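(* Consider a two-player zero-sum stochastic game $\langle S,A,r^1,r^2,p,\gamma\rangle$ in which both players follow the heterogeneous independent learning dynamics described in the context. Suppose that every state is visited infinitely often with probability $1$, and that the step sizes satisfy: (a) for each $i=1,2$: $\alpha_c^i\to 0$, $\beta_c^i\to 0$ and $\beta_c^i/\alpha_c^i\to 0$ as $c\to\infty$, and $\sum_{c=0}^\infty \alpha_c^i=\sum_{c=0}^\infty\beta_c^i=\infty$; (b) there are $i,j\in\{1,2\}$ (not necessarily equal) and $d_\alpha,d_\beta\in(0,1]$ such that $\lim_{c\to\infty}\alpha_c^i/\alpha_c^{-i}=d_\alpha$ and $\lim_{c\to\infty}\beta_c^j/\beta_c^{-j}=d_\beta$. If $\gamma< d_\alpha d_\beta$, then with probability $1$ we have $\pi_k^i\to\pi_*^i$ and $Q_k^i\to Q_*^i$ as $k\to\infty$ for each $i=1,2$, for some stationary equilibrium $\pi_*=(\pi_*^1,\pi_*^2)$ of the game and the associated $Q$-functions $(Q_*^1,Q_*^2)$.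
   Context: Game. $S$ is a finite set of states; $A=A^1\times A^2$ where $A^i$ is the finite action set of player $i$ (the same in every state); $r^i:S\times A\to\mathbb{R}$ is the stage payoff of player $i$; zero-sum means $r^1(s,a)+r^2(s,a)=0$ for all $(s,a)\in S\times A$; $p(s'|s,a)$ is the probability of moving from state $s$ to $s'$ when action profile $a=(a^1,a^2)$ is played; $\gamma\in[0,1)$ is the discount factor. The opponent of player $i$ is denoted $-i$. $\Delta(X)$ is the probability simplex over a finite set $X$, and a pure action is identified with the corresponding vertex of the simplex. Stationary equilibrium. A stationary strategy of player $i$ is a map $\pi^i:S\to\Delta(A^i)$. For a profile $\pi=(\pi^1,\pi^2)$ let $U^i(\pi)=\mathbb{E}\{\sum_{k=0}^\infty\gamma^k r^i(s_k,a_k)\}$, where $a_k\sim\pi(s_k)$ (independently across players) and $s_{k+1}\sim p(\cdot|s_k,a_k)$. A profile $\pi_*$ is a stationary (Nash) equilibrium if $U^i(\pi_* )\ge U^i(\pi^i,\pi_*^{-i})$ for every stationary strategy $\pi^i$ and $i=1,2$, for every initial state $s_0\in S$. The $Q$-function of player $i$ associated with $\pi_*$ is the unique $Q_*^i:S\times A\to\mathbb{R}$ with $$Q_*^i(s,a)=r^i(s,a)+\gamma\sum_{s'\in S}p(s'|s,a)\max_{\tilde a^i\in A^i}\mathbb{E}_{\tilde a^{-i}\sim\pi_*^{-i}(s')}\{Q_*^i(s',\tilde a)\},\quad\forall (s,a).$$ Learning dynamics. At stage $k=0,1,\ldots$ player $i$ holds a belief $\pi_k^{-i}:S\to\Delta(A^{-i})$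 about the opponent's strategy and a belief $Q_k^i:S\times A\to\mathbb{R}$ about her own $Q$-function (initial beliefs are arbitrary). At the current state $s_k$ she plays an action $$a_k^i\in\operatorname{argmax}_{a^i\in A^i}\mathbb{E}_{a^{-i}\sim\pi_k^{-i}(s_k)}\{Q_k^i(s_k,a)\},$$ observes the opponent's action $a_k^{-i}$, and the next state is $s_{k+1}\sim p(\cdot|s_k,a_k)$. She updates, for all $(s,a)$, $$\pi_{k+1}^{-i}(s)=\pi_k^{-i}(s)+\mathbb{I}_{\{s=s_k\}}\alpha^i_{c_k(s)}\,(a_k^{-i}-\pi_k^{-i}(s)),$$ $$Q_{k+1}^i(s,a)=Q_k^i(s,a)+\mathbb{I}_{\{s=s_k\}}\beta^i_{c_k(s)}\Big(r^i(s,a)+\gamma\sum_{s'\in S}p(s'|s,a)v_k^i(s')-Q_k^i(s,a)\Big),$$ where $v_k^i(s)=\max_{a^i\in A^i}\mathbb{E}_{a^{-i}\sim\pi_k^{-i}(s)}\{Q_k^i(s,a)\}$, $c_k(s)$ is the number of times state $s$ has been visited until stage $k$, and $\alpha_c^i,\beta_c^i\in(0,1)$ are player-dependent step sizes.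
   Formalization: Beliefs are shown to approach the set of stationary equilibria (all with the same limiting Q-functions), not one fixed equilibrium: with zero payoffs and arbitrary argmax selection beliefs can oscillate forever. If the equilibrium is unique, the stated convergence follows. *)

theory Defs
  imports "HOL-Probability.Probability"
begin

datatype player = P1 | P2

primrec opp :: "player \<Rightarrow> player" where
  "opp P1 = P2"
| "opp P2 = P1"

text \<open>
  The two players have separate finite action types \<open>'a\<close> and \<open>'b\<close>; payoffs, transitions and
  \<open>Q\<close>-functions take the state, the action of player 1 and the action of player 2, in this order.
  Notions that concern a single player are stated once, with own action first and opponent's
  action second, and are applied to player 2 through \<open>swap_actions\<close>.
\<close>

definition swap_actions :: "('s \<Rightarrow> 'a \<Rightarrow> 'b \<Rightarrow> 'c) \<Rightarrow> 's \<Rightarrow> 'b \<Rightarrow> 'a \<Rightarrow> 'c" where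
  "swap_actions f = (\<lambda>s b a. f s a b)"

definition zero_sum :: "('s \<Rightarrow> 'a \<Rightarrow> 'b \<Rightarrow> real) \<Rightarrow> ('s \<Rightarrow> 'a \<Rightarrow> 'b \<Rightarrow> real) \<Rightarrow> bool" where
  "zero_sum r1 r2 \<longleftrightarrow> (\<forall>s a b. r1 s a b + r2 s a b = 0)"


section \<open>Stationary strategies and stationary equilibrium\<close>

type_synonym ('s, 'x) strategy = "'s \<Rightarrow> 'x pmf"

definition stage_pmf ::
  "('s, 'a) strategy \<Rightarrow> ('s, 'b) strategy \<Rightarrow> 's \<Rightarrow> ('s \<times> 'a \<times> 'b) pmf" where
  "stage_pmf \<pi>1 \<pi>2 s = map_pmf (Pair s) (pair_pmf (\<pi>1 s) (\<pi>2 s))"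

text \<open>
  A play is a sequence of triples (state, action of player 1, action of player 2).  The kernel
  gives the law of the \<open>n\<close>-th triple in terms of the preceding ones.
\<close>

primrec play_kernel ::
  "('s \<Rightarrow> 'a \<Rightarrow> 'b \<Rightarrow> 's pmf) \<Rightarrow> ('s, 'a) strategy \<Rightarrow> ('s, 'b) strategy \<Rightarrow> 's \<Rightarrow>
    nat \<Rightarrow> (nat \<Rightarrow> 's \<times> 'a \<times> 'b) \<Rightarrow> ('s \<times> 'a \<times> 'b) measure" where
  "play_kernel p \<pi>1 \<pi>2 s0 0 = (\<lambda>\<omega>. measure_pmf (stage_pmf \<pi>1 \<pi>2 s0))"
| "play_kernel p \<pi>1 \<pi>2 s0 (Suc n) = (\<lambda>\<omega>. case \<omega> n of (s, a, b) \<Rightarrow>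
      measure_pmf (bind_pmf (p s a b) (stage_pmf \<pi>1 \<pi>2)))"

text \<open>The law of the play started in \<open>s0\<close>, obtained from the Ionescu-Tulcea theorem.\<close>

definition play_measure ::
  "('s \<Rightarrow> 'a \<Rightarrow> 'b \<Rightarrow> 's pmf) \<Rightarrow> ('s, 'a) strategy \<Rightarrow> ('s, 'b) strategy \<Rightarrow> 's \<Rightarrow>
    (nat \<Rightarrow> 's \<times> 'a \<times> 'b) measure" where
  "play_measure p \<pi>1 \<pi>2 s0 =
    projective_family.lim UNIV
      (Ionescu_Tulcea.CI (play_kernel p \<pi>1 \<pi>2 s0) (\<lambda>_. count_space UNIV))
      (\<lambda>_. count_space UNIV)"

lemma Ionescu_Tulcea_play_kernel:
  fixes p :: "'s::finite \<Rightarrow> 'a::finite \<Rightarrow> 'b::finite \<Rightarrow> 's pmf"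
  shows "Ionescu_Tulcea (play_kernel p \<pi>1 \<pi>2 s0) (\<lambda>_. count_space UNIV)"
proof (rule Ionescu_Tulcea.intro)
  fix i
  show "play_kernel p \<pi>1 \<pi>2 s0 i
    \<in> measurable (Pi\<^sub>M {0..<i} (\<lambda>_. count_space UNIV)) (subprob_algebra (count_space UNIV))"
  proof (cases i)
    case 0
    then show ?thesis
      by (simp add: measure_pmf_in_subprob_space)
  next
    case (Suc n)
    have comp: "(\<lambda>\<omega>. \<omega> n) \<in> measurable (Pi\<^sub>M {0..<Suc n} (\<lambda>_. count_space (UNIV :: ('s \<times> 'a \<times> 'b) set)))
        (count_space UNIV)"
      by (rule measurable_component_singleton) simp
    have "(\<lambda>t. case t of (s, a, b) \<Rightarrow> measure_pmf (bind_pmf (p s a b) (stage_pmf \<pi>1 \<pi>2)))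
        \<in> measurable (count_space UNIV) (subprob_algebra (count_space UNIV))"
      by (auto intro: measure_pmf_in_subprob_space)
    from measurable_compose[OF comp this] show ?thesis
      by (simp add: Suc)
  qed
next
  fix i x
  show "prob_space (play_kernel p \<pi>1 \<pi>2 s0 i x)"
    by (cases i) (auto simp: measure_pmf.prob_space_axioms split: prod.split)
qed

definition discounted_payoff ::
  "('s \<Rightarrow> 'a \<Rightarrow> 'b \<Rightarrow> real) \<Rightarrow> ('s \<Rightarrow> 'a \<Rightarrow> 'b \<Rightarrow> 's pmf) \<Rightarrow> real \<Rightarrow>
    ('s, 'a) strategy \<Rightarrow> ('s, 'b) strategy \<Rightarrow> 's \<Rightarrow> real" where
  "discounted_payoff r p \<gamma> \<pi>1 \<pi>2 s0 =
    (\<integral>\<omega>. (\<Sum>k. \<gamma> ^ k * (case \<omega> k of (s, a, b) \<Rightarrow> r s a b)) \<partial>play_measure p \<pi>1 \<pi>2 s0)"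

definition stationary_equilibrium ::
  "('s \<Rightarrow> 'a \<Rightarrow> 'b \<Rightarrow> real) \<Rightarrow> ('s \<Rightarrow> 'a \<Rightarrow> 'b \<Rightarrow> real) \<Rightarrow> ('s \<Rightarrow> 'a \<Rightarrow> 'b \<Rightarrow> 's pmf) \<Rightarrow>
    real \<Rightarrow> ('s, 'a) strategy \<Rightarrow> ('s, 'b) strategy \<Rightarrow> bool" where
  "stationary_equilibrium r1 r2 p \<gamma> \<pi>1 \<pi>2 \<longleftrightarrow>
    (\<forall>s0. (\<forall>\<sigma>1. discounted_payoff r1 p \<gamma> \<pi>1 \<pi>2 s0 \<ge> discounted_payoff r1 p \<gamma> \<sigma>1 \<pi>2 s0) \<and>
          (\<forall>\<sigma>2. discounted_payoff r2 p \<gamma> \<pi>1 \<pi>2 s0 \<ge> discounted_payoff r2 p \<gamma> \<pi>1 \<sigma>2 s0))"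


section \<open>Best-response values and \<open>Q\<close>-functions of one player\<close>

definition action_value :: "('x \<Rightarrow> 'y \<Rightarrow> real) \<Rightarrow> 'y pmf \<Rightarrow> 'x \<Rightarrow> real" where
  "action_value q \<mu> x = measure_pmf.expectation \<mu> (\<lambda>y. q x y)"

definition best_value :: "('x::finite \<Rightarrow> 'y \<Rightarrow> real) \<Rightarrow> 'y pmf \<Rightarrow> real" where
  "best_value q \<mu> = (MAX x. action_value q \<mu> x)"

text \<open>
  \<open>Q\<close> is the \<open>Q\<close>-function of a player whose opponent uses \<open>\<mu>\<close>; the equation has exactly one
  solution when \<open>0 \<le> \<gamma> < 1\<close>.
\<close>

definition is_Q_function ::
  "('s::finite \<Rightarrow> 'x::finite \<Rightarrow> 'y \<Rightarrow> real) \<Rightarrow> ('s \<Rightarrow> 'x \<Rightarrow> 'y \<Rightarrow> 's pmf) \<Rightarrow> real \<Rightarrow>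
    ('s, 'y) strategy \<Rightarrow> ('s \<Rightarrow> 'x \<Rightarrow> 'y \<Rightarrow> real) \<Rightarrow> bool" where
  "is_Q_function r p \<gamma> \<mu> Q \<longleftrightarrow>
    (\<forall>s x y. Q s x y = r s x y + \<gamma> * (\<Sum>s'\<in>UNIV. pmf (p s x y) s' * best_value (Q s') (\<mu> s')))"


section \<open>Learning dynamics\<close>

text \<open>
  The current stage is not counted, so that the step sizes used at the successive visits to a
  state are those with index \<open>0, 1, 2, \<dots>\<close>.
\<close>

definition visits :: "(nat \<Rightarrow> 's) \<Rightarrow> nat \<Rightarrow> 's \<Rightarrow> nat" where
  "visits \<sigma> k s = card {l. l < k \<and> \<sigma> l = s}"

text \<open>
  One player's learning rule along one realisation: \<open>\<sigma>\<close> is the state sequence, \<open>x\<close> and \<open>y\<close> the own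
  and the opponent's action sequences, \<open>\<mu>\<close> the beliefs about the opponent's strategy, \<open>Q\<close> the
  beliefs about the own \<open>Q\<close>-function.  Any selection from the argmax is allowed.  Since beliefs are
  of type \<open>pmf\<close>, their update is written in terms of the probabilities of the single actions.
\<close>

definition learning_path ::
  "('s::finite \<Rightarrow> 'x::finite \<Rightarrow> 'y \<Rightarrow> real) \<Rightarrow> ('s \<Rightarrow> 'x \<Rightarrow> 'y \<Rightarrow> 's pmf) \<Rightarrow> real \<Rightarrow>
    (nat \<Rightarrow> real) \<Rightarrow> (nat \<Rightarrow> real) \<Rightarrow> (nat \<Rightarrow> 's) \<Rightarrow> (nat \<Rightarrow> 'x) \<Rightarrow> (nat \<Rightarrow> 'y) \<Rightarrow>
    (nat \<Rightarrow> ('s, 'y) strategy) \<Rightarrow> (nat \<Rightarrow> 's \<Rightarrow> 'x \<Rightarrow> 'y \<Rightarrow> real) \<Rightarrow> bool" where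
  "learning_path r p \<gamma> \<alpha> \<beta> \<sigma> x y \<mu> Q \<longleftrightarrow> (\<forall>k.
    is_arg_max (action_value (Q k (\<sigma> k)) (\<mu> k (\<sigma> k))) (\<lambda>_. True) (x k) \<and>
    (\<forall>s y'. pmf (\<mu> (Suc k) s) y' = pmf (\<mu> k s) y' +
      of_bool (s = \<sigma> k) * \<alpha> (visits \<sigma> k s) * (pmf (return_pmf (y k)) y' - pmf (\<mu> k s) y')) \<and>
    (\<forall>s x' y'. Q (Suc k) s x' y' = Q k s x' y' +
      of_bool (s = \<sigma> k) * \<beta> (visits \<sigma> k s) *
        (r s x' y' + \<gamma> * (\<Sum>s'\<in>UNIV. pmf (p s x' y') s' * best_value (Q k s') (\<mu> k s'))
          - Q k s x' y')))"

text \<open>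
  The filtration \<open>F k\<close> describes the history up to stage \<open>k\<close>, including the actions of stage \<open>k\<close>.
  It may be larger than the one generated by states and actions, so that arbitrary (also
  randomised) tie-breaking and random initial beliefs are covered.  \<open>\<pi>1\<close> is the belief of player 2
  about player 1, and \<open>\<pi>2\<close> the belief of player 1 about player 2.
\<close>

locale learning_dynamics = prob_space M + filtration "space M" F
  for M :: "'w measure" and F :: "nat \<Rightarrow> 'w measure" +
  fixes r1 r2 :: "'s::finite \<Rightarrow> 'a::finite \<Rightarrow> 'b::finite \<Rightarrow> real"
    and p :: "'s \<Rightarrow> 'a \<Rightarrow> 'b \<Rightarrow> 's pmf"
    and \<gamma> :: real
    and \<alpha> \<beta> :: "player \<Rightarrow> nat \<Rightarrow> real"
    and S :: "nat \<Rightarrow> 'w \<Rightarrow> 's"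
    and A1 :: "nat \<Rightarrow> 'w \<Rightarrow> 'a"
    and A2 :: "nat \<Rightarrow> 'w \<Rightarrow> 'b"
    and \<pi>1 :: "nat \<Rightarrow> 'w \<Rightarrow> ('s, 'a) strategy"
    and \<pi>2 :: "nat \<Rightarrow> 'w \<Rightarrow> ('s, 'b) strategy"
    and Q1 Q2 :: "nat \<Rightarrow> 'w \<Rightarrow> 's \<Rightarrow> 'a \<Rightarrow> 'b \<Rightarrow> real"
  assumes subalgebra_F: "subalgebra M (F k)"
    and S_measurable: "S k \<in> measurable (F k) (count_space UNIV)"
    and A1_measurable: "A1 k \<in> measurable (F k) (count_space UNIV)"
    and A2_measurable: "A2 k \<in> measurable (F k) (count_space UNIV)"
    and \<pi>1_0_measurable: "(\<lambda>\<omega>. pmf (\<pi>1 0 \<omega> s) a) \<in> borel_measurable (F 0)"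
    and \<pi>2_0_measurable: "(\<lambda>\<omega>. pmf (\<pi>2 0 \<omega> s) b) \<in> borel_measurable (F 0)"
    and Q1_0_measurable: "(\<lambda>\<omega>. Q1 0 \<omega> s a b) \<in> borel_measurable (F 0)"
    and Q2_0_measurable: "(\<lambda>\<omega>. Q2 0 \<omega> s a b) \<in> borel_measurable (F 0)"
    and transition: "AE \<omega> in M. real_cond_exp M (F k) (indicator {\<omega> \<in> space M. S (Suc k) \<omega> = s'}) \<omega>
          = pmf (p (S k \<omega>) (A1 k \<omega>) (A2 k \<omega>)) s'"
    and path1: "\<omega> \<in> space M \<Longrightarrow>
      learning_path r1 p \<gamma> (\<alpha> P1) (\<beta> P1)
        (\<lambda>k. S k \<omega>) (\<lambda>k. A1 k \<omega>) (\<lambda>k. A2 k \<omega>) (\<lambda>k. \<pi>2 k \<omega>) (\<lambda>k. Q1 k \<omega>)"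
    and path2: "\<omega> \<in> space M \<Longrightarrow>
      learning_path (swap_actions r2) (swap_actions p) \<gamma> (\<alpha> P2) (\<beta> P2)
        (\<lambda>k. S k \<omega>) (\<lambda>k. A2 k \<omega>) (\<lambda>k. A1 k \<omega>) (\<lambda>k. \<pi>1 k \<omega>) (\<lambda>k. swap_actions (Q2 k \<omega>))"

text \<open>
  Belief profiles can in general only be claimed to approach the set of stationary equilibria, i.e.
  to be asymptotically equal to a sequence of equilibria \<open>(e1 k, e2 k)\<close>, all having the same
  associated \<open>Q\<close>-functions.  If \<open>r1 = r2 = 0\<close> and the initial \<open>Q\<close>-beliefs are \<open>0\<close>, then every action is
  always in the argmax and tie-breaking can make the beliefs oscillate forever.  When the equilibrium
  is unique, \<open>e1\<close> and \<open>e2\<close> are constant and the beliefs converge to it.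
\<close>

end

theory Submission
  imports Defs
begin

text \<open>
  Once every state is visited infinitely often, the claim holds along each single realisation: the
  transition probabilities enter the updates only through expected continuation values, so no
  random noise has to be averaged out. The argument is therefore a deterministic analysis of one
  path, with the step size of a state set to zero at the stages at which the state is not visited.

  Let \<open>w\<close> be the value vector of the game (the solution of Shapley's equation) and \<open>Q*\<close> the
  continuation payoff that belongs to it. Let \<open>Q1\<close>, \<open>Q2\<close> be the beliefs of the players about their
  \<open>Q\<close>-functions and \<open>v1\<close>, \<open>v2\<close> the best-reply values that they expect. Three facts carry the proof.

  \<^item> Lower bounds. A best reply to any belief secures at least the value of the matrix game, so each
    \<open>Q\<close>-belief dominates an asynchronous value iteration. That iteration is a contraction; hence
    \<open>Q1 - Q*\<close>, \<open>Q2 + Q*\<close>, \<open>v1 - w\<close> and \<open>v2 + w\<close> are asymptotically nonnegative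
    (\<open>Q_asymptotic_lower_bound\<close>).

  \<^item> Fast timescale. While the \<open>Q\<close>-beliefs are almost constant, the strategy beliefs perform
    fictitious play in a state. With \<open>\<rho>\<close> the limit of the ratio of the two step sizes, the function
    \<open>(v1 - w) + \<rho> (v2 + w)\<close> is, in continuous time, driven by \<open>(Q1 + Q2)(a, b) - (v1 + v2)\<close>. Since both
    summands are nonnegative in the limit, \<open>v1 + v2\<close> exceeds \<open>max (Q1 + Q2)\<close> at most by the factor
    \<open>1/d\<alpha>\<close> (\<open>fictitious_play_limsup\<close>, \<open>belief_timescale_bound\<close>).

  \<^item> Slow timescale. The same weighting, applied to the two \<open>Q\<close>-updates, bounds \<open>Q1 + Q2\<close> by
    \<open>\<gamma>/d\<beta>\<close> times the bound on \<open>v1 + v2\<close> (\<open>coupled_relaxation_limsup\<close>, \<open>Q_timescale_bound\<close>).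

  Together, an asymptotic bound on \<open>Q1 + Q2\<close> improves by the factor \<open>\<gamma>/(d\<alpha> d\<beta>) < 1\<close>, so \<open>Q1 + Q2\<close>
  tends to \<open>0\<close>, and with the lower bounds \<open>Q1\<close> tends to \<open>Q*\<close>, \<open>Q2\<close> to \<open>-Q*\<close>, \<open>v1\<close> to \<open>w\<close> and
  \<open>v2\<close> to \<open>-w\<close>. By compactness the strategy beliefs approach the optimal strategies of the matrix
  games \<open>Q* s\<close>, and profiles of such strategies are stationary equilibria.

  The delicate point is that the continuous-time derivative above is wrong for a single discrete
  step: when the best reply switches, the best-reply value changes by an amount of the same order as
  the step. That these errors cancel over long windows is proved by the induction on the number of
  actions with which Robinson proved the convergence of fictitious play
  (\<open>ex_growth_constant_for_card\<close>). It yields the minimax theorem as a by-product.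
\<close>

section \<open>Relaxation of real sequences\<close>

text \<open>
  The excess over \<open>c\<close> shrinks by the factor \<open>1 - g k \<le> exp (- g k)\<close> in each step, and the exponents
  add up to infinity.
\<close>

lemma eventually_le_of_relaxation:
  fixes X g :: "nat \<Rightarrow> real"
  assumes step: "\<forall>\<^sub>F k in sequentially. X (Suc k) \<le> X k + g k * (c - X k)"
    and g: "\<And>k. 0 \<le> g k" "\<And>k. g k \<le> 1"
    and div: "filterlim (\<lambda>n. \<Sum>k<n. g k) at_top sequentially"
    and e: "0 < e"
  shows "\<forall>\<^sub>F k in sequentially. X k \<le> c + e"
proof -
  obtain N where N: "\<And>k. k \<ge> N \<Longrightarrow> X (Suc k) \<le> X k + g k * (c - X k)"
    using step by (auto simp: eventually_sequentially)
  define D where "D k = max 0 (X k - c)" for k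
  let ?t = "\<lambda>n. \<Sum>k<n. g k"
  have D0: "0 \<le> D k" for k by (simp add: D_def)
  have Dstep: "D (Suc k) \<le> exp (- g k) * D k" if "k \<ge> N" for k
  proof -
    have "X (Suc k) - c \<le> (1 - g k) * (X k - c)"
      using N[OF that] by (simp add: algebra_simps)
    also have "\<dots> \<le> (1 - g k) * D k"
      by (intro mult_left_mono) (use g in \<open>auto simp: D_def\<close>)
    finally have "D (Suc k) \<le> (1 - g k) * D k"
      using D0 g by (simp add: D_def)
    also have "\<dots> \<le> exp (- g k) * D k"
      using exp_ge_add_one_self[of "- g k"] by (intro mult_right_mono D0) auto
    finally show ?thesis .
  qed
  have bound: "D n \<le> exp (?t N - ?t n) * D N" if "n \<ge> N" for n
    using that
  proof (induction rule: dec_induct)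
    case (step n)
    have "D (Suc n) \<le> exp (- g n) * (exp (?t N - ?t n) * D N)"
      using Dstep[OF step(1)] mult_left_mono[OF step(3) exp_ge_zero[of "- g n"]] by linarith
    also have "\<dots> = exp (?t N - ?t (Suc n)) * D N"
      by (simp add: exp_add[symmetric] algebra_simps flip: mult.assoc)
    finally show ?case .
  qed simp
  have "filterlim (\<lambda>n. - ?t N + ?t n) at_top sequentially"
    by (rule filterlim_tendsto_add_at_top[OF tendsto_const div])
  then have "filterlim (\<lambda>n. ?t N - ?t n) at_bot sequentially"
    unfolding filterlim_uminus_at_bot by simp
  then have "(\<lambda>n. exp (?t N - ?t n)) \<longlonglongrightarrow> 0"
    by (rule filterlim_compose[OF exp_at_bot])
  then have "(\<lambda>n. exp (?t N - ?t n) * D N) \<longlonglongrightarrow> 0"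
    by (rule tendsto_mult_left_zero)
  then have "\<forall>\<^sub>F n in sequentially. exp (?t N - ?t n) * D N < e"
    using e by (rule order_tendstoD)
  then show ?thesis
    using eventually_ge_at_top[of N]
  proof eventually_elim
    case (elim n)
    then show ?case using bound[of n] by (simp add: D_def)
  qed
qed

text \<open>
  Applied to "the number is an asymptotic bound on the deviation". With the slack \<open>(1 - \<kappa>) * (e / 2)\<close> in
  each round, the bounds converge geometrically to the fixed point \<open>e / 2\<close>.
\<close>

lemma contraction_of_bounds:
  fixes P :: "real \<Rightarrow> bool"
  assumes start: "P c0" and mono: "\<And>c d. P c \<Longrightarrow> c \<le> d \<Longrightarrow> P d"
    and step: "\<And>c e. 0 \<le> c \<Longrightarrow> 0 < e \<Longrightarrow> P c \<Longrightarrow> P (\<kappa> * c + e)"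
    and \<kappa>: "0 \<le> \<kappa>" "\<kappa> < 1" and e: "0 < e"
  shows "P e"
proof -
  define c where "c = max 0 c0"
  define f where "f = (1 - \<kappa>) * (e / 2)"
  have f: "0 < f" using \<kappa> e by (simp add: f_def)
  have c: "0 \<le> c" "P c" using mono[OF start] by (auto simp: c_def)
  have iter: "P (\<kappa> ^ n * c + e / 2)" for n
  proof (induction n)
    case 0
    then show ?case using c e by (auto intro: mono)
  next
    case (Suc n)
    have "P (\<kappa> * (\<kappa> ^ n * c + e / 2) + f)"
      using Suc f c e \<kappa> by (intro step) auto
    moreover have "\<kappa> * (\<kappa> ^ n * c + e / 2) + f = \<kappa> ^ Suc n * c + e / 2"
      by (simp add: f_def field_simps)
    ultimately show ?case by simp
  qed
  have "(\<lambda>n. \<kappa> ^ n * c) \<longlonglongrightarrow> 0"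
    using \<kappa> by (intro tendsto_mult_left_zero LIMSEQ_power_zero) simp
  then have "\<forall>\<^sub>F n in sequentially. \<kappa> ^ n * c < e / 2"
    using e by (intro order_tendstoD(2)[where a="e/2"]) auto
  then obtain n where "\<kappa> ^ n * c < e / 2"
    by (auto simp: eventually_sequentially)
  then show ?thesis using iter[of n] mono by force
qed

text \<open>
  Cutting off a last window of prescribed duration reduces a statement about the end point \<open>m\<close> to the
  same statement about an earlier end point; this drives the inductions below.
\<close>

lemma last_window:
  fixes h :: "nat \<Rightarrow> real"
  assumes "n \<le> m" and "\<And>k. n \<le> k \<Longrightarrow> k < m \<Longrightarrow> h k \<le> H" and "0 < \<tau>" and "\<tau> \<le> (\<Sum>k=n..<m. h k)"
  obtains n' where "n \<le> n'" "n' < m" "\<tau> \<le> (\<Sum>k=n'..<m. h k)" "(\<Sum>k=n'..<m. h k) \<le> \<tau> + H"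
proof -
  define Z where "Z = {l. n \<le> l \<and> l \<le> m \<and> \<tau> \<le> (\<Sum>k=l..<m. h k)}"
  have Z: "finite Z" "n \<in> Z"
    using assms by (auto simp: Z_def)
  define n' where "n' = Max Z"
  have "n' \<in> Z" using Z Max_in by (auto simp: n'_def)
  then have 1: "n \<le> n'" "n' \<le> m" "\<tau> \<le> (\<Sum>k=n'..<m. h k)"
    by (auto simp: Z_def)
  with \<open>0 < \<tau>\<close> have 2: "n' < m"
    by (cases "n' = m") auto
  have "Suc n' \<notin> Z" using Max_ge[OF Z(1), of "Suc n'"] by (auto simp: n'_def)
  then have "(\<Sum>k=Suc n'..<m. h k) < \<tau>"
    using 1 2 by (auto simp: Z_def)
  then have "(\<Sum>k=n'..<m. h k) \<le> \<tau> + H"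
    using assms(2)[of n'] 1 2 by (simp add: sum.atLeast_Suc_lessThan[OF 2])
  with 1 2 that show thesis by blast
qed

text \<open>
  The relaxation inequality is required only for the net change over windows of duration between \<open>\<tau>\<close>
  and \<open>2 * \<tau>\<close>. As long as \<open>L\<close> is above \<open>M * c + e\<close>, every window lowers it by at least a fixed amount,
  so it gets below that level at some time. Afterwards, windows that start above \<open>M * c\<close> do not raise
  it, and from below \<open>M * c\<close> it climbs by at most \<open>2 * C * \<tau>\<close> within a window.
\<close>

lemma eventually_le_of_window_relaxation:
  fixes L h :: "nat \<Rightarrow> real"
  assumes h: "\<And>k. 0 \<le> h k" and H: "\<And>k. h k \<le> 1"
    and div: "filterlim (\<lambda>n. \<Sum>k<n. h k) at_top sequentially"
    and h0: "h \<longlonglongrightarrow> 0"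
    and lip: "\<forall>\<^sub>F k in sequentially. \<bar>L (Suc k) - L k\<bar> \<le> C * h k"
    and C: "0 \<le> C"
    and \<tau>: "0 < \<tau>" and M: "1 \<le> M" and e: "0 < e"
    and window: "\<forall>\<^sub>F n in sequentially. \<forall>m\<ge>n. \<tau> \<le> (\<Sum>k=n..<m. h k) \<longrightarrow> (\<Sum>k=n..<m. h k) \<le> 2 * \<tau> \<longrightarrow>
       L m \<le> L n + (c - L n / M) * (\<Sum>k=n..<m. h k)"
  shows "\<forall>\<^sub>F k in sequentially. L k \<le> M * c + 2 * C * \<tau> + e"
proof -
  have "\<forall>\<^sub>F k in sequentially. h k < \<tau>"
    using h0 \<tau> by (rule order_tendstoD)
  with window lip have "\<forall>\<^sub>F n in sequentially. h n < \<tau> \<and> \<bar>L (Suc n) - L n\<bar> \<le> C * h n \<and> (\<forall>m\<ge>n. \<tau> \<le> (\<Sum>k=n..<m. h k) \<longrightarrow> (\<Sum>k=n..<m. h k) \<le> 2 * \<tau> \<longrightarrow>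
       L m \<le> L n + (c - L n / M) * (\<Sum>k=n..<m. h k))"
    by eventually_elim blast
  then obtain N where hN: "\<And>n. n \<ge> N \<Longrightarrow> h n < \<tau>" and lipN: "\<And>n. n \<ge> N \<Longrightarrow> \<bar>L (Suc n) - L n\<bar> \<le> C * h n"
    and N: "\<And>n m. n \<ge> N \<Longrightarrow> n \<le> m \<Longrightarrow> \<tau> \<le> (\<Sum>k=n..<m. h k) \<Longrightarrow> (\<Sum>k=n..<m. h k) \<le> 2 * \<tau> \<Longrightarrow>
       L m \<le> L n + (c - L n / M) * (\<Sum>k=n..<m. h k)"
    by (auto simp: eventually_sequentially)
  have lips: "\<bar>L m - L n\<bar> \<le> C * (\<Sum>k=n..<m. h k)" if "N \<le> n" "n \<le> m" for n m
    using that(2)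
  proof (induction rule: dec_induct)
    case (step m)
    have "\<bar>L (Suc m) - L n\<bar> \<le> \<bar>L (Suc m) - L m\<bar> + \<bar>L m - L n\<bar>" by simp
    also have "\<dots> \<le> C * h m + C * (\<Sum>k=n..<m. h k)" using step lipN[of m] that(1) by simp
    finally show ?case using step by (simp add: algebra_simps)
  qed simp
  have win: "\<exists>l. n \<le> l \<and> l < m \<and> \<tau> \<le> (\<Sum>k=l..<m. h k) \<and> (\<Sum>k=l..<m. h k) \<le> 2 * \<tau>"
    if "N \<le> n" "n \<le> m" "\<tau> \<le> (\<Sum>k=n..<m. h k)" for n m
  proof -
    have "h k \<le> \<tau>" if "n \<le> k" for k using hN[of k] that \<open>N \<le> n\<close> by simp
    with that(3) obtain l where "n \<le> l" "l < m" "\<tau> \<le> (\<Sum>k=l..<m. h k)" "(\<Sum>k=l..<m. h k) \<le> \<tau> + \<tau>"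
      using last_window[OF \<open>n \<le> m\<close> _ \<tau>, of h \<tau>] by blast
    then show ?thesis by (intro exI[of _ l]) simp
  qed
  have sums: "(\<Sum>k=n..<m. h k) = (\<Sum>k=n..<l. h k) + (\<Sum>k=l..<m. h k)" if "n \<le> l" "l \<le> m" for n l m
    using sum.atLeastLessThan_concat[OF that, of h] by simp
  have "\<exists>n\<ge>N. L n \<le> M * c + e"
  proof (rule ccontr)
    assume "\<not> ?thesis"
    then have above: "L n > M * c + e" if "n \<ge> N" for n
      using that by force
    let ?X = "2 * \<tau> * (C + e / M)"
    \<comment> \<open>The constant \<open>?X\<close> absorbs the initial piece that is shorter than a window.\<close>
    have down: "L m \<le> L N + ?X - (e / M) * (\<Sum>k=N..<m. h k)" if "N \<le> m" for m
      using that
    proof (induction m rule: less_induct)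
      case (less m)
      show ?case
      proof (cases "\<tau> \<le> (\<Sum>k=N..<m. h k)")
        case True
        then obtain l where l: "N \<le> l" "l < m" "\<tau> \<le> (\<Sum>k=l..<m. h k)" "(\<Sum>k=l..<m. h k) \<le> 2 * \<tau>"
          using win[of N m] less.prems by auto
        have "M * c + e \<le> L l" using above[OF l(1)] by simp
        then have "(M * c + e) / M \<le> L l / M"
          using M by (intro divide_right_mono) auto
        then have "c - L l / M \<le> - (e / M)"
          using M by (simp add: add_divide_distrib)
        then have "(c - L l / M) * (\<Sum>k=l..<m. h k) \<le> - (e / M) * (\<Sum>k=l..<m. h k)"
          by (rule mult_right_mono) (use l \<tau> in auto)
        with N[OF l(1) _ l(3,4)] l(2)
        have "L m \<le> L l - (e / M) * (\<Sum>k=l..<m. h k)" by simp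
        also have "\<dots> \<le> L N + ?X - (e / M) * (\<Sum>k=N..<l. h k) - (e / M) * (\<Sum>k=l..<m. h k)"
          using less.IH[OF l(2,1)] by simp
        also have "\<dots> = L N + ?X - (e / M) * (\<Sum>k=N..<m. h k)"
          using sums[of N l m] l by (simp add: algebra_simps)
        finally show ?thesis .
      next
        case False
        let ?T = "\<Sum>k=N..<m. h k"
        have "L m + (e / M) * ?T \<le> L N + (C + e / M) * ?T"
          using lips[OF order_refl less.prems] by (simp add: algebra_simps)
        also have "(C + e / M) * ?T \<le> (C + e / M) * (2 * \<tau>)"
          using False C e M \<tau> by (intro mult_left_mono) auto
        finally show ?thesis by (simp add: algebra_simps)
      qed
    qed
    have "\<forall>\<^sub>F m in sequentially. (\<Sum>k<m. h k) \<ge> (\<Sum>k<N. h k) + (M / e) * (L N + ?X - M * c)"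
      using div by (simp add: filterlim_at_top)
    with eventually_ge_at_top[of N] have "\<forall>\<^sub>F m in sequentially. m \<ge> N \<and> (\<Sum>k<m. h k) \<ge> (\<Sum>k<N. h k) + (M / e) * (L N + ?X - M * c)"
      by eventually_elim blast
    then obtain m where m: "m \<ge> N" "(\<Sum>k<m. h k) \<ge> (\<Sum>k<N. h k) + (M / e) * (L N + ?X - M * c)"
      by (auto simp: eventually_sequentially)
    have "(\<Sum>k=N..<m. h k) \<ge> (M / e) * (L N + ?X - M * c)"
      using sums[of 0 N m] m by (simp add: atLeast0LessThan)
    then have "(e / M) * (\<Sum>k=N..<m. h k) \<ge> (e / M) * ((M / e) * (L N + ?X - M * c))"
      using e M by (intro mult_left_mono) auto
    then have "(e / M) * (\<Sum>k=N..<m. h k) \<ge> L N + ?X - M * c"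
      using e M by simp
    with down[OF m(1)] above[OF m(1)] e show False by simp
  qed
  then obtain n where n: "n \<ge> N" "L n \<le> M * c + e" by auto
  have "L m \<le> M * c + 2 * C * \<tau> + e" if "m \<ge> n" for m
    using that
  proof (induction m rule: less_induct)
    case (less m)
    have close: "L m \<le> L l + 2 * C * \<tau>" if "N \<le> l" "l \<le> m" "(\<Sum>k=l..<m. h k) \<le> 2 * \<tau>" for l
      using lips[OF that(1,2)] mult_left_mono[OF that(3) C] by (simp add: algebra_simps)
    show ?case
    proof (cases "\<tau> \<le> (\<Sum>k=n..<m. h k)")
      case True
      then obtain l where l: "n \<le> l" "l < m" "\<tau> \<le> (\<Sum>k=l..<m. h k)" "(\<Sum>k=l..<m. h k) \<le> 2 * \<tau>"
        using win[of n m] less.prems n by auto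
      show ?thesis
      proof (cases "L l \<le> M * c")
        case True
        then show ?thesis using close[of l] l n e by simp
      next
        case False
        then have "(c - L l / M) * (\<Sum>k=l..<m. h k) \<le> 0"
          using M l \<tau> by (intro mult_nonpos_nonneg) (auto simp: field_simps)
        with N[of l m] n l have "L m \<le> L l" by simp
        with less.IH[of l] l show ?thesis by simp
      qed
    next
      case False
      then show ?thesis using close[of n] n less.prems \<tau> by simp
    qed
  qed
  then show ?thesis by (auto simp: eventually_sequentially)
qed

section \<open>Growth of best replies in fictitious play\<close>

text \<open>
  \<open>F k\<close> and \<open>G k\<close> are the payoffs that the two players expect from each action, and \<open>x k\<close>, \<open>y k\<close> are
  best replies. An increment is controlled by the payoff matrix only for the actions played between
  \<open>n\<close> and \<open>m\<close>, and only from above. For an action that is not played, a Lipschitz bound has to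
  suffice: its expected payoff drifts towards its actual payoff from a level that may be far below
  the best-reply value.
\<close>

definition fictitious_play_system ::
  "'a set \<Rightarrow> 'b set \<Rightarrow> ('a \<Rightarrow> 'b \<Rightarrow> real) \<Rightarrow> ('a \<Rightarrow> 'b \<Rightarrow> real) \<Rightarrow> real \<Rightarrow> (nat \<Rightarrow> real) \<Rightarrow>
    (nat \<Rightarrow> 'a \<Rightarrow> real) \<Rightarrow> (nat \<Rightarrow> 'b \<Rightarrow> real) \<Rightarrow> (nat \<Rightarrow> 'a) \<Rightarrow> (nat \<Rightarrow> 'b) \<Rightarrow> nat \<Rightarrow> nat \<Rightarrow> bool" where
  "fictitious_play_system I J A B C h F G x y n m \<longleftrightarrow>
    (\<forall>k\<in>{n..m}. x k \<in> I \<and> (\<forall>i\<in>I. F k i \<le> F k (x k))) \<and>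
    (\<forall>k\<in>{n..m}. y k \<in> J \<and> (\<forall>j\<in>J. G k j \<le> G k (y k))) \<and>
    (\<forall>k\<in>{n..<m}. (\<forall>i\<in>I. \<bar>F (Suc k) i - F k i\<bar> \<le> C * h k) \<and> (\<forall>j\<in>J. \<bar>G (Suc k) j - G k j\<bar> \<le> C * h k)) \<and>
    (\<forall>k\<in>{n..<m}. \<forall>l\<in>{n..<m}. F (Suc k) (x l) - F k (x l) \<le> h k * A (x l) (y k)) \<and>
    (\<forall>k\<in>{n..<m}. \<forall>l\<in>{n..<m}. G (Suc k) (y l) - G k (y l) \<le> h k * B (x k) (y l))"

lemma fictitious_play_system_subinterval:
  assumes "fictitious_play_system I J A B C h F G x y n m" "n \<le> n'" "m' \<le> m"
  shows "fictitious_play_system I J A B C h F G x y n' m'"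
  using assms unfolding fictitious_play_system_def by auto

lemma telescope_le:
  fixes f g :: "nat \<Rightarrow> real"
  assumes "n \<le> m" "\<And>k. n \<le> k \<Longrightarrow> k < m \<Longrightarrow> f (Suc k) - f k \<le> g k"
  shows "f m - f n \<le> (\<Sum>k=n..<m. g k)"
  using assms
proof (induction m rule: dec_induct)
  case (step k)
  have "f (Suc k) - f k \<le> g k" using step by simp
  moreover have "f k - f n \<le> (\<Sum>l=n..<k. g l)" using step by simp
  ultimately show ?case using sum.atLeastLessThan_Suc[OF step(1), of g] by linarith
qed simp

lemma telescope_abs_le:
  fixes f g :: "nat \<Rightarrow> real"
  assumes "n \<le> m" "\<And>k. n \<le> k \<Longrightarrow> k < m \<Longrightarrow> \<bar>f (Suc k) - f k\<bar> \<le> g k"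
  shows "\<bar>f m - f n\<bar> \<le> (\<Sum>k=n..<m. g k)"
proof -
  have "f m - f n \<le> (\<Sum>k=n..<m. g k)"
    using assms by (intro telescope_le) (auto dest: abs_le_D1)
  moreover have "- f m - - f n \<le> (\<Sum>k=n..<m. g k)"
    using assms by (intro telescope_le) (auto simp: abs_le_iff)
  ultimately show ?thesis by simp
qed

text \<open>
  If at time \<open>m\<close> every action is optimal up to \<open>\<delta>\<close>, the best-reply values may be replaced by the
  average, with weights \<open>h\<close>, of the payoffs of the actions played between \<open>n\<close> and \<open>m\<close>. The averaged
  increments of both players run over the same pairs of actions, so only \<open>A + B\<close> enters.
\<close>

lemma growth_if_all_nearly_optimal:
  assumes sys: "fictitious_play_system I J A B C h F G x y n m"
    and nm: "n \<le> m" and h: "\<And>k. 0 \<le> h k" and T: "0 < (\<Sum>k=n..<m. h k)"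
    and AB: "\<And>i j. i \<in> I \<Longrightarrow> j \<in> J \<Longrightarrow> A i j + B i j \<le> \<zeta>"
    and F: "\<And>i. i \<in> I \<Longrightarrow> F m (x m) \<le> F m i + \<delta>"
    and G: "\<And>j. j \<in> J \<Longrightarrow> G m (y m) \<le> G m j + \<delta>"
  shows "F m (x m) + G m (y m) \<le> F n (x n) + G n (y n) + \<zeta> * (\<Sum>k=n..<m. h k) + 2 * \<delta>"
proof -
  define K where "K = {n..<m}"
  define T where "T = (\<Sum>k\<in>K. h k)"
  let ?R = "F m (x m) - F n (x n) - \<delta>" and ?S = "G m (y m) - G n (y n) - \<delta>"
  have x: "x k \<in> I" "F n (x k) \<le> F n (x n)" if "k \<in> K" for k
    using sys that unfolding fictitious_play_system_def K_def by auto
  have y: "y k \<in> J" "G n (y k) \<le> G n (y n)" if "k \<in> K" for k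
    using sys that unfolding fictitious_play_system_def K_def by auto
  have R: "?R \<le> (\<Sum>l\<in>K. h l * A (x k) (y l))" if k: "k \<in> K" for k
  proof -
    have "F m (x k) - F n (x k) \<le> (\<Sum>l\<in>K. h l * A (x k) (y l))"
      unfolding K_def using sys k nm
      by (intro telescope_le) (auto simp: fictitious_play_system_def K_def)
    then show ?thesis using F[OF x(1)[OF k]] x(2)[OF k] by simp
  qed
  have S: "?S \<le> (\<Sum>l\<in>K. h l * B (x l) (y k))" if k: "k \<in> K" for k
  proof -
    have "G m (y k) - G n (y k) \<le> (\<Sum>l\<in>K. h l * B (x l) (y k))"
      unfolding K_def using sys k nm
      by (intro telescope_le) (auto simp: fictitious_play_system_def K_def)
    then show ?thesis using G[OF y(1)[OF k]] y(2)[OF k] by simp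
  qed
  have "T * ?R = (\<Sum>k\<in>K. h k * ?R)" by (simp add: T_def sum_distrib_right)
  also have "\<dots> \<le> (\<Sum>k\<in>K. h k * (\<Sum>l\<in>K. h l * A (x k) (y l)))"
    by (intro sum_mono mult_left_mono R h)
  finally have 1: "T * ?R \<le> (\<Sum>k\<in>K. \<Sum>l\<in>K. h k * h l * A (x k) (y l))"
    by (simp add: sum_distrib_left mult.assoc)
  have "T * ?S = (\<Sum>k\<in>K. h k * ?S)" by (simp add: T_def sum_distrib_right)
  also have "\<dots> \<le> (\<Sum>k\<in>K. h k * (\<Sum>l\<in>K. h l * B (x l) (y k)))"
    by (intro sum_mono mult_left_mono S h)
  also have "\<dots> = (\<Sum>l\<in>K. \<Sum>k\<in>K. h k * h l * B (x l) (y k))"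
    by (subst sum.swap) (simp add: sum_distrib_left mult.assoc)
  also have "\<dots> = (\<Sum>k\<in>K. \<Sum>l\<in>K. h k * h l * B (x k) (y l))"
    by (simp add: mult.commute mult.left_commute)
  finally have 2: "T * ?S \<le> (\<Sum>k\<in>K. \<Sum>l\<in>K. h k * h l * B (x k) (y l))" .
  have "T * (?R + ?S) = T * ?R + T * ?S" by (rule distrib_left)
  also have "\<dots> \<le> (\<Sum>k\<in>K. \<Sum>l\<in>K. h k * h l * A (x k) (y l)) + (\<Sum>k\<in>K. \<Sum>l\<in>K. h k * h l * B (x k) (y l))"
    by (rule add_mono[OF 1 2])
  also have "\<dots> = (\<Sum>k\<in>K. \<Sum>l\<in>K. h k * h l * (A (x k) (y l) + B (x k) (y l)))"
    by (simp add: distrib_left sum.distrib)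
  also have "\<dots> \<le> (\<Sum>k\<in>K. \<Sum>l\<in>K. h k * h l * \<zeta>)"
    by (intro sum_mono mult_left_mono AB x y) (auto simp: h)
  also have "\<dots> = T * (T * \<zeta>)"
    by (simp add: T_def sum_distrib_left sum_distrib_right mult_ac)
  finally have "?R + ?S \<le> T * \<zeta>"
    using T by (simp add: T_def K_def)
  then show ?thesis by (simp add: T_def K_def mult.commute)
qed

text \<open>
  In continuous time the sum of the two best-reply values grows at most at the rate \<open>\<zeta>\<close>. For step
  sizes bounded by \<open>H\<close>, the rate may be exceeded by \<open>\<epsilon>\<close>, and the error \<open>K * H\<close> does not depend on the
  duration, the initial payoffs and the matrices.
\<close>

definition growth_constant :: "'a set \<Rightarrow> 'b set \<Rightarrow> real \<Rightarrow> real \<Rightarrow> real \<Rightarrow> bool" where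
  "growth_constant I J C \<epsilon> K \<longleftrightarrow> (\<forall>A B h F G x y n m H \<zeta>.
    fictitious_play_system I J A B C h F G x y n m \<longrightarrow> n \<le> m \<longrightarrow> (\<forall>k. 0 \<le> h k) \<longrightarrow>
    (\<forall>k\<in>{n..<m}. h k \<le> H) \<longrightarrow> 0 < H \<longrightarrow> - 2 * C \<le> \<zeta> \<longrightarrow> (\<forall>i\<in>I. \<forall>j\<in>J. A i j + B i j \<le> \<zeta>) \<longrightarrow>
    F m (x m) + G m (y m) \<le> F n (x n) + G n (y n) + (\<zeta> + \<epsilon>) * (\<Sum>k=n..<m. h k) + K * H)"

lemma growth_constantD:
  assumes "growth_constant I J C \<epsilon> K" "fictitious_play_system I J A B C h F G x y n m" "n \<le> m"
    and "\<And>k. 0 \<le> h k" "\<And>k. k \<in> {n..<m} \<Longrightarrow> h k \<le> H" "0 < H" "- 2 * C \<le> \<zeta>"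
    and "\<And>i j. i \<in> I \<Longrightarrow> j \<in> J \<Longrightarrow> A i j + B i j \<le> \<zeta>"
  shows "F m (x m) + G m (y m) \<le> F n (x n) + G n (y n) + (\<zeta> + \<epsilon>) * (\<Sum>k=n..<m. h k) + K * H"
  using assms unfolding growth_constant_def by simp

text \<open>
  Robinson's induction. Consider a last window whose duration is a suitable multiple of \<open>H\<close>. If some
  action is never a best reply in it, the players play a smaller game there, and the induction
  hypothesis bounds the growth over the window; the multiple is chosen so that its constant \<open>K' * H\<close>
  costs no more than the rate \<open>\<epsilon> / 2\<close> over the window. The part before the window is handled by
  induction on the end point. If, on the other hand, every action is a best reply at some time of the
  window, then by Lipschitz continuity all actions are nearly optimal at the end, and
  \<open>growth_if_all_nearly_optimal\<close> bounds the growth since time \<open>n\<close> at once, whatever happened before.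
\<close>

theorem ex_growth_constant_for_card:
  assumes C: "0 \<le> C" and \<epsilon>: "0 < \<epsilon>"
  shows "\<exists>K\<ge>0. \<forall>(I::'a set) (J::'b set). finite I \<longrightarrow> finite J \<longrightarrow> card I + card J \<le> N \<longrightarrow> growth_constant I J C \<epsilon> K"
  using \<epsilon>
proof (induction N arbitrary: \<epsilon>)
  case 0
  have "growth_constant I J C \<epsilon> 0" if "finite I" "finite J" "card I + card J \<le> 0" for I :: "'a set" and J :: "'b set"
    using that by (auto simp: growth_constant_def fictitious_play_system_def)
  then show ?case by (intro exI[of _ 0]) blast
next
  case (Suc N)
  have "0 < \<epsilon> / 2" using Suc.prems by simp
  from Suc.IH[OF this] obtain K' where K': "0 \<le> K'" and IH: "\<And>(I::'a set) (J::'b set). finite I \<Longrightarrow> finite J \<Longrightarrow>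
      card I + card J \<le> N \<Longrightarrow> growth_constant I J C (\<epsilon> / 2) K'" by blast
  \<comment> \<open>\<open>w * H\<close> is the duration of a window: over it, the rate \<open>\<epsilon> / 2\<close> pays for \<open>K' * H\<close>.\<close>
  define w where "w = 2 * K' / \<epsilon> + 1"
  have w: "1 \<le> w" "K' \<le> (\<epsilon> / 2) * w"
    using K' Suc.prems by (auto simp: w_def field_simps)
  define K where "K = 8 * C * (w + 1)"
  have K: "0 \<le> K" using C w by (simp add: K_def)
  have "F m (x m) + G m (y m) \<le> F n (x n) + G n (y n) + (\<zeta> + \<epsilon>) * (\<Sum>k=n..<m. h k) + K * H"
    if fin: "finite I" "finite J" and card: "card I + card J \<le> Suc N"
      and h: "\<And>k. 0 \<le> h k" and hH: "\<forall>k\<in>{n..<m}. h k \<le> H" and H: "0 < H" and nm: "n \<le> m" and \<zeta>: "- 2 * C \<le> \<zeta>"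
      and AB: "\<And>i j. i \<in> I \<Longrightarrow> j \<in> J \<Longrightarrow> A i j + B i j \<le> \<zeta>"
      and sys: "fictitious_play_system I J A B C h F G x y n m"
    for I :: "'a set" and J :: "'b set" and A B \<zeta> H h F G x y n m
    using nm hH sys
  proof (induction m rule: less_induct)
    case (less m)
    note sys = less.prems(3)
    have xy: "x k \<in> I" "\<And>i. i \<in> I \<Longrightarrow> F k i \<le> F k (x k)" "y k \<in> J" "\<And>j. j \<in> J \<Longrightarrow> G k j \<le> G k (y k)"
      if "n \<le> k" "k \<le> m" for k
      using sys that by (auto simp: fictitious_play_system_def)
    have lip: "\<bar>F l i - F k i\<bar> \<le> C * (\<Sum>q=k..<l. h q)" "\<bar>G l j - G k j\<bar> \<le> C * (\<Sum>q=k..<l. h q)"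
      if "n \<le> k" "k \<le> l" "l \<le> m" "i \<in> I" "j \<in> J" for k l i j
      unfolding sum_distrib_left using sys that
      by (auto intro!: telescope_abs_le simp: fictitious_play_system_def)
    show ?case
    proof (cases "w * H \<le> (\<Sum>k=n..<m. h k)")
      case False
      let ?T = "\<Sum>k=n..<m. h k"
      have T: "0 \<le> ?T" by (intro sum_nonneg h)
      have "F m (x m) \<le> F n (x n) + C * ?T" "G m (y m) \<le> G n (y n) + C * ?T"
        using lip(1)[of n m "x m" "y m"] lip(2)[of n m "x m" "y m"] xy(1,3)[of m] xy(2)[of n "x m"] xy(4)[of n "y m"] less.prems(1)
        by auto
      moreover have "(- 2 * C) * ?T \<le> (\<zeta> + \<epsilon>) * ?T"
        using \<zeta> Suc.prems T by (intro mult_right_mono) auto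
      moreover have "4 * C * ?T \<le> 4 * C * (w * H)"
        using False C by (intro mult_left_mono) auto
      moreover have "4 * C * (w * H) \<le> K * H"
        using C H w by (simp add: K_def algebra_simps)
      ultimately show ?thesis by (simp add: algebra_simps)
    next
      case True
      have "0 < w * H" using w H by simp
      moreover have "h k \<le> H" if "n \<le> k" "k < m" for k using less.prems(2) that by simp
      ultimately obtain l where l: "n \<le> l" "l < m" "w * H \<le> (\<Sum>k=l..<m. h k)" "(\<Sum>k=l..<m. h k) \<le> w * H + H"
        using last_window[OF less.prems(1) _ _ True] by blast
      let ?T = "\<Sum>k=l..<m. h k"
      have Tl: "(\<Sum>k=n..<m. h k) = (\<Sum>k=n..<l. h k) + ?T"
        using sum.atLeastLessThan_concat[of n l m h] l by simp
      note sysl = fictitious_play_system_subinterval[OF sys l(1) order_refl]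
      have smaller: ?thesis
        if sys': "fictitious_play_system I' J' A B C h F G x y l m" and sub: "I' \<subseteq> I" "J' \<subseteq> J"
          "card I' + card J' < card I + card J" for I' J'
      proof -
        have "F m (x m) + G m (y m) \<le> F l (x l) + G l (y l) + (\<zeta> + \<epsilon> / 2) * ?T + K' * H"
        proof (rule growth_constantD[OF IH sys'])
          show "finite I'" "finite J'" "card I' + card J' \<le> N"
            using sub fin card by (auto intro: finite_subset)
          show "A i j + B i j \<le> \<zeta>" if "i \<in> I'" "j \<in> J'" for i j
            using that sub by (intro AB) auto
        qed (use h H \<zeta> sub less.prems(2) l in auto)
        moreover have "K' * H \<le> (\<epsilon> / 2) * w * H"
          using w H by (intro mult_right_mono) auto
        moreover have "(\<epsilon> / 2) * (w * H) \<le> (\<epsilon> / 2) * ?T"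
          using l Suc.prems by (intro mult_left_mono) auto
        moreover have "F l (x l) + G l (y l) \<le> F n (x n) + G n (y n) + (\<zeta> + \<epsilon>) * (\<Sum>k=n..<l. h k) + K * H"
          using less.IH[OF l(2,1)] fictitious_play_system_subinterval[OF sys order_refl] less.prems(2) l by simp
        ultimately show ?thesis unfolding Tl by (simp add: algebra_simps)
      qed
      consider (row) i where "i \<in> I" "\<forall>k\<in>{l..m}. F k i < F k (x k)"
        | (col) j where "j \<in> J" "\<forall>k\<in>{l..m}. G k j < G k (y k)"
        | (all) "\<forall>i\<in>I. \<exists>k\<in>{l..m}. F k (x k) \<le> F k i" "\<forall>j\<in>J. \<exists>k\<in>{l..m}. G k (y k) \<le> G k j"
        by (meson not_le)
      then show ?thesis
      proof cases
        case row
        then have "fictitious_play_system (I - {i}) J A B C h F G x y l m"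
          using sysl by (auto simp: fictitious_play_system_def)
        then show ?thesis
          by (rule smaller) (use card_Diff1_less[OF fin(1) row(1)] in auto)
      next
        case col
        then have "fictitious_play_system I (J - {j}) A B C h F G x y l m"
          using sysl by (auto simp: fictitious_play_system_def)
        then show ?thesis
          by (rule smaller) (use card_Diff1_less[OF fin(2) col(1)] in auto)
      next
        case all
        define \<delta> where "\<delta> = 2 * C * ((w + 1) * H)"
        have near: "2 * C * (\<Sum>q=k..<m. h q) \<le> \<delta>" if "l \<le> k" for k
        proof -
          have "(\<Sum>q=k..<m. h q) \<le> ?T"
            using that by (intro sum_mono2) (auto simp: h)
          also have "\<dots> \<le> (w + 1) * H" using l by (simp add: algebra_simps)
          finally show ?thesis unfolding \<delta>_def using C by (intro mult_left_mono) auto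
        qed
        have "F m (x m) \<le> F m i + \<delta>" if i: "i \<in> I" for i
        proof -
          obtain k where k: "l \<le> k" "k \<le> m" "F k (x k) \<le> F k i" using bspec[OF all(1) i] by auto
          have nk: "n \<le> k" "n \<le> m" using k l by auto
          show ?thesis
            using lip(1)[OF nk(1) k(2) order_refl i xy(3)[OF nk(2) order_refl]]
              lip(1)[OF nk(1) k(2) order_refl xy(1)[OF nk(2) order_refl] xy(3)[OF nk(2) order_refl]]
              k(3) xy(2)[OF nk(1) k(2) xy(1)[OF nk(2) order_refl]] near[OF k(1)]
            by (simp add: abs_le_iff)
        qed
        moreover have "G m (y m) \<le> G m j + \<delta>" if j: "j \<in> J" for j
        proof -
          obtain k where k: "l \<le> k" "k \<le> m" "G k (y k) \<le> G k j" using bspec[OF all(2) j] by auto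
          have nk: "n \<le> k" "n \<le> m" using k l by auto
          show ?thesis
            using lip(2)[OF nk(1) k(2) order_refl xy(1)[OF nk(2) order_refl] j]
              lip(2)[OF nk(1) k(2) order_refl xy(1)[OF nk(2) order_refl] xy(3)[OF nk(2) order_refl]]
              k(3) xy(4)[OF nk(1) k(2) xy(3)[OF nk(2) order_refl]] near[OF k(1)]
            by (simp add: abs_le_iff)
        qed
        moreover have "0 < (\<Sum>k=n..<m. h k)"
          using True w H by (smt (verit) mult_pos_pos)
        ultimately have "F m (x m) + G m (y m) \<le> F n (x n) + G n (y n) + \<zeta> * (\<Sum>k=n..<m. h k) + 2 * \<delta>"
          using less.prems(1) h AB by (intro growth_if_all_nearly_optimal[OF sys])
        moreover have "2 * \<delta> \<le> K * H"
          using C H w by (simp add: \<delta>_def K_def algebra_simps)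
        moreover have "0 \<le> \<epsilon> * (\<Sum>k=n..<m. h k)"
          using Suc.prems by (intro mult_nonneg_nonneg sum_nonneg h) auto
        ultimately show ?thesis by (simp add: algebra_simps)
      qed
    qed
  qed
  then have "growth_constant I J C \<epsilon> K" if "finite I" "finite J" "card I + card J \<le> Suc N" for I :: "'a set" and J :: "'b set"
    unfolding growth_constant_def using that by blast
  then show ?case using K by (intro exI[of _ K]) blast
qed

corollary ex_growth_constant:
  fixes C :: real
  assumes "0 \<le> C" "0 < \<epsilon>"
  obtains K where "0 \<le> K" "growth_constant (UNIV :: 'a::finite set) (UNIV :: 'b::finite set) C \<epsilon> K"
proof -
  obtain K where K: "0 \<le> K" "\<forall>(I::'a set) (J::'b set). finite I \<longrightarrow> finite J \<longrightarrow>
      card I + card J \<le> CARD('a) + CARD('b) \<longrightarrow> growth_constant I J C \<epsilon> K"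
    using ex_growth_constant_for_card[OF assms] by blast
  show thesis by (rule that[OF K(1)]) (simp add: K(2))
qed

section \<open>Asymptotic bounds on the two timescales\<close>

text \<open>
  The dynamics control \<open>u + \<rho> * w\<close>, the argument needs \<open>u + w\<close>. Passing from one to the other costs a
  constant factor, provided that both summands are almost nonnegative.
\<close>

lemma weighted_sum_bounds:
  fixes u w \<rho> \<delta> :: real
  assumes "0 < \<rho>" "- \<delta> \<le> u" "- \<delta> \<le> w" "0 \<le> \<delta>"
  shows "u + \<rho> * w \<le> max 1 \<rho> * (u + w + 2 * \<delta>)"
    and "min 1 \<rho> * (u + w) \<le> u + \<rho> * w + 2 * max 1 \<rho> * \<delta>"
proof -
  have a: "(u + \<delta>) \<le> max 1 \<rho> * (u + \<delta>)" "\<rho> * (w + \<delta>) \<le> max 1 \<rho> * (w + \<delta>)"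
    using assms mult_right_mono[of 1 "max 1 \<rho>" "u + \<delta>"] mult_right_mono[of \<rho> "max 1 \<rho>" "w + \<delta>"] by auto
  have b: "min 1 \<rho> * (u + \<delta>) \<le> u + \<delta>" "min 1 \<rho> * (w + \<delta>) \<le> \<rho> * (w + \<delta>)"
    using assms mult_right_mono[of "min 1 \<rho>" 1 "u + \<delta>"] mult_right_mono[of "min 1 \<rho>" \<rho> "w + \<delta>"] by auto
  have c: "\<delta> \<le> max 1 \<rho> * \<delta>" "\<rho> * \<delta> \<le> max 1 \<rho> * \<delta>" "0 \<le> min 1 \<rho> * \<delta>" "0 \<le> \<rho> * \<delta>"
    using assms mult_right_mono[of 1 "max 1 \<rho>" "\<delta>"] mult_right_mono[of \<rho> "max 1 \<rho>" "\<delta>"] by auto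
  show "u + \<rho> * w \<le> max 1 \<rho> * (u + w + 2 * \<delta>)"
    using a c assms(4) by (simp add: distrib_left distrib_right del: max_mult_distrib_left max_mult_distrib_right)
  show "min 1 \<rho> * (u + w) \<le> u + \<rho> * w + 2 * max 1 \<rho> * \<delta>"
    using b c assms(4) by (simp add: distrib_left distrib_right)
qed

text \<open>
  The weight \<open>\<mu>\<close> compensates the ratio of the step sizes, so that \<open>p + \<mu> * q\<close> is driven by
  \<open>(U + W) - (p + q)\<close> at the common rate \<open>g\<close>. Replacing \<open>p + q\<close> by a multiple of \<open>p + \<mu> * q\<close> makes this
  a relaxation.
\<close>

lemma coupled_relaxation_limsup:
  fixes p q U W g :: "nat \<Rightarrow> real"
  assumes g: "\<And>k. 0 \<le> g k" "\<And>k. g k \<le> 1"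
    and div: "filterlim (\<lambda>n. \<Sum>k<n. g k) at_top sequentially"
    and \<mu>: "0 < \<mu>"
    and dp: "\<And>\<epsilon>. 0 < \<epsilon> \<Longrightarrow> \<forall>\<^sub>F k in sequentially. \<bar>p (Suc k) - p k - g k * (U k - p k)\<bar> \<le> \<epsilon> * g k"
    and dq: "\<And>\<epsilon>. 0 < \<epsilon> \<Longrightarrow> \<forall>\<^sub>F k in sequentially. \<bar>\<mu> * (q (Suc k) - q k) - g k * (W k - q k)\<bar> \<le> \<epsilon> * g k"
    and p: "\<And>\<delta>. 0 < \<delta> \<Longrightarrow> \<forall>\<^sub>F k in sequentially. - \<delta> \<le> p k"
    and q: "\<And>\<delta>. 0 < \<delta> \<Longrightarrow> \<forall>\<^sub>F k in sequentially. - \<delta> \<le> q k"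
    and UW: "\<forall>\<^sub>F k in sequentially. U k + W k \<le> c"
    and e: "0 < e"
  shows "\<forall>\<^sub>F k in sequentially. p k + q k \<le> max 1 \<mu> / min 1 \<mu> * c + e"
proof -
  define M where "M = max 1 \<mu>"
  define m where "m = min 1 \<mu>"
  have M: "1 \<le> M" and m: "0 < m" using \<mu> by (auto simp: M_def m_def)
  \<comment> \<open>All error tolerances are set to \<open>t\<close>; they sum up to \<open>t * (6 * M + 1) / m = e\<close>.\<close>
  define t where "t = e * m / (6 * M + 1)"
  have t: "0 < t" using e m M by (simp add: t_def)
  have te: "t * (6 * M + 1) = e * m" using M by (simp add: t_def)
  let ?N = "\<lambda>k. p k + \<mu> * q k" and ?c = "M * (c + 4 * t)"
  note ws = weighted_sum_bounds[OF \<mu>, of t, folded M_def m_def]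
  have "\<forall>\<^sub>F k in sequentially. ?N (Suc k) \<le> ?N k + g k / M * (?c - ?N k)"
    using dp[OF t] dq[OF t] p[OF t] q[OF t] UW
  proof eventually_elim
    case (elim k)
    have "?N k \<le> M * (p k + q k + 2 * t)" using ws(1) elim t by simp
    then have "?N k / M \<le> p k + q k + 2 * t"
      using M by (simp add: divide_le_eq mult.commute)
    then have "U k + W k - (p k + q k) + 2 * t \<le> (?c - ?N k) / M"
      using elim(5) M by (simp add: diff_divide_distrib)
    then have "g k * (U k + W k - (p k + q k) + 2 * t) \<le> g k * ((?c - ?N k) / M)"
      by (rule mult_left_mono) (rule g)
    moreover have "p (Suc k) - p k \<le> g k * (U k - p k) + t * g k" using elim(1) by linarith
    moreover have "\<mu> * q (Suc k) - \<mu> * q k \<le> g k * (W k - q k) + t * g k"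
      using elim(2) unfolding right_diff_distrib[of \<mu>] by linarith
    ultimately have "?N (Suc k) \<le> ?N k + g k * ((?c - ?N k) / M)" by (simp add: algebra_simps)
    then show ?case by simp
  qed
  moreover have "filterlim (\<lambda>n. \<Sum>k<n. g k / M) at_top sequentially"
    using filterlim_tendsto_pos_mult_at_top[OF tendsto_const _ div, of "1 / M"] M
    by (simp add: sum_divide_distrib)
  moreover have "g k / M \<le> 1" for k using g(2)[of k] M by (simp add: divide_le_eq)
  ultimately have "\<forall>\<^sub>F k in sequentially. ?N k \<le> ?c + t"
    using M g(1) t by (intro eventually_le_of_relaxation[where g="\<lambda>k. g k / M"]) auto
  with p[OF t] q[OF t] show ?thesis
  proof eventually_elim
    case (elim k)
    have "m * (p k + q k) \<le> ?N k + 2 * M * t" using ws(2) elim t by simp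
    also have "\<dots> \<le> M * c + t * (6 * M + 1)" using elim by (simp add: algebra_simps)
    also have "\<dots> = M * c + e * m" by (simp only: te)
    finally have "p k + q k \<le> (M * c + e * m) / m" using m by (simp add: le_divide_eq mult.commute)
    also have "\<dots> = M / m * c + e" using m by (simp add: add_divide_distrib)
    finally show ?case by (simp add: M_def m_def)
  qed
qed

lemma maximum_change:
  fixes f g :: "'a \<Rightarrow> real"
  assumes "\<And>i. \<bar>g i - f i\<bar> \<le> c" "\<And>i. f i \<le> f x" "\<And>i. g i \<le> g x'"
  shows "\<bar>g x' - f x\<bar> \<le> c"
  using assms(1)[of x'] assms(1)[of x] assms(2)[of x'] assms(3)[of x] by linarith

text \<open>
  Fictitious play for slowly varying matrices \<open>A k\<close> and \<open>B k\<close>, where the player with payoffs \<open>G\<close> updates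
  beliefs \<open>1 / \<rho>\<close> times as fast as the other one. Over a short window that starts at \<open>n\<close>, the pair \<open>F\<close>,
  \<open>\<rho> * G\<close> is a \<open>fictitious_play_system\<close> for the matrices \<open>A n\<close> and \<open>B n\<close>, each reduced by the
  best-reply value at \<open>n\<close>: an action that is played within the window has expected payoff close to that
  value all the time, so its drift is nearly the same for all such actions. The growth bound then says
  that \<open>F k (x k) + \<rho> * G k (y k)\<close> changes at a rate of at most \<open>\<zeta>\<close> minus the sum of the best-reply
  values, which is a relaxation over windows.
\<close>

lemma fictitious_play_limsup:
  fixes F :: "nat \<Rightarrow> 'a::finite \<Rightarrow> real" and G :: "nat \<Rightarrow> 'b::finite \<Rightarrow> real"
    and A B :: "nat \<Rightarrow> 'a \<Rightarrow> 'b \<Rightarrow> real"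
  assumes h: "\<And>k. 0 \<le> h k" "\<And>k. h k \<le> 1" "h \<longlonglongrightarrow> 0"
    and div: "filterlim (\<lambda>n. \<Sum>k<n. h k) at_top sequentially"
    and \<rho>: "0 < \<rho>"
    and x: "\<And>k i. F k i \<le> F k (x k)" and y: "\<And>k j. G k j \<le> G k (y k)"
    and D: "1 \<le> D" "\<And>k i. \<bar>F k i\<bar> \<le> D" "\<And>k j. \<bar>G k j\<bar> \<le> D" "\<And>k i j. \<bar>A k i j\<bar> \<le> D" "\<And>k i j. \<bar>B k i j\<bar> \<le> D"
    and dF: "\<And>\<epsilon>. 0 < \<epsilon> \<Longrightarrow> \<forall>\<^sub>F k in sequentially. \<forall>i. \<bar>F (Suc k) i - F k i - h k * (A k i (y k) - F k i)\<bar> \<le> \<epsilon> * h k"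
    and dG: "\<And>\<epsilon>. 0 < \<epsilon> \<Longrightarrow> \<forall>\<^sub>F k in sequentially. \<forall>j. \<bar>\<rho> * (G (Suc k) j - G k j) - h k * (B k (x k) j - G k j)\<bar> \<le> \<epsilon> * h k"
    and dA: "\<And>\<epsilon>. 0 < \<epsilon> \<Longrightarrow> \<forall>\<^sub>F k in sequentially. \<forall>i j. \<bar>A (Suc k) i j - A k i j\<bar> \<le> \<epsilon> * h k"
    and dB: "\<And>\<epsilon>. 0 < \<epsilon> \<Longrightarrow> \<forall>\<^sub>F k in sequentially. \<forall>i j. \<bar>B (Suc k) i j - B k i j\<bar> \<le> \<epsilon> * h k"
    and lowF: "\<And>\<delta>. 0 < \<delta> \<Longrightarrow> \<forall>\<^sub>F k in sequentially. - \<delta> \<le> F k (x k)"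
    and lowG: "\<And>\<delta>. 0 < \<delta> \<Longrightarrow> \<forall>\<^sub>F k in sequentially. - \<delta> \<le> G k (y k)"
    and AB: "\<forall>\<^sub>F k in sequentially. \<forall>i j. A k i j + B k i j \<le> \<zeta>" and \<zeta>: "0 \<le> \<zeta>"
    and e: "0 < e"
  shows "\<forall>\<^sub>F k in sequentially. F k (x k) + G k (y k) \<le> max 1 \<rho> / min 1 \<rho> * \<zeta> + e"
proof -
  define M where "M = max 1 \<rho>"
  define m where "m = min 1 \<rho>"
  have M: "1 \<le> M" and m: "0 < m" using \<rho> by (auto simp: M_def m_def)
  define \<kappa> where "\<kappa> = 15 * D * (1 + 1 / \<rho>)"
  have \<kappa>: "15 * D \<le> \<kappa>" "3 + 12 * D / \<rho> \<le> \<kappa>" "0 \<le> \<kappa>"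
  proof -
    have "12 * D / \<rho> \<le> 15 * D / \<rho>" "0 \<le> 15 * D / \<rho>"
      using D(1) \<rho> by (auto intro: divide_right_mono)
    moreover have "\<kappa> = 15 * D + 15 * D / \<rho>" by (simp add: \<kappa>_def distrib_left)
    ultimately show "15 * D \<le> \<kappa>" "3 + 12 * D / \<rho> \<le> \<kappa>" "0 \<le> \<kappa>"
      using D(1) by linarith+
  qed
  \<comment> \<open>The tolerances and the duration of a window are set to \<open>t\<close>; the resulting errors sum up to
    \<open>t * R / m \<le> e\<close>.\<close>
  define R where "R = M * (2 * \<kappa> + 4) + 12 * D + 1 + 2 * M"
  have R: "0 < R" using M \<kappa> D(1) by (simp add: R_def add_pos_nonneg add_nonneg_pos)
  define t where "t = min 1 (e * m / R)"
  have t: "0 < t" "t \<le> 1" using e m R by (auto simp: t_def)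
  have te: "t * R \<le> e * m" using R by (simp add: t_def min_def field_simps)
  let ?u = "\<lambda>k. F k (x k)" and ?w = "\<lambda>k. G k (y k)"
  let ?L = "\<lambda>k. ?u k + \<rho> * ?w k" and ?c = "\<zeta> + (2 * \<kappa> + 4) * t"
  note ws = weighted_sum_bounds[OF \<rho>, of t, folded M_def m_def]

  have "0 \<le> 3 * D" using D by simp
  obtain K where K: "0 \<le> K" and growth: "growth_constant (UNIV :: 'a set) (UNIV :: 'b set) (3 * D) t K"
    using ex_growth_constant[OF \<open>0 \<le> 3 * D\<close> t(1)] by blast

  \<comment> \<open>Steps below \<open>H\<close> make the constant error \<open>K * H\<close> of the growth bound small compared with the
    duration \<open>t\<close> of a window.\<close>
  define H where "H = t * t / (K + 1)"
  have H: "0 < H" "K * H \<le> t * t"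
    using t K by (auto simp: H_def field_simps)
  have "\<forall>\<^sub>F k in sequentially. h k < H" using h(3) H(1) by (rule order_tendstoD)
  then have "\<forall>\<^sub>F k in sequentially. h k \<le> H" by eventually_elim simp
  then have "\<forall>\<^sub>F k in sequentially. (h k \<le> H \<and> - t \<le> ?u k \<and> - t \<le> ?w k) \<and> (\<forall>i j. A k i j + B k i j \<le> \<zeta>) \<and>
      (\<forall>i. \<bar>F (Suc k) i - F k i - h k * (A k i (y k) - F k i)\<bar> \<le> t * h k) \<and>
      (\<forall>j. \<bar>\<rho> * (G (Suc k) j - G k j) - h k * (B k (x k) j - G k j)\<bar> \<le> t * h k) \<and>
      (\<forall>i j. \<bar>A (Suc k) i j - A k i j\<bar> \<le> t * h k) \<and> (\<forall>i j. \<bar>B (Suc k) i j - B k i j\<bar> \<le> t * h k)"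
    using lowF[OF t(1)] lowG[OF t(1)] AB dF[OF t(1)] dG[OF t(1)] dA[OF t(1)] dB[OF t(1)]
    by eventually_elim (intro conjI)
  then obtain N where N0: "\<forall>k\<ge>N. (h k \<le> H \<and> - t \<le> ?u k \<and> - t \<le> ?w k) \<and> (\<forall>i j. A k i j + B k i j \<le> \<zeta>) \<and>
      (\<forall>i. \<bar>F (Suc k) i - F k i - h k * (A k i (y k) - F k i)\<bar> \<le> t * h k) \<and>
      (\<forall>j. \<bar>\<rho> * (G (Suc k) j - G k j) - h k * (B k (x k) j - G k j)\<bar> \<le> t * h k) \<and>
      (\<forall>i j. \<bar>A (Suc k) i j - A k i j\<bar> \<le> t * h k) \<and> (\<forall>i j. \<bar>B (Suc k) i j - B k i j\<bar> \<le> t * h k)"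
    unfolding eventually_sequentially by (elim exE) (rule that)
  note N1 = N0[THEN spec, THEN mp]
  have N: "\<And>k. N \<le> k \<Longrightarrow> h k \<le> H" "\<And>k. N \<le> k \<Longrightarrow> - t \<le> ?u k" "\<And>k. N \<le> k \<Longrightarrow> - t \<le> ?w k"
    using N1[THEN conjunct1] by simp_all
  note N = N N1[THEN conjunct2, THEN conjunct1, rule_format]
    N1[THEN conjunct2, THEN conjunct2, THEN conjunct1, rule_format]
    N1[THEN conjunct2, THEN conjunct2, THEN conjunct2, THEN conjunct1, rule_format]
    N1[THEN conjunct2, THEN conjunct2, THEN conjunct2, THEN conjunct2, THEN conjunct1, rule_format]
    N1[THEN conjunct2, THEN conjunct2, THEN conjunct2, THEN conjunct2, THEN conjunct2, rule_format]

  have small: "\<bar>h k * (a - b)\<bar> \<le> 2 * D * h k" if "\<bar>a\<bar> \<le> D" "\<bar>b\<bar> \<le> D" for a b k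
  proof -
    have "\<bar>a - b\<bar> * h k \<le> (2 * D) * h k" using that h(1) by (intro mult_right_mono) auto
    then show ?thesis using h(1)[of k] by (simp add: abs_mult mult.commute)
  qed
  have th: "t * h k \<le> D * h k" for k
    using t D(1) h(1) by (intro mult_right_mono) auto
  have lipF: "\<bar>F (Suc k) i - F k i\<bar> \<le> 3 * D * h k" if "N \<le> k" for k i
    using N(5)[OF that, of i] small[OF D(4,2), of k k i "y k" k i] th[of k] by linarith
  have lipG: "\<bar>\<rho> * G (Suc k) j - \<rho> * G k j\<bar> \<le> 3 * D * h k" if "N \<le> k" for k j
    using N(6)[OF that, of j] small[OF D(5,3), of k k "x k" j k j] th[of k]
    unfolding right_diff_distrib[of \<rho>] by linarith
  have lip_range:
    "\<bar>F l i - F k i\<bar> \<le> 3 * D * (\<Sum>q=k..<l. h q)" "\<bar>\<rho> * G l j - \<rho> * G k j\<bar> \<le> 3 * D * (\<Sum>q=k..<l. h q)"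
    "\<bar>A l i j - A k i j\<bar> \<le> t * (\<Sum>q=k..<l. h q)" "\<bar>B l i j - B k i j\<bar> \<le> t * (\<Sum>q=k..<l. h q)"
    if "N \<le> k" "k \<le> l" for k l i j
    unfolding sum_distrib_left using that
    by (auto intro!: telescope_abs_le lipF lipG N(7,8))

  have lipL: "\<bar>?L (Suc k) - ?L k\<bar> \<le> 6 * D * h k" if "N \<le> k" for k
  proof -
    have "\<bar>?u (Suc k) - ?u k\<bar> \<le> 3 * D * h k"
      by (rule maximum_change[where f="F k"]) (use lipF[OF that] x in auto)
    moreover have "\<bar>\<rho> * ?w (Suc k) - \<rho> * ?w k\<bar> \<le> 3 * D * h k"
      by (rule maximum_change[where f="\<lambda>j. \<rho> * G k j" and g="\<lambda>j. \<rho> * G (Suc k) j"])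
        (use lipG[OF that] y \<rho> in auto)
    ultimately show ?thesis by simp
  qed

  have window: "?L m \<le> ?L n + (?c - ?L n / M) * (\<Sum>k=n..<m. h k)"
    if nm: "N \<le> n" "n \<le> m" and T: "t \<le> (\<Sum>k=n..<m. h k)" "(\<Sum>k=n..<m. h k) \<le> 2 * t" for n m
  proof -
    let ?T = "\<Sum>k=n..<m. h k"
    have sub: "(\<Sum>q=k..<l. h q) \<le> 2 * t" if "n \<le> k" "l \<le> m" for k l
    proof -
      have "(\<Sum>q=k..<l. h q) \<le> ?T" using that by (intro sum_mono2) (auto simp: h)
      then show ?thesis using T by simp
    qed
    have closeF: "\<bar>F l i - F k i\<bar> \<le> 6 * D * t" if "n \<le> k" "k \<le> m" "n \<le> l" "l \<le> m" for k l i
    proof -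
      have *: "\<bar>F l i - F k i\<bar> \<le> 6 * D * t" if "n \<le> k" "k \<le> l" "l \<le> m" for k l
      proof -
        have "3 * D * (\<Sum>q=k..<l. h q) \<le> 3 * D * (2 * t)"
          using sub[of k l] that D(1) by (intro mult_left_mono) auto
        then show ?thesis using lip_range(1)[of k l i] that nm by simp
      qed
      show ?thesis using *[of k l] *[of l k] that by (cases "k \<le> l") (auto simp: abs_minus_commute)
    qed
    have closeG: "\<bar>G l j - G k j\<bar> \<le> 6 * D / \<rho> * t" if "n \<le> k" "k \<le> m" "n \<le> l" "l \<le> m" for k l j
    proof -
      have *: "\<bar>G l j - G k j\<bar> \<le> 6 * D / \<rho> * t" if "n \<le> k" "k \<le> l" "l \<le> m" for k l
      proof -
        have "3 * D * (\<Sum>q=k..<l. h q) \<le> 3 * D * (2 * t)"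
          using sub[of k l] that D(1) by (intro mult_left_mono) auto
        moreover have "\<bar>\<rho> * G l j - \<rho> * G k j\<bar> = \<rho> * \<bar>G l j - G k j\<bar>"
          using \<rho> by (simp add: abs_mult flip: right_diff_distrib)
        ultimately have "\<rho> * \<bar>G l j - G k j\<bar> \<le> 6 * D * t"
          using lip_range(2)[of k l j] that nm by simp
        then show ?thesis using \<rho> by (simp add: le_divide_eq mult.commute)
      qed
      show ?thesis using *[of k l] *[of l k] that by (cases "k \<le> l") (auto simp: abs_minus_commute)
    qed
    have closeA: "\<bar>A k i j - A n i j\<bar> \<le> 2 * t" "\<bar>B k i j - B n i j\<bar> \<le> 2 * t" if "n \<le> k" "k \<le> m" for k i j
    proof -
      have "t * (\<Sum>q=n..<k. h q) \<le> 1 * (2 * t)"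
        using sub[of n k] that t by (intro mult_mono sum_nonneg h) auto
      then show "\<bar>A k i j - A n i j\<bar> \<le> 2 * t" "\<bar>B k i j - B n i j\<bar> \<le> 2 * t"
        using lip_range(3,4)[of n k i j] that nm by auto
    qed
    have tD: "3 * t \<le> 3 * D * t" using t D(1) by simp
    define A' where "A' i j = A n i j - ?u n + \<kappa> * t" for i j
    define B' where "B' i j = B n i j - ?w n + \<kappa> * t" for i j
    have incF: "F (Suc k) (x l) - F k (x l) \<le> h k * A' (x l) (y k)" if "k \<in> {n..<m}" "l \<in> {n..<m}" for k l
    proof -
      have "F k (x l) \<ge> ?u n - 12 * D * t"
        using closeF[of k l "x l"] closeF[of n l "x n"] x[of l "x n"] that nm by (simp add: abs_le_iff)
      moreover have "15 * D * t \<le> \<kappa> * t" using \<kappa> t by (intro mult_right_mono) auto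
      ultimately have "A k (x l) (y k) - F k (x l) + t \<le> A' (x l) (y k)"
        using closeA(1)[of k "x l" "y k"] that tD by (simp add: A'_def abs_le_iff)
      then have "h k * (A k (x l) (y k) - F k (x l) + t) \<le> h k * A' (x l) (y k)"
        by (rule mult_left_mono) (rule h)
      then show ?thesis using N(5)[of k "x l"] that nm by (simp add: abs_le_iff algebra_simps)
    qed
    have incG: "\<rho> * G (Suc k) (y l) - \<rho> * G k (y l) \<le> h k * B' (x k) (y l)" if "k \<in> {n..<m}" "l \<in> {n..<m}" for k l
    proof -
      have "G k (y l) \<ge> ?w n - 2 * (6 * D / \<rho> * t)"
        using closeG[of k l "y l"] closeG[of n l "y n"] y[of l "y n"] that nm by (simp add: abs_le_iff)
      moreover have "(3 + 12 * D / \<rho>) * t \<le> \<kappa> * t" using \<kappa> t by (intro mult_right_mono) auto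
      ultimately have "B k (x k) (y l) - G k (y l) + t \<le> B' (x k) (y l)"
        using closeA(2)[of k "x k" "y l"] that by (simp add: B'_def abs_le_iff distrib_right)
      then have "h k * (B k (x k) (y l) - G k (y l) + t) \<le> h k * B' (x k) (y l)"
        by (rule mult_left_mono) (rule h)
      then show ?thesis using N(6)[of k "y l"] that nm by (simp add: abs_le_iff algebra_simps)
    qed
    have sy: "\<rho> * G k j \<le> \<rho> * G k (y k)" for k j
      by (intro mult_left_mono y) (use \<rho> in simp)
    have sys: "fictitious_play_system UNIV UNIV A' B' (3 * D) h F (\<lambda>k j. \<rho> * G k j) x y n m"
      unfolding fictitious_play_system_def
      by (intro conjI ballI incF incG lipF lipG x sy UNIV_I) (use nm in auto)
    have low: "- 2 * (3 * D) \<le> \<zeta> - ?u n - ?w n + 2 * \<kappa> * t"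
    proof -
      have "0 \<le> 2 * \<kappa> * t" using \<kappa> t by simp
      then show ?thesis
        using \<zeta> D(1) D(2)[of n "x n"] D(3)[of n "y n"] unfolding abs_le_iff by linarith
    qed
    have sum: "A' i j + B' i j \<le> \<zeta> - ?u n - ?w n + 2 * \<kappa> * t" for i j
      using N(4)[OF nm(1), of i j] by (simp add: A'_def B'_def)
    have "?L m \<le> ?L n + (\<zeta> - ?u n - ?w n + 2 * \<kappa> * t + t) * ?T + K * H"
      by (rule growth_constantD[OF growth sys nm(2) h(1) _ H(1) low sum]) (use N(1) nm(1) in simp)
    also have "K * H \<le> t * ?T"
      using H(2) mult_left_mono[OF T(1) less_imp_le[OF t(1)]] by linarith
    also have "?L n + (\<zeta> - ?u n - ?w n + 2 * \<kappa> * t + t) * ?T + t * ?T = ?L n + (\<zeta> - (?u n + ?w n) + 2 * \<kappa> * t + 2 * t) * ?T"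
      by (simp add: algebra_simps)
    also have "(\<zeta> - (?u n + ?w n) + 2 * \<kappa> * t + 2 * t) * ?T \<le> (?c - ?L n / M) * ?T"
    proof (rule mult_right_mono)
      have "?L n \<le> M * (?u n + ?w n + 2 * t)" using ws(1) N(2,3)[OF nm(1)] t by simp
      then have "?L n / M \<le> ?u n + ?w n + 2 * t" using M by (simp add: divide_le_eq mult.commute)
      then show "\<zeta> - (?u n + ?w n) + 2 * \<kappa> * t + 2 * t \<le> ?c - ?L n / M"
        by (simp add: algebra_simps)
    qed (use T t in simp)
    finally show ?thesis by simp
  qed
  have "\<forall>\<^sub>F k in sequentially. ?L k \<le> M * ?c + 2 * (6 * D) * t + t"
  proof (rule eventually_le_of_window_relaxation[OF h(1,2) div h(3)])
    show "\<forall>\<^sub>F k in sequentially. \<bar>?L (Suc k) - ?L k\<bar> \<le> 6 * D * h k"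
      by (rule eventually_sequentiallyI[of N]) (rule lipL)
    show "\<forall>\<^sub>F n in sequentially. \<forall>m\<ge>n. t \<le> (\<Sum>k=n..<m. h k) \<longrightarrow> (\<Sum>k=n..<m. h k) \<le> 2 * t \<longrightarrow>
       ?L m \<le> ?L n + (?c - ?L n / M) * (\<Sum>k=n..<m. h k)"
      by (rule eventually_sequentiallyI[of N]) (use window in blast)
  qed (use t M D in auto)
  moreover have "\<forall>\<^sub>F k in sequentially. N \<le> k" by (rule eventually_ge_at_top)
  ultimately show ?thesis
  proof eventually_elim
    case (elim k)
    have "m * (?u k + ?w k) \<le> ?L k + 2 * M * t" using ws(2) N(2,3)[OF elim(2)] t by simp
    also have "\<dots> \<le> M * \<zeta> + t * R" using elim(1) by (simp add: R_def algebra_simps)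
    also have "\<dots> \<le> M * \<zeta> + e * m" using te by simp
    finally have "?u k + ?w k \<le> (M * \<zeta> + e * m) / m" using m by (simp add: le_divide_eq mult.commute)
    also have "\<dots> = M / m * \<zeta> + e" using m by (simp add: add_divide_distrib)
    finally show ?case by (simp add: M_def m_def)
  qed
qed

section \<open>Values of matrix games\<close>

lemma action_value_eq_sum:
  fixes q :: "'x \<Rightarrow> 'y::finite \<Rightarrow> real"
  shows "action_value q \<mu> x = (\<Sum>y\<in>UNIV. pmf \<mu> y * q x y)"
  unfolding action_value_def by (subst integral_measure_pmf_real[of UNIV]) (auto simp: mult.commute)

lemma action_value_le_best_value: "action_value q \<mu> x \<le> best_value q \<mu>"
  for q :: "'x::finite \<Rightarrow> 'y \<Rightarrow> real"
  unfolding best_value_def by (intro Max_ge) auto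

lemma best_value_leI: "(\<And>x. action_value q \<mu> x \<le> c) \<Longrightarrow> best_value q \<mu> \<le> c"
  for q :: "'x::finite \<Rightarrow> 'y \<Rightarrow> real"
  unfolding best_value_def by (subst Max_le_iff) auto

lemma best_value_attained:
  fixes q :: "'x::finite \<Rightarrow> 'y \<Rightarrow> real"
  obtains x where "best_value q \<mu> = action_value q \<mu> x"
proof -
  have "Max (range (action_value q \<mu>)) \<in> range (action_value q \<mu>)" by (intro Max_in) auto
  then show thesis by (elim rangeE) (rule that, simp add: best_value_def)
qed

lemma best_value_eq_if_maximal:
  fixes q :: "'x::finite \<Rightarrow> 'y \<Rightarrow> real"
  assumes "\<And>x'. action_value q \<mu> x' \<le> action_value q \<mu> x"
  shows "best_value q \<mu> = action_value q \<mu> x"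
  by (intro antisym best_value_leI assms action_value_le_best_value)

lemma action_value_mono:
  fixes q q' :: "'x \<Rightarrow> 'y::finite \<Rightarrow> real"
  assumes "\<And>y. q x y \<le> q' x y + c"
  shows "action_value q \<mu> x \<le> action_value q' \<mu> x + c"
proof -
  have "action_value q \<mu> x \<le> (\<Sum>y\<in>UNIV. pmf \<mu> y * (q' x y + c))"
    unfolding action_value_eq_sum by (intro sum_mono mult_left_mono assms) simp
  also have "\<dots> = action_value q' \<mu> x + (\<Sum>y\<in>UNIV. pmf \<mu> y) * c"
    by (simp add: action_value_eq_sum distrib_left sum.distrib sum_distrib_right)
  finally show ?thesis by (simp add: sum_pmf_eq_1)
qed

lemma best_value_mono:
  fixes q q' :: "'x::finite \<Rightarrow> 'y::finite \<Rightarrow> real"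
  assumes "\<And>x y. q x y \<le> q' x y + c"
  shows "best_value q \<mu> \<le> best_value q' \<mu> + c"
proof (rule best_value_leI)
  fix x
  have "action_value q \<mu> x \<le> action_value q' \<mu> x + c"
    by (rule action_value_mono) (rule assms)
  then show "action_value q \<mu> x \<le> best_value q' \<mu> + c"
    using action_value_le_best_value[of q' \<mu> x] by linarith
qed

lemma action_value_abs_le:
  fixes q :: "'x \<Rightarrow> 'y::finite \<Rightarrow> real"
  assumes "\<And>y. \<bar>q x y\<bar> \<le> D"
  shows "\<bar>action_value q \<mu> x\<bar> \<le> D"
proof -
  have D: "q x y \<le> D" "0 \<le> q x y + D" for y using assms[of y] by linarith+
  have "action_value q \<mu> x \<le> action_value (\<lambda>_ _. 0) \<mu> x + D"
    by (rule action_value_mono) (use D in simp)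
  moreover have "action_value (\<lambda>_ _. 0) \<mu> x \<le> action_value q \<mu> x + D"
    by (rule action_value_mono) (use D in simp)
  ultimately show ?thesis by (simp add: action_value_def abs_le_iff)
qed

lemma best_value_abs_le:
  fixes q :: "'x::finite \<Rightarrow> 'y::finite \<Rightarrow> real"
  assumes "\<And>x y. \<bar>q x y\<bar> \<le> D"
  shows "\<bar>best_value q \<mu>\<bar> \<le> D"
proof -
  obtain x where "best_value q \<mu> = action_value q \<mu> x" by (rule best_value_attained)
  then show ?thesis by (simp only:) (rule action_value_abs_le, rule assms)
qed

text \<open>
  The smallest payoff to which the opponent can hold a player who replies optimally, that is, the
  upper value of the matrix game.
\<close>

definition game_value :: "('x::finite \<Rightarrow> 'y::finite \<Rightarrow> real) \<Rightarrow> real" where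
  "game_value q = (INF \<mu>. best_value q \<mu>)"

lemma game_value_le_best_value: "game_value q \<le> best_value q \<mu>"
proof -
  define D where "D = Max (range (\<lambda>(x, y). \<bar>q x y\<bar>))"
  have "\<bar>q x y\<bar> \<le> D" for x y
    unfolding D_def by (intro Max_ge) (auto intro: image_eqI[of _ _ "(x, y)"])
  then have "- D \<le> best_value q \<mu>" for \<mu>
    using best_value_abs_le[of q D \<mu>] by auto
  then show ?thesis
    unfolding game_value_def by (intro cINF_lower) (auto simp: bdd_below_def)
qed

lemma game_value_greatest: "(\<And>\<mu>. c \<le> best_value q \<mu>) \<Longrightarrow> c \<le> game_value q"
  unfolding game_value_def by (intro cINF_greatest) auto

lemma game_value_mono:
  assumes "\<And>x y. q x y \<le> q' x y + c"
  shows "game_value q \<le> game_value q' + c"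
proof -
  have "game_value q - c \<le> best_value q' \<mu>" for \<mu>
  proof -
    have "best_value q \<mu> \<le> best_value q' \<mu> + c" by (rule best_value_mono) (rule assms)
    then show ?thesis using game_value_le_best_value[of q \<mu>] by linarith
  qed
  then show ?thesis using game_value_greatest[of "game_value q - c" q'] by simp
qed

text \<open>
  Probability mass functions on a finite type have no topology of their own; their vectors of
  probabilities form the simplex.
\<close>

lemma compact_pmfs: "compact (range (\<lambda>\<mu>::'y::finite pmf. \<chi> y. pmf \<mu> y))"
proof -
  have "range (\<lambda>\<mu>::'y pmf. \<chi> y. pmf \<mu> y) = (\<Inter>y. {v. 0 \<le> v $ y}) \<inter> {v::real^'y. (\<Sum>y\<in>UNIV. v $ y) = 1}"
  proof (intro equalityI subsetI)
    fix v :: "real^'y" assume v: "v \<in> (\<Inter>y. {v. 0 \<le> v $ y}) \<inter> {v. (\<Sum>y\<in>UNIV. v $ y) = 1}"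
    have "pmf (embed_pmf (\<lambda>y. v $ y)) y = v $ y" for y
    proof (rule pmf_embed_pmf)
      show "(\<integral>\<^sup>+y. ennreal (v $ y) \<partial>count_space UNIV) = 1"
        using v by (simp add: nn_integral_count_space_finite sum_ennreal)
    qed (use v in auto)
    then have "v = (\<chi> y. pmf (embed_pmf (\<lambda>y. v $ y)) y)" by (simp add: vec_eq_iff)
    then show "v \<in> range (\<lambda>\<mu>. \<chi> y. pmf \<mu> y)" by blast
  qed (auto simp: sum_pmf_eq_1)
  moreover have "closed ((\<Inter>y. {v. 0 \<le> v $ y}) \<inter> {v::real^'y. (\<Sum>y\<in>UNIV. v $ y) = 1})"
    by (intro closed_Int closed_INT ballI closed_Collect_le closed_Collect_eq continuous_intros)
  moreover have "bounded (range (\<lambda>\<mu>::'y pmf. \<chi> y. pmf \<mu> y))"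
  proof (rule boundedI)
    fix v assume "v \<in> range (\<lambda>\<mu>::'y pmf. \<chi> y. pmf \<mu> y)"
    then obtain \<mu> :: "'y pmf" where v: "v = (\<chi> y. pmf \<mu> y)" by auto
    have "norm v \<le> (\<Sum>y\<in>UNIV. \<bar>v $ y\<bar>)" by (rule norm_le_l1_cart)
    then show "norm v \<le> 1" by (simp add: v sum_pmf_eq_1)
  qed
  ultimately show ?thesis by (simp add: compact_eq_bounded_closed)
qed

lemma pmf_convergent_subseq:
  fixes \<mu> :: "nat \<Rightarrow> 'y::finite pmf"
  obtains \<nu> r where "strict_mono r" "\<And>y. (\<lambda>k. pmf (\<mu> (r k)) y) \<longlonglongrightarrow> pmf \<nu> y"
proof -
  let ?f = "\<lambda>k. \<chi> y. pmf (\<mu> k) y"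
  have "\<forall>k. ?f k \<in> range (\<lambda>\<mu>::'y pmf. \<chi> y. pmf \<mu> y)" by auto
  from compact_pmfs[unfolded compact_def, THEN spec[of _ ?f], THEN mp, OF this]
  obtain v r where v: "v \<in> range (\<lambda>\<mu>::'y pmf. \<chi> y. pmf \<mu> y)" "strict_mono r" "(?f \<circ> r) \<longlonglongrightarrow> v"
    by (elim bexE exE conjE) (rule that)
  then obtain \<nu> where "v = (\<chi> y. pmf \<nu> y)" by auto
  then have "(\<lambda>k. pmf (\<mu> (r k)) y) \<longlonglongrightarrow> pmf \<nu> y" for y
    using tendsto_vec_nth[OF v(3), of y] by (simp add: o_def)
  with v(2) that show thesis by blast
qed

lemma best_value_limit:
  fixes q :: "'x::finite \<Rightarrow> 'y::finite \<Rightarrow> real"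
  assumes "\<And>y. (\<lambda>k. pmf (\<mu> k) y) \<longlonglongrightarrow> pmf \<nu> y" and "(\<lambda>k. best_value q (\<mu> k)) \<longlonglongrightarrow> c"
  shows "best_value q \<nu> \<le> c"
proof (rule best_value_leI)
  fix x
  have "(\<lambda>k. action_value q (\<mu> k) x) \<longlonglongrightarrow> action_value q \<nu> x"
    unfolding action_value_eq_sum by (intro tendsto_intros assms)
  then show "action_value q \<nu> x \<le> c"
    by (rule LIMSEQ_le[OF _ assms(2)]) (auto intro: action_value_le_best_value)
qed

lemma game_value_attained:
  fixes q :: "'x::finite \<Rightarrow> 'y::finite \<Rightarrow> real"
  obtains \<mu> where "best_value q \<mu> = game_value q"
proof -
  have "\<exists>\<mu>. best_value q \<mu> < game_value q + 1 / Suc n" for n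
    using game_value_greatest[of "game_value q + 1 / Suc n" q] by (force simp: not_le[symmetric])
  then obtain \<mu> where \<mu>: "\<And>n. best_value q (\<mu> n) < game_value q + 1 / Suc n" by metis
  obtain \<nu> r where r: "strict_mono r" and \<nu>: "\<And>y. (\<lambda>k. pmf (\<mu> (r k)) y) \<longlonglongrightarrow> pmf \<nu> y"
    by (rule pmf_convergent_subseq[of \<mu>]) (rule that)
  have "(\<lambda>n. best_value q (\<mu> n)) \<longlonglongrightarrow> game_value q"
  proof (rule tendsto_sandwich[of "\<lambda>_. game_value q" _ _ "\<lambda>n. game_value q + 1 / Suc n"])
    show "(\<lambda>n. game_value q + 1 / Suc n) \<longlonglongrightarrow> game_value q"
      using tendsto_add[OF tendsto_const LIMSEQ_inverse_real_of_nat] by (simp add: inverse_eq_divide)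
  qed (use \<mu> in \<open>auto intro!: always_eventually less_imp_le simp: game_value_le_best_value\<close>)
  from LIMSEQ_subseq_LIMSEQ[OF this r] have "best_value q \<nu> \<le> game_value q"
    by (intro best_value_limit[OF \<nu>]) (simp add: o_def)
  then show thesis by (intro that[of \<nu>] antisym game_value_le_best_value)
qed

text \<open>
  Choose \<open>e k\<close> among the optimal strategies at almost minimal distance from \<open>\<mu> k\<close>. If the distances did
  not tend to \<open>0\<close>, a limit point of \<open>\<mu>\<close> along stages with a large distance would be optimal by
  \<open>best_value_limit\<close>, which is impossible.
\<close>

lemma asymptotically_optimal:
  fixes q :: "'x::finite \<Rightarrow> 'y::finite \<Rightarrow> real"
  assumes "(\<lambda>k. best_value q (\<mu> k)) \<longlonglongrightarrow> game_value q"
  obtains e where "\<And>k. best_value q (e k) = game_value q" "\<And>y. (\<lambda>k. pmf (\<mu> k) y - pmf (e k) y) \<longlonglongrightarrow> 0"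
proof -
  define d where "d \<mu> \<nu> = (\<Sum>y\<in>UNIV. \<bar>pmf \<mu> y - pmf \<nu> y\<bar>)" for \<mu> \<nu> :: "'y pmf"
  define E where "E = {\<nu>. best_value q \<nu> = game_value q}"
  have d0: "0 \<le> d \<mu> \<nu>" for \<mu> \<nu> unfolding d_def by (simp add: sum_nonneg)
  obtain \<nu>0 where "\<nu>0 \<in> E" using game_value_attained unfolding E_def by blast
  then have E: "E \<noteq> {}" by auto
  have "\<exists>\<nu>\<in>E. d (\<mu> k) \<nu> < (INF \<nu>\<in>E. d (\<mu> k) \<nu>) + 1 / Suc k" for k
  proof (subst cINF_less_iff[symmetric])
    show "bdd_below (d (\<mu> k) ` E)" by (rule bdd_belowI2[of _ 0]) (rule d0)
  qed (use E in simp_all)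
  then have "\<forall>k. \<exists>\<nu>. \<nu> \<in> E \<and> d (\<mu> k) \<nu> < (INF \<nu>\<in>E. d (\<mu> k) \<nu>) + 1 / Suc k" by blast
  from choice[OF this]
  obtain e where e0: "\<forall>k. e k \<in> E \<and> d (\<mu> k) (e k) < (INF \<nu>\<in>E. d (\<mu> k) \<nu>) + 1 / Suc k"
    by (elim exE) (rule that)
  note e = e0[THEN spec, THEN conjunct1] e0[THEN spec, THEN conjunct2]
  have "(\<lambda>k. d (\<mu> k) (e k)) \<longlonglongrightarrow> 0"
  proof (rule ccontr)
    assume "\<not> ?thesis"
    then obtain \<epsilon> where \<epsilon>: "0 < \<epsilon>" and "\<not> (\<forall>\<^sub>F k in sequentially. dist (d (\<mu> k) (e k)) 0 < \<epsilon>)"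
      unfolding tendsto_iff by blast
    then have "\<exists>\<^sub>F k in sequentially. \<not> dist (d (\<mu> k) (e k)) 0 < \<epsilon>"
      by (simp only: not_eventually simp_thms)
    then have freq: "\<exists>\<^sub>F k in sequentially. \<epsilon> \<le> d (\<mu> k) (e k)"
      by (rule frequently_elim1) (simp add: dist_real_def d0)
    from freq have "infinite {k. \<epsilon> \<le> d (\<mu> k) (e k)}"
      by (simp add: frequently_cofinite cofinite_eq_sequentially[symmetric])
    then obtain s :: "nat \<Rightarrow> nat" where s: "strict_mono s" "\<And>k. \<epsilon> \<le> d (\<mu> (s k)) (e (s k))"
      using infinite_enumerate[OF \<open>infinite _\<close>] by auto
    obtain \<nu> r where r: "strict_mono r" and \<nu>: "\<And>y. (\<lambda>k. pmf (\<mu> (s (r k))) y) \<longlonglongrightarrow> pmf \<nu> y"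
      by (rule pmf_convergent_subseq[of "\<lambda>k. \<mu> (s k)"]) (rule that)
    have sr: "strict_mono (s \<circ> r)" using s(1) r by (rule strict_mono_o)
    have "best_value q \<nu> \<le> game_value q"
      using LIMSEQ_subseq_LIMSEQ[OF assms sr] by (intro best_value_limit[OF \<nu>]) (simp add: o_def)
    then have "\<nu> \<in> E" unfolding E_def using game_value_le_best_value[of q \<nu>] by simp
    have "(\<lambda>k. d (\<mu> (s (r k))) \<nu> + 1 / Suc (s (r k))) \<longlonglongrightarrow> (\<Sum>y\<in>(UNIV::'y set). \<bar>pmf \<nu> y - pmf \<nu> y\<bar>) + 0"
      unfolding d_def using LIMSEQ_subseq_LIMSEQ[OF LIMSEQ_inverse_real_of_nat sr]
      by (intro tendsto_intros \<nu>) (simp add: o_def inverse_eq_divide)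
    then have "\<forall>\<^sub>F k in sequentially. d (\<mu> (s (r k))) \<nu> + 1 / Suc (s (r k)) < \<epsilon>"
      using \<epsilon> by (intro order_tendstoD) auto
    then obtain k where k: "d (\<mu> (s (r k))) \<nu> + 1 / Suc (s (r k)) < \<epsilon>"
      by (auto simp: eventually_sequentially)
    have "(INF \<nu>\<in>E. d (\<mu> (s (r k))) \<nu>) \<le> d (\<mu> (s (r k))) \<nu>"
      using \<open>\<nu> \<in> E\<close> d0 by (intro cINF_lower) (auto simp: bdd_below_def)
    with e(2)[of "s (r k)"] s(2)[of "r k"] k show False by linarith
  qed
  then have "(\<lambda>k. pmf (\<mu> k) y - pmf (e k) y) \<longlonglongrightarrow> 0" for y
    by (rule Lim_null_comparison[rotated])
       (auto simp: d_def intro!: always_eventually member_le_sum[of y UNIV "\<lambda>y. \<bar>pmf (\<mu> k) y - pmf (e k) y\<bar>" for k])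
  with e(1) that show thesis unfolding E_def by blast
qed

lemma weak_duality:
  fixes q :: "'x::finite \<Rightarrow> 'y::finite \<Rightarrow> real"
  shows "0 \<le> best_value q \<mu> + best_value (\<lambda>y x. - q x y) \<nu>"
proof -
  have avg: "(\<Sum>x\<in>UNIV. pmf \<nu> x * action_value q' \<mu> x) \<le> best_value q' \<mu>"
    for q' :: "'u::finite \<Rightarrow> 'v::finite \<Rightarrow> real" and \<mu> \<nu>
  proof -
    have "(\<Sum>x\<in>UNIV. pmf \<nu> x * action_value q' \<mu> x) \<le> (\<Sum>x\<in>UNIV. pmf \<nu> x * best_value q' \<mu>)"
      by (intro sum_mono mult_left_mono action_value_le_best_value) simp
    then show ?thesis by (simp add: sum_pmf_eq_1 flip: sum_distrib_right)
  qed
  have "(\<Sum>y\<in>UNIV. pmf \<mu> y * action_value (\<lambda>y x. - q x y) \<nu> y) = - (\<Sum>x\<in>UNIV. pmf \<nu> x * action_value q \<mu> x)"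
    unfolding action_value_eq_sum sum_distrib_left
    by (subst sum.swap) (simp add: sum_negf mult_ac)
  then show ?thesis using avg[of \<nu> q \<mu>] avg[of \<mu> "\<lambda>y x. - q x y" \<nu>] by linarith
qed

lemma ex_maximiser: "\<exists>x. \<forall>i. f i \<le> (f x :: real)" for f :: "'x::finite \<Rightarrow> real"
proof -
  have "Max (range f) \<in> range f" by (intro Max_in) auto
  then obtain x where "Max (range f) = f x" by (elim rangeE) (rule that)
  then have "\<forall>i. f i \<le> f x" by (metis Max_ge finite finite_imageI rangeI)
  then show ?thesis ..
qed

text \<open>
  Fictitious play with unit steps, started from zero payoffs: after \<open>n\<close> rounds the best-reply values are
  \<open>n\<close> times those against the empirical distributions of play, while their sum has grown only by
  \<open>e / 2 * n + K\<close>, because the payoff matrices add up to \<open>0\<close>.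
\<close>

theorem minimax:
  fixes q :: "'x::finite \<Rightarrow> 'y::finite \<Rightarrow> real"
  shows "game_value (\<lambda>y x. - q x y) = - game_value q"
proof -
  obtain \<mu> where "best_value q \<mu> = game_value q" by (rule game_value_attained)
  moreover obtain \<nu> where "best_value (\<lambda>y x. - q x y) \<nu> = game_value (\<lambda>y x. - q x y)" by (rule game_value_attained)
  ultimately have "0 \<le> game_value q + game_value (\<lambda>y x. - q x y)"
    using weak_duality[of q \<mu> \<nu>] by simp
  moreover have "game_value q + game_value (\<lambda>y x. - q x y) \<le> 0"
  proof (rule field_le_epsilon)
    fix e :: real assume e: "0 < e"
    define am where "am f = (SOME x. \<forall>i. f i \<le> f x)" for f :: "'x \<Rightarrow> real"
    define bm where "bm f = (SOME x. \<forall>i. f i \<le> f x)" for f :: "'y \<Rightarrow> real"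
    have am: "f i \<le> f (am f)" for f i unfolding am_def using someI_ex[OF ex_maximiser[of f]] by blast
    have bm: "f i \<le> f (bm f)" for f i unfolding bm_def using someI_ex[OF ex_maximiser[of f]] by blast
    define Z where "Z = rec_nat (\<lambda>_. 0, \<lambda>_. 0) (\<lambda>_ fg. (\<lambda>i. fst fg i + q i (bm (snd fg)), \<lambda>j. snd fg j - q (am (fst fg)) j))"
    define F where "F k = fst (Z k)" for k
    define G where "G k = snd (Z k)" for k
    define x where "x k = am (F k)" for k
    define y where "y k = bm (G k)" for k
    have FG0: "F 0 = (\<lambda>_. 0)" "G 0 = (\<lambda>_. 0)" by (simp_all add: F_def G_def Z_def)
    have FS: "F (Suc k) i = F k i + q i (y k)" and GS: "G (Suc k) j = G k j - q (x k) j" for k i j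
      by (simp_all add: F_def G_def Z_def x_def y_def)
    have F: "F n i = (\<Sum>k<n. q i (y k))" and G: "G n j = (\<Sum>k<n. - q (x k) j)" for n i j
      by (induction n) (simp_all add: FG0 FS GS)
    define D where "D = Max (range (\<lambda>(x, y). \<bar>q x y\<bar>))"
    have D: "\<bar>q x y\<bar> \<le> D" for x y
      unfolding D_def by (intro Max_ge) (auto intro: image_eqI[of _ _ "(x, y)"])
    then have D0: "0 \<le> D" using abs_ge_zero order_trans by blast
    have "0 < e / 2" using e by simp
    obtain K where K: "0 \<le> K" and growth: "growth_constant (UNIV :: 'x set) (UNIV :: 'y set) D (e / 2) K"
      using ex_growth_constant[OF D0 \<open>0 < e / 2\<close>] by blast
    obtain n :: nat where n: "2 * K / e < n" using reals_Archimedean2 by blast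
    have npos: "0 < n" using n K e by (cases n) (auto simp: divide_less_0_iff)
    have "fictitious_play_system UNIV UNIV q (\<lambda>i j. - q i j) D (\<lambda>_. 1) F G x y 0 n"
      unfolding fictitious_play_system_def
      using am bm D by (auto simp: x_def y_def FS GS)
    then have "F n (x n) + G n (y n) \<le> F 0 (x 0) + G 0 (y 0) + (0 + e / 2) * (\<Sum>k=0..<n. 1) + K * 1"
      by (rule growth_constantD[OF growth, where A=q and B="\<lambda>i j. - q i j"]) (use D0 in auto)
    also have "\<dots> = e / 2 * n + K" by (simp add: FG0)
    also have "\<dots> \<le> e * n" using n e by (simp add: field_simps)
    finally have bound: "F n (x n) + G n (y n) \<le> e * n" .
    have avg: "action_value q' (map_pmf z (pmf_of_set {..<n})) i = (\<Sum>k<n. q' i (z k)) / n"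
      for q' :: "'u \<Rightarrow> 'v \<Rightarrow> real" and z i
      using npos by (simp add: action_value_def integral_pmf_of_set lessThan_empty_iff)
    have "game_value q \<le> F n (x n) / n"
    proof (rule order_trans[OF game_value_le_best_value best_value_leI])
      fix i show "action_value q (map_pmf y (pmf_of_set {..<n})) i \<le> F n (x n) / n"
        unfolding avg using am[of "F n" i] by (simp add: F[symmetric] x_def divide_right_mono)
    qed
    moreover have "game_value (\<lambda>y x. - q x y) \<le> G n (y n) / n"
    proof (rule order_trans[OF game_value_le_best_value best_value_leI])
      fix j show "action_value (\<lambda>y x. - q x y) (map_pmf x (pmf_of_set {..<n})) j \<le> G n (y n) / n"
        unfolding avg using bm[of "G n" j] by (simp only: G[symmetric] y_def divide_right_mono)
    qed
    ultimately have "game_value q + game_value (\<lambda>y x. - q x y) \<le> (F n (x n) + G n (y n)) / n"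
      by (simp add: add_divide_distrib)
    also have "\<dots> \<le> e" using bound npos by (simp add: divide_le_eq)
    finally show "game_value q + game_value (\<lambda>y x. - q x y) \<le> 0 + e" by simp
  qed
  ultimately show ?thesis by simp
qed

section \<open>The Shapley equation\<close>

definition continuation :: "('s::finite \<Rightarrow> 'x \<Rightarrow> 'y \<Rightarrow> real) \<Rightarrow> ('s \<Rightarrow> 'x \<Rightarrow> 'y \<Rightarrow> 's pmf) \<Rightarrow> real \<Rightarrow>
    ('s \<Rightarrow> real) \<Rightarrow> 's \<Rightarrow> 'x \<Rightarrow> 'y \<Rightarrow> real" where
  "continuation r p \<gamma> w s x y = r s x y + \<gamma> * (\<Sum>s'\<in>UNIV. pmf (p s x y) s' * w s')"

lemma continuation_mono:
  assumes "0 \<le> \<gamma>" "\<And>s. w s \<le> w' s + c"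
  shows "continuation r p \<gamma> w s x y \<le> continuation r p \<gamma> w' s x y + \<gamma> * c"
proof -
  have "(\<Sum>s'\<in>UNIV. pmf (p s x y) s' * w s') \<le> (\<Sum>s'\<in>UNIV. pmf (p s x y) s' * (w' s' + c))"
    by (intro sum_mono mult_left_mono assms) simp
  also have "\<dots> = (\<Sum>s'\<in>UNIV. pmf (p s x y) s' * w' s') + c"
    by (simp add: distrib_left sum.distrib sum_pmf_eq_1 flip: sum_distrib_right)
  finally have "\<gamma> * (\<Sum>s'\<in>UNIV. pmf (p s x y) s' * w s') \<le> \<gamma> * ((\<Sum>s'\<in>UNIV. pmf (p s x y) s' * w' s') + c)"
    using assms(1) by (rule mult_left_mono)
  then show ?thesis by (simp add: continuation_def distrib_left)
qed

lemma continuation_const: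
  "continuation r p \<gamma> (\<lambda>_. c) s x y = r s x y + \<gamma> * c"
  by (simp add: continuation_def sum_pmf_eq_1 flip: sum_distrib_right)

text \<open>
  The operator \<open>T\<close> is monotone and maps the constants \<open>- B\<close> and \<open>B\<close> inwards. Iterating it from \<open>- B\<close>
  gives an increasing bounded sequence, whose limit is a fixed point because \<open>T\<close> is Lipschitz.
\<close>

theorem Shapley_equation_solvable:
  fixes r :: "'s::finite \<Rightarrow> 'x::finite \<Rightarrow> 'y::finite \<Rightarrow> real"
  assumes \<gamma>: "0 \<le> \<gamma>" "\<gamma> < 1"
  obtains w where "\<And>s. game_value (continuation r p \<gamma> w s) = w s"
proof -
  define T where "T w s = game_value (continuation r p \<gamma> w s)" for w s
  have T_mono: "T w s \<le> T w' s + \<gamma> * c" if "\<And>s. w s \<le> w' s + c" for w w' s c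
    unfolding T_def by (intro game_value_mono continuation_mono \<gamma> that)
  have T_mono0: "T w s \<le> T w' s" if "\<And>s. w s \<le> w' s" for w w' s
    using T_mono[of w w' 0 s] that by simp
  define R where "R = Max (range (\<lambda>(s, x, y). \<bar>r s x y\<bar>))"
  have R: "\<bar>r s x y\<bar> \<le> R" for s x y
    unfolding R_def by (intro Max_ge) (auto intro: image_eqI[of _ _ "(s, x, y)"])
  define B where "B = R / (1 - \<gamma>)"
  have B: "R + \<gamma> * B = B" using \<gamma> by (simp add: B_def field_simps)
  have value_const: "game_value (\<lambda>(x::'x) (y::'y). c) = c" for c
  proof -
    obtain \<mu> where "best_value (\<lambda>(x::'x) (y::'y). c) \<mu> = game_value (\<lambda>(x::'x) (y::'y). c)" by (rule game_value_attained)
    then show ?thesis by (simp add: best_value_def action_value_def)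
  qed
  have lo: "- B \<le> T (\<lambda>_. - B) s" for s
  proof -
    have "game_value (\<lambda>(x::'x) (y::'y). - B) \<le> T (\<lambda>_. - B) s + 0"
      unfolding T_def
    proof (rule game_value_mono)
      fix x y show "- B \<le> continuation r p \<gamma> (\<lambda>_. - B) s x y + 0"
        using R[of s x y] B by (simp add: continuation_const abs_le_iff)
    qed
    then show ?thesis by (simp add: value_const)
  qed
  have hi: "T (\<lambda>_. B) s \<le> B" for s
  proof -
    have "T (\<lambda>_. B) s \<le> game_value (\<lambda>(x::'x) (y::'y). B) + 0"
      unfolding T_def
    proof (rule game_value_mono)
      fix x y show "continuation r p \<gamma> (\<lambda>_. B) s x y \<le> B + 0"
        using R[of s x y] B by (simp add: continuation_const abs_le_iff)
    qed
    then show ?thesis by (simp add: value_const)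
  qed
  define W where "W n = (T ^^ n) (\<lambda>_. - B)" for n
  have WS: "W (Suc n) s = T (W n) s" for n s by (simp add: W_def)
  have inc: "W n s \<le> W (Suc n) s" for n s
  proof (induction n arbitrary: s)
    case 0 then show ?case using lo by (simp add: W_def)
  next
    case (Suc n) then show ?case unfolding WS by (intro T_mono0)
  qed
  have "0 \<le> R" using R abs_ge_zero order_trans by blast
  then have "0 \<le> B" using \<gamma> by (simp add: B_def)
  have up: "W n s \<le> B" for n s
  proof (induction n arbitrary: s)
    case 0 then show ?case using \<open>0 \<le> B\<close> by (simp add: W_def)
  next
    case (Suc n) then show ?case using T_mono0[of "W n" "\<lambda>_. B" s] hi[of s] by (simp add: WS)
  qed
  have "\<exists>l. (\<lambda>n. W n s) \<longlonglongrightarrow> l" for s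
    using incseq_convergent[of "\<lambda>n. W n s" B] inc up by (metis incseq_SucI)
  then obtain w where w: "\<And>s. (\<lambda>n. W n s) \<longlonglongrightarrow> w s" by metis
  have "T w s = w s" for s
  proof -
    define d where "d n = (\<Sum>s\<in>UNIV. \<bar>W n s - w s\<bar>)" for n
    have d: "\<bar>W n s - w s\<bar> \<le> d n" for n s
      unfolding d_def by (rule member_le_sum) auto
    have "d \<longlonglongrightarrow> (\<Sum>s\<in>(UNIV::'s set). \<bar>w s - w s\<bar>)"
      unfolding d_def by (intro tendsto_intros w)
    then have "(\<lambda>n. \<gamma> * d n) \<longlonglongrightarrow> 0" by (intro tendsto_mult_right_zero) simp
    have "norm (T (W n) s - T w s) \<le> \<gamma> * d n" for n
    proof -
      have "W n s \<le> w s + d n" "w s \<le> W n s + d n" for s using d[of n s] by linarith+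
      then show ?thesis using T_mono[of "W n" w "d n" s] T_mono[of w "W n" "d n" s] by simp
    qed
    then have "\<forall>\<^sub>F n in sequentially. norm (T (W n) s - T w s) \<le> \<gamma> * d n"
      by (intro always_eventually allI)
    from Lim_null_comparison[OF this \<open>(\<lambda>n. \<gamma> * d n) \<longlonglongrightarrow> 0\<close>]
    have "(\<lambda>n. T (W n) s - T w s) \<longlonglongrightarrow> 0" .
    then have "(\<lambda>n. W (Suc n) s) \<longlonglongrightarrow> T w s"
      unfolding WS by (rule LIM_zero_cancel)
    then show ?thesis by (intro LIMSEQ_unique[OF _ LIMSEQ_Suc[OF w[of s]]])
  qed
  then show thesis by (intro that) (simp add: T_def)
qed

lemma Shapley_equation_opponent:
  fixes r :: "'s::finite \<Rightarrow> 'x::finite \<Rightarrow> 'y::finite \<Rightarrow> real"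
  assumes "\<And>s. game_value (continuation r p \<gamma> w s) = w s"
  shows "game_value (continuation (\<lambda>s y x. - r s x y) (\<lambda>s y x. p s x y) \<gamma> (\<lambda>s. - w s) s) = - w s"
proof -
  have "continuation (\<lambda>s y x. - r s x y) (\<lambda>s y x. p s x y) \<gamma> (\<lambda>s. - w s) s = (\<lambda>y x. - continuation r p \<gamma> w s x y)"
    by (simp add: continuation_def fun_eq_iff sum_negf)
  then show ?thesis using minimax[of "continuation r p \<gamma> w s"] assms by simp
qed

section \<open>One player's learning path\<close>

text \<open>
  The step size for state \<open>s\<close> at stage \<open>k\<close>, with value \<open>0\<close> at the stages at which \<open>s\<close> is not visited.
  Thus all states can be treated on the common clock of stages.
\<close>

definition visit_step :: "(nat \<Rightarrow> real) \<Rightarrow> (nat \<Rightarrow> 's) \<Rightarrow> 's \<Rightarrow> nat \<Rightarrow> real" where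
  "visit_step \<alpha> \<sigma> s k = of_bool (s = \<sigma> k) * \<alpha> (visits \<sigma> k s)"

lemma visits_0: "visits \<sigma> 0 s = 0"
  by (simp add: visits_def)

lemma visits_Suc: "visits \<sigma> (Suc k) s = visits \<sigma> k s + of_bool (s = \<sigma> k)"
proof -
  have "{l. l < Suc k \<and> \<sigma> l = s} = {l. l < k \<and> \<sigma> l = s} \<union> (if s = \<sigma> k then {k} else {})"
    by (auto simp: less_Suc_eq)
  then show ?thesis by (auto simp: visits_def)
qed

lemma sum_visit_step: "(\<Sum>k<n. visit_step \<alpha> \<sigma> s k) = (\<Sum>c<visits \<sigma> n s. \<alpha> c)"
  by (induction n) (auto simp: visits_0 visits_Suc visit_step_def)

lemma visits_at_top:
  assumes "infinite {k. \<sigma> k = s}"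
  shows "filterlim (\<lambda>k. visits \<sigma> k s) at_top sequentially"
proof -
  have mono: "mono (\<lambda>k. visits \<sigma> k s)"
    by (simp add: mono_iff_le_Suc visits_Suc)
  have "\<exists>k. c \<le> visits \<sigma> k s" for c
  proof (induction c)
    case (Suc c)
    then obtain k where k: "c \<le> visits \<sigma> k s" by auto
    obtain l where l: "k \<le> l" "\<sigma> l = s"
      using assms unfolding infinite_nat_iff_unbounded_le by auto
    have "c \<le> visits \<sigma> l s" using monoD[OF mono l(1)] k by simp
    then show ?case using l(2) by (intro exI[of _ "Suc l"]) (simp add: visits_Suc)
  qed simp
  then show ?thesis
    unfolding filterlim_at_top eventually_sequentially using monoD[OF mono] by (meson order_trans)
qed

lemma visit_step_divergent:
  assumes "infinite {k. \<sigma> k = s}" "filterlim (\<lambda>n. \<Sum>c<n. \<alpha> c) at_top sequentially"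
  shows "filterlim (\<lambda>n. \<Sum>k<n. visit_step \<alpha> \<sigma> s k) at_top sequentially"
  unfolding sum_visit_step by (rule filterlim_compose[OF assms(2) visits_at_top[OF assms(1)]])

text \<open>
  The limit of a ratio of step sizes in the number of visits, restated on the clock of stages without
  a division, since the steps vanish between visits.
\<close>

lemma visit_step_ratio:
  assumes inf: "infinite {k. \<sigma> k = s}" and g: "\<And>c. 0 < g c" and lim: "(\<lambda>c. f c / g c) \<longlonglongrightarrow> L" and \<epsilon>: "0 < \<epsilon>"
  shows "\<forall>\<^sub>F k in sequentially. \<bar>visit_step f \<sigma> s k - L * visit_step g \<sigma> s k\<bar> \<le> \<epsilon> * visit_step g \<sigma> s k"
proof -
  have "\<forall>\<^sub>F c in sequentially. dist (f c / g c) L < \<epsilon>"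
    using lim \<epsilon> by (rule tendstoD)
  from filterlim_iff[THEN iffD1, OF visits_at_top[OF inf], rule_format, OF this]
  show ?thesis
  proof eventually_elim
    case (elim k)
    let ?c = "visits \<sigma> k s"
    have "f ?c - L * g ?c = (f ?c / g ?c - L) * g ?c"
      using g[of ?c] by (simp add: field_simps)
    then have "\<bar>f ?c - L * g ?c\<bar> = \<bar>f ?c / g ?c - L\<bar> * g ?c"
      using g[of ?c] by (simp add: abs_mult)
    also have "\<dots> \<le> \<epsilon> * g ?c"
      using elim g[of ?c] by (intro mult_right_mono) (auto simp: dist_real_def)
    finally show ?case by (cases "s = \<sigma> k") (simp_all add: visit_step_def)
  qed
qed

lemma visit_step_tendsto_0:
  assumes inf: "infinite {k. \<sigma> k = s}" and \<alpha>: "\<And>c. 0 < \<alpha> c" "\<alpha> \<longlonglongrightarrow> 0"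
  shows "visit_step \<alpha> \<sigma> s \<longlonglongrightarrow> 0"
proof -
  have "(\<lambda>k. \<alpha> (visits \<sigma> k s)) \<longlonglongrightarrow> 0"
    by (rule filterlim_compose[OF \<alpha>(2) visits_at_top[OF inf]])
  moreover have "\<forall>\<^sub>F k in sequentially. norm (visit_step \<alpha> \<sigma> s k) \<le> \<alpha> (visits \<sigma> k s)"
    using \<alpha>(1) by (intro always_eventually) (simp add: visit_step_def less_imp_le)
  ultimately show ?thesis by (rule Lim_null_comparison[rotated])
qed

locale learning_path_bounded_steps =
  fixes r :: "'s::finite \<Rightarrow> 'x::finite \<Rightarrow> 'y::finite \<Rightarrow> real"
    and p \<gamma> \<alpha> \<beta> \<sigma> x y \<mu> Q
  assumes \<gamma>: "0 \<le> \<gamma>" "\<gamma> < 1"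
    and \<alpha>: "\<And>c. 0 < \<alpha> c" "\<And>c. \<alpha> c < 1"
    and \<beta>: "\<And>c. 0 < \<beta> c" "\<And>c. \<beta> c < 1"
    and path: "learning_path r p \<gamma> \<alpha> \<beta> \<sigma> x y \<mu> Q"
begin

abbreviation V :: "nat \<Rightarrow> 's \<Rightarrow> real" where
  "V k s \<equiv> best_value (Q k s) (\<mu> k s)"

lemma steps: "0 \<le> visit_step \<alpha> \<sigma> s k" "visit_step \<alpha> \<sigma> s k \<le> 1" "0 \<le> visit_step \<beta> \<sigma> s k" "visit_step \<beta> \<sigma> s k \<le> 1"
  using \<alpha> \<beta> by (auto simp: visit_step_def intro: less_imp_le)

lemma played_action: "action_value (Q k (\<sigma> k)) (\<mu> k (\<sigma> k)) i \<le> action_value (Q k (\<sigma> k)) (\<mu> k (\<sigma> k)) (x k)"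
  using path unfolding learning_path_def is_arg_max_def by (simp add: not_less)

lemma belief_update: "pmf (\<mu> (Suc k) s) j = pmf (\<mu> k s) j + visit_step \<alpha> \<sigma> s k * (pmf (return_pmf (y k)) j - pmf (\<mu> k s) j)"
  using path unfolding learning_path_def visit_step_def by blast

lemma Q_update: "Q (Suc k) s i j = Q k s i j + visit_step \<beta> \<sigma> s k * (continuation r p \<gamma> (V k) s i j - Q k s i j)"
  using path unfolding learning_path_def visit_step_def continuation_def by blast

lemma Q_bounded:
  obtains D where "1 \<le> D" "\<And>k s i j. \<bar>Q k s i j\<bar> \<le> D" "\<And>k s i j. \<bar>continuation r p \<gamma> (V k) s i j\<bar> \<le> D"
proof -
  define R where "R = Max (range (\<lambda>(s, x, y). \<bar>r s x y\<bar>))"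
  define D0 where "D0 = Max (range (\<lambda>(s, x, y). \<bar>Q 0 s x y\<bar>))"
  have R: "\<bar>r s x y\<bar> \<le> R" for s x y
    unfolding R_def by (intro Max_ge) (auto intro: image_eqI[of _ _ "(s, x, y)"])
  have D0: "\<bar>Q 0 s x y\<bar> \<le> D0" for s x y
    unfolding D0_def by (intro Max_ge) (auto intro: image_eqI[of _ _ "(s, x, y)"])
  define D where "D = max 1 (max D0 (R / (1 - \<gamma>)))"
  have "R / (1 - \<gamma>) \<le> D" by (simp add: D_def)
  then have RD: "R + \<gamma> * D \<le> D" using \<gamma> by (simp add: divide_le_eq algebra_simps)
  have cont: "\<bar>continuation r p \<gamma> (V k) s i j\<bar> \<le> D" if Q: "\<And>s i j. \<bar>Q k s i j\<bar> \<le> D" for k s i j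
  proof -
    have "\<bar>V k s\<bar> \<le> D" for s by (rule best_value_abs_le) (rule Q)
    then have V: "V k s \<le> 0 + D" "0 \<le> V k s + D" for s by (auto simp: abs_le_iff) (smt (verit))
    show ?thesis
      using continuation_mono[of \<gamma> "V k" "\<lambda>_. 0" D r p s i j, OF \<gamma>(1) V(1)]
        continuation_mono[of \<gamma> "\<lambda>_. 0" "V k" D r p s i j, OF \<gamma>(1) V(2)] R[of s i j] RD
      by (simp add: continuation_const abs_le_iff)
  qed
  have Q: "\<bar>Q k s i j\<bar> \<le> D" for k s i j
  proof (induction k arbitrary: s i j)
    case 0 then show ?case using D0[of s i j] by (simp add: D_def)
  next
    case (Suc k)
    let ?b = "visit_step \<beta> \<sigma> s k"
    have "Q (Suc k) s i j = (1 - ?b) * Q k s i j + ?b * continuation r p \<gamma> (V k) s i j"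
      by (simp add: Q_update algebra_simps)
    also have "\<bar>\<dots>\<bar> \<le> (1 - ?b) * \<bar>Q k s i j\<bar> + ?b * \<bar>continuation r p \<gamma> (V k) s i j\<bar>"
      using steps(3,4)[of s k] by (intro order_trans[OF abs_triangle_ineq]) (simp add: abs_mult)
    also have "\<dots> \<le> (1 - ?b) * D + ?b * D"
      using steps(3,4)[of s k] by (intro add_mono mult_left_mono Suc cont) auto
    finally show ?case by (simp add: algebra_simps)
  qed
  show thesis by (rule that[OF _ Q cont[OF Q]]) (simp add: D_def)
qed

lemma Q_change:
  assumes "\<And>k s i j. \<bar>Q k s i j\<bar> \<le> D" "\<And>k s i j. \<bar>continuation r p \<gamma> (V k) s i j\<bar> \<le> D"
  shows "\<bar>Q (Suc k) s i j - Q k s i j\<bar> \<le> 2 * D * visit_step \<beta> \<sigma> s k"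
proof -
  have "\<bar>continuation r p \<gamma> (V k) s i j - Q k s i j\<bar> * visit_step \<beta> \<sigma> s k \<le> (2 * D) * visit_step \<beta> \<sigma> s k"
    using assms(1)[of k s i j] assms(2)[of k s i j] by (intro mult_right_mono steps) linarith
  then show ?thesis using steps(3)[of s k] by (simp add: Q_update abs_mult mult.commute)
qed

text \<open>
  With \<open>Q\<close> held fixed, the belief update moves the expected payoffs exactly towards those of the
  observed action; the change of \<open>Q\<close> only adds an error of the order of the slower step size.
\<close>

lemma action_value_change:
  assumes "\<And>k s i j. \<bar>Q k s i j\<bar> \<le> D" "\<And>k s i j. \<bar>continuation r p \<gamma> (V k) s i j\<bar> \<le> D"
  shows "\<bar>action_value (Q (Suc k) s) (\<mu> (Suc k) s) i - action_value (Q k s) (\<mu> k s) i -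
      visit_step \<alpha> \<sigma> s k * (Q k s i (y k) - action_value (Q k s) (\<mu> k s) i)\<bar> \<le> 2 * D * visit_step \<beta> \<sigma> s k"
proof -
  let ?a = "visit_step \<alpha> \<sigma> s k"
  have "action_value (Q k s) (\<mu> (Suc k) s) i = (\<Sum>j\<in>UNIV. (1 - ?a) * (pmf (\<mu> k s) j * Q k s i j) + ?a * (of_bool (j = y k) * Q k s i j))"
    unfolding action_value_eq_sum
    by (intro sum.cong) (auto simp: belief_update pmf_return indicator_def algebra_simps)
  also have "\<dots> = (1 - ?a) * action_value (Q k s) (\<mu> k s) i + ?a * Q k s i (y k)"
    unfolding sum.distrib sum_distrib_left[symmetric] action_value_eq_sum
    by (simp add: of_bool_def if_distrib[of "\<lambda>t. t * _"] cong: if_cong)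
  finally have 1: "action_value (Q k s) (\<mu> (Suc k) s) i = \<dots>" .
  have "action_value (Q (Suc k) s) (\<mu> (Suc k) s) i - action_value (Q k s) (\<mu> (Suc k) s) i =
      action_value (\<lambda>i j. Q (Suc k) s i j - Q k s i j) (\<mu> (Suc k) s) i"
    by (simp add: action_value_eq_sum algebra_simps sum_subtractf)
  also have "\<bar>\<dots>\<bar> \<le> 2 * D * visit_step \<beta> \<sigma> s k"
    by (rule action_value_abs_le) (rule Q_change[OF assms])
  finally show ?thesis unfolding 1 by (simp add: algebra_simps)
qed

text \<open>
  If \<open>Q\<close> lies at most \<open>c\<close> below its target, the best-reply values lie at most \<open>c\<close> below \<open>w\<close>, because a best
  reply secures the value of the matrix game whatever the belief is. Then \<open>Q\<close> relaxes to a level at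
  most \<open>\<gamma> * c\<close> below its target.
\<close>

lemma Q_asymptotic_lower_bound:
  assumes w: "\<And>s. game_value (continuation r p \<gamma> w s) = w s"
    and inf: "\<And>s. infinite {k. \<sigma> k = s}"
    and div: "filterlim (\<lambda>n. \<Sum>c<n. \<beta> c) at_top sequentially" and \<delta>: "0 < \<delta>"
  shows "\<forall>\<^sub>F k in sequentially. \<forall>s i j. continuation r p \<gamma> w s i j \<le> Q k s i j + \<delta>"
    and "\<forall>\<^sub>F k in sequentially. \<forall>s. w s \<le> V k s + \<delta>"
proof -
  let ?Q = "continuation r p \<gamma> w"
  define P where "P c \<longleftrightarrow> (\<forall>\<^sub>F k in sequentially. \<forall>s i j. ?Q s i j \<le> Q k s i j + c)" for c
  have V: "\<forall>\<^sub>F k in sequentially. \<forall>s. w s \<le> V k s + c" if "P c" for c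
    using that unfolding P_def
  proof eventually_elim
    case (elim k)
    show ?case
    proof
      fix s
      have "game_value (?Q s) \<le> game_value (Q k s) + c"
        by (rule game_value_mono) (use elim in blast)
      then show "w s \<le> V k s + c"
        using game_value_le_best_value[of "Q k s" "\<mu> k s"] by (simp add: w)
    qed
  qed
  obtain D where D: "\<And>k s i j. \<bar>Q k s i j\<bar> \<le> D" using Q_bounded by metis
  define E where "E = Max (range (\<lambda>(s, x, y). \<bar>?Q s x y\<bar>))"
  have E: "\<bar>?Q s x y\<bar> \<le> E" for s x y
    unfolding E_def by (intro Max_ge) (auto intro: image_eqI[of _ _ "(s, x, y)"])
  have "P \<delta>"
  proof (rule contraction_of_bounds[where \<kappa>=\<gamma>])
    have "?Q s i j \<le> Q k s i j + (D + E)" for k s i j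
      using D[of k s i j] E[of s i j] by linarith
    then show "P (D + E)" unfolding P_def by (intro always_eventually allI)
  next
    fix c d assume "P c" "c \<le> d"
    from this(1) show "P d" unfolding P_def
      by (rule eventually_mono) (use \<open>c \<le> d\<close> in \<open>meson add_left_mono order_trans\<close>)
  next
    fix c e :: real assume c: "0 \<le> c" "0 < e" "P c"
    have "\<forall>\<^sub>F k in sequentially. ?Q s i j \<le> Q k s i j + (\<gamma> * c + e)" for s i j
    proof -
      have "\<forall>\<^sub>F k in sequentially. - Q (Suc k) s i j \<le> - Q k s i j + visit_step \<beta> \<sigma> s k * ((\<gamma> * c - ?Q s i j) - (- Q k s i j))"
        using V[OF c(3)]
      proof eventually_elim
        case (elim k)
        have "?Q s i j \<le> continuation r p \<gamma> (V k) s i j + \<gamma> * c"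
          by (rule continuation_mono[OF \<gamma>(1)]) (use elim in blast)
        then have "visit_step \<beta> \<sigma> s k * (Q k s i j - continuation r p \<gamma> (V k) s i j) \<le> visit_step \<beta> \<sigma> s k * (Q k s i j - (?Q s i j - \<gamma> * c))"
          by (intro mult_left_mono steps) simp
        then show ?case by (simp add: Q_update algebra_simps)
      qed
      then have "\<forall>\<^sub>F k in sequentially. - Q k s i j \<le> (\<gamma> * c - ?Q s i j) + e"
        by (rule eventually_le_of_relaxation) (use steps c visit_step_divergent[OF inf div] in auto)
      then show ?thesis by eventually_elim simp
    qed
    then show "P (\<gamma> * c + e)" unfolding P_def by (intro eventually_all_finite)
  qed (use \<gamma> \<delta> in auto)
  then show "\<forall>\<^sub>F k in sequentially. \<forall>s i j. ?Q s i j \<le> Q k s i j + \<delta>"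
    and "\<forall>\<^sub>F k in sequentially. \<forall>s. w s \<le> V k s + \<delta>"
    using V by (auto simp: P_def)
qed

end

section \<open>Both learning paths in a zero-sum game\<close>

lemma LIMSEQ_of_eventual_bounds:
  fixes X :: "nat \<Rightarrow> real"
  assumes "\<And>e. 0 < e \<Longrightarrow> \<forall>\<^sub>F k in sequentially. X k \<le> l + e" "\<And>e. 0 < e \<Longrightarrow> \<forall>\<^sub>F k in sequentially. l \<le> X k + e"
  shows "X \<longlonglongrightarrow> l"
proof (rule tendstoI)
  fix e :: real assume "0 < e"
  then have e: "0 < e / 2" "e / 2 < e" by auto
  show "\<forall>\<^sub>F k in sequentially. dist (X k) l < e"
    using assms(1)[OF e(1)] assms(2)[OF e(1)]
    by eventually_elim (use e in \<open>auto simp: dist_real_def\<close>)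
qed

text \<open>
  \<open>\<nu>\<close> and \<open>Q\<close> are the beliefs of player 1, \<open>\<mu>\<close> and \<open>R\<close> those of player 2, whose payoffs have the
  own action first. \<open>\<rho>\<close> and \<open>\<tau>\<close> are the limits of the step-size ratios of player 1 to player 2;
  whichever of the players is faster, \<open>max 1 \<rho> / min 1 \<rho>\<close> is the reciprocal of the ratio that is at
  most \<open>1\<close>.
\<close>

locale zero_sum_learning_paths =
  fixes r :: "'s::finite \<Rightarrow> 'a::finite \<Rightarrow> 'b::finite \<Rightarrow> real"
    and p \<gamma> \<alpha>1 \<beta>1 \<alpha>2 \<beta>2 \<sigma> x y \<mu> \<nu> Q R and w :: "'s \<Rightarrow> real" and \<rho> \<tau> :: real
  assumes P1: "learning_path_bounded_steps r p \<gamma> \<alpha>1 \<beta>1 \<sigma> x y \<nu> Q"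
    and P2: "learning_path_bounded_steps (\<lambda>s j i. - r s i j) (\<lambda>s j i. p s i j) \<gamma> \<alpha>2 \<beta>2 \<sigma> y x \<mu> R"
    and visited: "\<And>s. infinite {k. \<sigma> k = s}"
    and \<alpha>1_null: "\<alpha>1 \<longlonglongrightarrow> 0"
    and \<alpha>1_div: "filterlim (\<lambda>n. \<Sum>c<n. \<alpha>1 c) at_top sequentially"
    and \<beta>1_div: "filterlim (\<lambda>n. \<Sum>c<n. \<beta>1 c) at_top sequentially"
    and \<beta>2_div: "filterlim (\<lambda>n. \<Sum>c<n. \<beta>2 c) at_top sequentially"
    and timescale1: "(\<lambda>c. \<beta>1 c / \<alpha>1 c) \<longlonglongrightarrow> 0"
    and timescale2: "(\<lambda>c. \<beta>2 c / \<alpha>2 c) \<longlonglongrightarrow> 0"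
    and \<rho>: "0 < \<rho>" "(\<lambda>c. \<alpha>2 c / \<alpha>1 c) \<longlonglongrightarrow> 1 / \<rho>"
    and \<tau>: "0 < \<tau>" "(\<lambda>c. \<beta>2 c / \<beta>1 c) \<longlonglongrightarrow> 1 / \<tau>"
    and contraction: "\<gamma> * (max 1 \<rho> / min 1 \<rho>) * (max 1 \<tau> / min 1 \<tau>) < 1"
    and w: "\<And>s. game_value (continuation r p \<gamma> w s) = w s"
begin

sublocale P1: learning_path_bounded_steps r p \<gamma> \<alpha>1 \<beta>1 \<sigma> x y \<nu> Q by (rule P1)
sublocale P2: learning_path_bounded_steps "\<lambda>s j i. - r s i j" "\<lambda>s j i. p s i j" \<gamma> \<alpha>2 \<beta>2 \<sigma> y x \<mu> R by (rule P2)

abbreviation "Qs \<equiv> continuation r p \<gamma> w"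

lemma opponent_continuation:
  "continuation (\<lambda>s j i. - r s i j) (\<lambda>s j i. p s i j) \<gamma> v s j i = - continuation r p \<gamma> (\<lambda>s. - v s) s i j"
  by (simp add: continuation_def sum_negf)

lemma lower_bounds:
  assumes "0 < \<delta>"
  shows "\<forall>\<^sub>F k in sequentially. \<forall>s i j. Qs s i j \<le> Q k s i j + \<delta>"
    "\<forall>\<^sub>F k in sequentially. \<forall>s. w s \<le> P1.V k s + \<delta>"
    "\<forall>\<^sub>F k in sequentially. \<forall>s j i. - Qs s i j \<le> R k s j i + \<delta>"
    "\<forall>\<^sub>F k in sequentially. \<forall>s. - w s \<le> P2.V k s + \<delta>"
  using P1.Q_asymptotic_lower_bound[OF w visited \<beta>1_div assms]
    P2.Q_asymptotic_lower_bound[OF Shapley_equation_opponent[where r=r and p=p, OF w] visited \<beta>2_div assms]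
  by (simp_all add: opponent_continuation)

text \<open>
  Subtracting \<open>w s\<close> from the payoffs of player 1 and adding it to those of player 2 leaves \<open>Q + R\<close>
  unchanged and makes both best-reply values asymptotically nonnegative, so
  \<open>fictitious_play_limsup\<close> applies to state \<open>s\<close>.
\<close>

lemma belief_timescale_bound:
  assumes up: "\<forall>\<^sub>F k in sequentially. \<forall>s i j. Q k s i j + R k s j i \<le> \<zeta>" and \<zeta>: "0 \<le> \<zeta>" and e: "0 < e"
  shows "\<forall>\<^sub>F k in sequentially. \<forall>s. P1.V k s + P2.V k s \<le> max 1 \<rho> / min 1 \<rho> * \<zeta> + e"
proof (rule eventually_all_finite)
  fix s
  obtain D1 where D1: "1 \<le> D1" "\<And>k s i j. \<bar>Q k s i j\<bar> \<le> D1" "\<And>k s i j. \<bar>continuation r p \<gamma> (P1.V k) s i j\<bar> \<le> D1"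
    using P1.Q_bounded by blast
  obtain D2 where D2: "1 \<le> D2" "\<And>k s i j. \<bar>R k s i j\<bar> \<le> D2"
      "\<And>k s j i. \<bar>continuation (\<lambda>s j i. - r s i j) (\<lambda>s j i. p s i j) \<gamma> (P2.V k) s j i\<bar> \<le> D2"
    using P2.Q_bounded by blast
  define D where "D = D1 + D2 + \<bar>w s\<bar>"
  define F where "F k i = action_value (Q k s) (\<nu> k s) i - w s" for k i
  define G where "G k j = action_value (R k s) (\<mu> k s) j + w s" for k j
  define A where "A k i j = Q k s i j - w s" for k i j
  define B where "B k i j = R k s j i + w s" for k i j
  \<comment> \<open>At stages at which \<open>s\<close> is not visited, the steps are \<open>0\<close> and any best reply in \<open>s\<close> will do as the
    action played.\<close>
  define x' where "x' k = (if s = \<sigma> k then x k else SOME i. \<forall>i'. F k i' \<le> F k i)" for k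
  define y' where "y' k = (if s = \<sigma> k then y k else SOME j. \<forall>j'. G k j' \<le> G k j)" for k
  let ?h = "visit_step \<alpha>1 \<sigma> s" and ?h2 = "visit_step \<alpha>2 \<sigma> s" and ?b1 = "visit_step \<beta>1 \<sigma> s" and ?b2 = "visit_step \<beta>2 \<sigma> s"
  have x': "F k i \<le> F k (x' k)" for k i
    using P1.played_action[of k i] someI_ex[OF ex_maximiser[of "F k"]] by (auto simp: x'_def F_def)
  have y': "G k j \<le> G k (y' k)" for k j
    using P2.played_action[of k j] someI_ex[OF ex_maximiser[of "G k"]] by (auto simp: y'_def G_def)
  have u: "P1.V k s - w s = F k (x' k)" for k
    using best_value_eq_if_maximal[of "Q k s" "\<nu> k s" "x' k"] x'[of k] by (simp add: F_def)
  have v: "P2.V k s + w s = G k (y' k)" for k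
    using best_value_eq_if_maximal[of "R k s" "\<mu> k s" "y' k"] y'[of k] by (simp add: G_def)
  have small: "\<forall>\<^sub>F k in sequentially. C * ?b1 k \<le> \<epsilon> * ?h k" "\<forall>\<^sub>F k in sequentially. C * ?b2 k \<le> \<epsilon> * ?h k"
    "\<forall>\<^sub>F k in sequentially. C * \<bar>\<rho> * ?h2 k - ?h k\<bar> \<le> \<epsilon> * ?h k" if C: "0 < C" and \<epsilon>: "0 < \<epsilon>" for C \<epsilon>
  proof -
    have "0 < \<epsilon> / C" using C \<epsilon> by simp
    from visit_step_ratio[OF visited P1.\<alpha>(1) timescale1 this, of s]
    show "\<forall>\<^sub>F k in sequentially. C * ?b1 k \<le> \<epsilon> * ?h k"
      using C by (auto elim!: eventually_mono simp: abs_le_iff field_simps)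
    have eq: "\<beta>2 c / \<alpha>2 c * (\<alpha>2 c / \<alpha>1 c) = \<beta>2 c / \<alpha>1 c" for c
      using P2.\<alpha>(1)[of c] by simp
    have "(\<lambda>c. \<beta>2 c / \<alpha>1 c) \<longlonglongrightarrow> 0"
      using tendsto_mult[OF timescale2 \<rho>(2)] unfolding eq by simp
    from visit_step_ratio[OF visited P1.\<alpha>(1) this \<open>0 < \<epsilon> / C\<close>, of s]
    show "\<forall>\<^sub>F k in sequentially. C * ?b2 k \<le> \<epsilon> * ?h k"
      using C by (auto elim!: eventually_mono simp: abs_le_iff field_simps)
    have "0 < \<epsilon> / (C * \<rho>)" using C \<epsilon> \<rho> by simp
    from visit_step_ratio[OF visited P1.\<alpha>(1) \<rho>(2) this, of s]
    show "\<forall>\<^sub>F k in sequentially. C * \<bar>\<rho> * ?h2 k - ?h k\<bar> \<le> \<epsilon> * ?h k"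
    proof eventually_elim
      case (elim k)
      have "\<rho> * ?h2 k - ?h k = \<rho> * (?h2 k - 1 / \<rho> * ?h k)" using \<rho>(1) by (simp add: algebra_simps)
      then have "C * \<bar>\<rho> * ?h2 k - ?h k\<bar> = C * \<rho> * \<bar>?h2 k - 1 / \<rho> * ?h k\<bar>"
        using \<rho>(1) by (simp add: abs_mult)
      also have "\<dots> \<le> C * \<rho> * (\<epsilon> / (C * \<rho>) * ?h k)"
        using elim C \<rho>(1) by (intro mult_left_mono) auto
      also have "\<dots> = \<epsilon> * ?h k" using C \<rho>(1) by simp
      finally show ?case .
    qed
  qed
  have ABbound: "\<bar>A k i j\<bar> \<le> D" "\<bar>B k i j\<bar> \<le> D" for k i j
    using D1(1) D2(1) D1(2)[of k s i j] D2(2)[of k s j i] unfolding A_def B_def D_def by linarith+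
  have FGbound: "\<bar>F k i\<bar> \<le> D" "\<bar>G k j\<bar> \<le> D" for k i j
    using D1(1) D2(1) action_value_abs_le[of "Q k s" i D1 "\<nu> k s", OF D1(2)] action_value_abs_le[of "R k s" j D2 "\<mu> k s", OF D2(2)]
    unfolding F_def G_def D_def by linarith+
  have "\<forall>\<^sub>F k in sequentially. F k (x' k) + G k (y' k) \<le> max 1 \<rho> / min 1 \<rho> * \<zeta> + e"
  proof (rule fictitious_play_limsup[where h="?h" and F=F and G=G and x=x' and y=y' and A=A and B=B and D=D, OF _ _ _ _ \<rho>(1) x' y' _ FGbound ABbound])
    show "0 \<le> ?h k" "?h k \<le> 1" for k by (rule P1.steps)+
    show "?h \<longlonglongrightarrow> 0" by (rule visit_step_tendsto_0[OF visited P1.\<alpha>(1) \<alpha>1_null])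
    show "filterlim (\<lambda>n. sum ?h {..<n}) at_top sequentially" by (rule visit_step_divergent[OF visited \<alpha>1_div])
    show "1 \<le> D" using D1(1) D2(1) by (simp add: D_def)
    show "\<forall>\<^sub>F k in sequentially. \<forall>i j. A k i j + B k i j \<le> \<zeta>"
      using up by eventually_elim (simp add: A_def B_def)
    have F_step: "\<bar>F (Suc k) i - F k i - ?h k * (A k i (y' k) - F k i)\<bar> \<le> 2 * D1 * ?b1 k" for k i
    proof -
      have eq: "?h k * (A k i (y' k) - F k i) = ?h k * (Q k s i (y k) - action_value (Q k s) (\<nu> k s) i)"
        by (simp add: visit_step_def y'_def A_def F_def)
      show ?thesis unfolding eq using P1.action_value_change[OF D1(2,3), of k s i] by (simp add: F_def)
    qed
    have G_step: "\<bar>G (Suc k) j - G k j - ?h2 k * (B k (x' k) j - G k j)\<bar> \<le> 2 * D2 * ?b2 k" for k j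
    proof -
      have eq: "?h2 k * (B k (x' k) j - G k j) = ?h2 k * (R k s j (x k) - action_value (R k s) (\<mu> k s) j)"
        by (simp add: visit_step_def x'_def B_def G_def)
      show ?thesis unfolding eq using P2.action_value_change[OF D2(2,3), of k s j] by (simp add: G_def)
    qed
    fix \<epsilon> :: real assume \<epsilon>: "0 < \<epsilon>"
    show "\<forall>\<^sub>F k in sequentially. \<forall>i. \<bar>F (Suc k) i - F k i - ?h k * (A k i (y' k) - F k i)\<bar> \<le> \<epsilon> * ?h k"
      using small(1)[of "2 * D1", OF _ \<epsilon>] D1(1) F_step by (auto elim!: eventually_mono intro: order_trans)
    show "\<forall>\<^sub>F k in sequentially. \<forall>i j. \<bar>A (Suc k) i j - A k i j\<bar> \<le> \<epsilon> * ?h k"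
    proof (rule eventually_mono[OF small(1)[of "2 * D1", OF _ \<epsilon>]])
      fix k assume "2 * D1 * ?b1 k \<le> \<epsilon> * ?h k"
      then show "\<forall>i j. \<bar>A (Suc k) i j - A k i j\<bar> \<le> \<epsilon> * ?h k"
        using order_trans[OF P1.Q_change[OF D1(2,3)]] by (simp add: A_def)
    qed (use D1 in simp)
    show "\<forall>\<^sub>F k in sequentially. \<forall>i j. \<bar>B (Suc k) i j - B k i j\<bar> \<le> \<epsilon> * ?h k"
    proof (rule eventually_mono[OF small(2)[of "2 * D2", OF _ \<epsilon>]])
      fix k assume "2 * D2 * ?b2 k \<le> \<epsilon> * ?h k"
      then show "\<forall>i j. \<bar>B (Suc k) i j - B k i j\<bar> \<le> \<epsilon> * ?h k"
        using order_trans[OF P2.Q_change[OF D2(2,3)]] by (simp add: B_def)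
    qed (use D2 in simp)
    have \<epsilon>2: "0 < \<epsilon> / 2" "0 < \<rho> * (2 * D2)" "0 < 2 * D" using \<epsilon> \<rho> D2(1) D1(1) by (auto simp: D_def add_pos_nonneg)
    show "\<forall>\<^sub>F k in sequentially. \<forall>j. \<bar>\<rho> * (G (Suc k) j - G k j) - ?h k * (B k (x' k) j - G k j)\<bar> \<le> \<epsilon> * ?h k"
      using small(2)[OF \<epsilon>2(2,1)] small(3)[OF \<epsilon>2(3,1)]
    proof (eventually_elim, intro allI)
      fix k j assume a: "\<rho> * (2 * D2) * ?b2 k \<le> \<epsilon> / 2 * ?h k" "2 * D * \<bar>\<rho> * ?h2 k - ?h k\<bar> \<le> \<epsilon> / 2 * ?h k"
      let ?E = "B k (x' k) j - G k j"
      let ?d = "G (Suc k) j - G k j - ?h2 k * ?E"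
      have "\<rho> * (G (Suc k) j - G k j) - ?h k * ?E = \<rho> * ?d + (\<rho> * ?h2 k - ?h k) * ?E"
        by (simp add: algebra_simps)
      then have "\<bar>\<rho> * (G (Suc k) j - G k j) - ?h k * ?E\<bar> \<le> \<bar>\<rho> * ?d\<bar> + \<bar>(\<rho> * ?h2 k - ?h k) * ?E\<bar>"
        by linarith
      moreover have "\<bar>\<rho> * ?d\<bar> \<le> \<rho> * (2 * D2 * ?b2 k)"
        using mult_left_mono[OF G_step[of k j], of \<rho>] \<rho>(1) by (simp add: abs_mult)
      moreover have "\<bar>?E\<bar> \<le> 2 * D" using ABbound(2)[of k "x' k" j] FGbound(2)[of k j] by linarith
      then have "\<bar>(\<rho> * ?h2 k - ?h k) * ?E\<bar> \<le> \<bar>\<rho> * ?h2 k - ?h k\<bar> * (2 * D)"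
        unfolding abs_mult by (rule mult_left_mono) simp
      ultimately show "\<bar>\<rho> * (G (Suc k) j - G k j) - ?h k * ?E\<bar> \<le> \<epsilon> * ?h k"
        using a by (simp add: mult_ac)
    qed
    show "\<forall>\<^sub>F k in sequentially. - \<epsilon> \<le> F k (x' k)"
      using lower_bounds(2)[OF \<epsilon>] unfolding u[symmetric] by eventually_elim (simp add: algebra_simps)
    show "\<forall>\<^sub>F k in sequentially. - \<epsilon> \<le> G k (y' k)"
      using lower_bounds(4)[OF \<epsilon>] unfolding v[symmetric]
      by eventually_elim (metis add.commute add_uminus_conv_diff le_diff_eq minus_le_iff minus_minus)
  qed (use \<zeta> e in auto)
  then show "\<forall>\<^sub>F k in sequentially. P1.V k s + P2.V k s \<le> max 1 \<rho> / min 1 \<rho> * \<zeta> + e"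
    by eventually_elim (simp add: u[symmetric] v[symmetric])
qed

text \<open>
  In \<open>Q + R\<close> the stage payoffs cancel, and the continuation values add up to at most \<open>\<gamma> * c\<close>.
\<close>

lemma Q_timescale_bound:
  assumes up: "\<forall>\<^sub>F k in sequentially. \<forall>s. P1.V k s + P2.V k s \<le> c" and e: "0 < e"
  shows "\<forall>\<^sub>F k in sequentially. \<forall>s i j. Q k s i j + R k s j i \<le> max 1 \<tau> / min 1 \<tau> * (\<gamma> * c) + e"
proof (intro eventually_all_finite)
  fix s i j
  let ?g = "visit_step \<beta>1 \<sigma> s" and ?g2 = "visit_step \<beta>2 \<sigma> s"
  let ?C2 = "\<lambda>k. continuation (\<lambda>s j i. - r s i j) (\<lambda>s j i. p s i j) \<gamma> (P2.V k) s j i"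
  obtain D where D: "1 \<le> D" "\<And>k s i j. \<bar>R k s i j\<bar> \<le> D" "\<And>k s j i. \<bar>continuation (\<lambda>s j i. - r s i j) (\<lambda>s j i. p s i j) \<gamma> (P2.V k) s j i\<bar> \<le> D"
    using P2.Q_bounded by blast
  have "\<forall>\<^sub>F k in sequentially. (Q k s i j - Qs s i j) + (R k s j i + Qs s i j) \<le> max 1 \<tau> / min 1 \<tau> * (\<gamma> * c) + e"
  proof (rule coupled_relaxation_limsup[where g="?g" and p="\<lambda>k. Q k s i j - Qs s i j" and q="\<lambda>k. R k s j i + Qs s i j" and U="\<lambda>k. continuation r p \<gamma> (P1.V k) s i j - Qs s i j" and W="\<lambda>k. ?C2 k + Qs s i j", OF _ _ _ \<tau>(1)])
    show "0 \<le> ?g k" "?g k \<le> 1" for k by (rule P1.steps)+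
    show "filterlim (\<lambda>n. sum ?g {..<n}) at_top sequentially" by (rule visit_step_divergent[OF visited \<beta>1_div])
    show "\<forall>\<^sub>F k in sequentially. (continuation r p \<gamma> (P1.V k) s i j - Qs s i j) + (?C2 k + Qs s i j) \<le> \<gamma> * c"
      using up
    proof eventually_elim
      case (elim k)
      have "P1.V k s' \<le> - P2.V k s' + c" for s' using elim[rule_format, of s'] by linarith
      then have "continuation r p \<gamma> (P1.V k) s i j \<le> continuation r p \<gamma> (\<lambda>s. - P2.V k s) s i j + \<gamma> * c"
        by (intro continuation_mono P1.\<gamma>)
      then show ?case by (simp add: opponent_continuation)
    qed
    fix \<epsilon> :: real assume \<epsilon>: "0 < \<epsilon>"
    show "\<forall>\<^sub>F k in sequentially. \<bar>(Q (Suc k) s i j - Qs s i j) - (Q k s i j - Qs s i j) -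
        ?g k * ((continuation r p \<gamma> (P1.V k) s i j - Qs s i j) - (Q k s i j - Qs s i j))\<bar> \<le> \<epsilon> * ?g k"
      using \<epsilon> P1.steps by (intro always_eventually) (simp add: P1.Q_update)
    show "\<forall>\<^sub>F k in sequentially. - \<epsilon> \<le> Q k s i j - Qs s i j"
      using lower_bounds(1)[OF \<epsilon>] by (auto elim!: eventually_mono simp: algebra_simps)
    show "\<forall>\<^sub>F k in sequentially. - \<epsilon> \<le> R k s j i + Qs s i j"
      using lower_bounds(3)[OF \<epsilon>]
    proof eventually_elim
      case (elim k) then show ?case using elim[rule_format, of s i j] by linarith
    qed
    have "0 < \<epsilon> / (2 * D * \<tau>)" using \<epsilon> D \<tau> by simp
    from visit_step_ratio[OF visited P1.\<beta>(1) \<tau>(2) this, of s]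
    show "\<forall>\<^sub>F k in sequentially. \<bar>\<tau> * ((R (Suc k) s j i + Qs s i j) - (R k s j i + Qs s i j)) -
        ?g k * ((?C2 k + Qs s i j) - (R k s j i + Qs s i j))\<bar> \<le> \<epsilon> * ?g k"
    proof eventually_elim
      case (elim k)
      let ?E = "?C2 k - R k s j i"
      have "\<tau> * (R (Suc k) s j i - R k s j i) - ?g k * ?E = \<tau> * (?g2 k - 1 / \<tau> * ?g k) * ?E"
        using \<tau>(1) by (simp add: P2.Q_update algebra_simps)
      also have "\<bar>\<dots>\<bar> = \<tau> * \<bar>?g2 k - 1 / \<tau> * ?g k\<bar> * \<bar>?E\<bar>"
        using \<tau>(1) by (simp add: abs_mult)
      also have "\<dots> \<le> \<tau> * (\<epsilon> / (2 * D * \<tau>) * ?g k) * (2 * D)"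
      proof (intro mult_mono mult_left_mono)
        show "\<bar>?E\<bar> \<le> 2 * D" using D(2)[of k s j i] D(3)[of k s j i] by linarith
      qed (use elim \<tau> D \<epsilon> P1.steps in auto)
      also have "\<dots> = \<epsilon> * ?g k" using \<tau>(1) D(1) by simp
      finally show ?case by simp
    qed
  qed (rule e)
  then show "\<forall>\<^sub>F k in sequentially. Q k s i j + R k s j i \<le> max 1 \<tau> / min 1 \<tau> * (\<gamma> * c) + e" by simp
qed

text \<open>
  One round through the two timescales multiplies an asymptotic bound on \<open>Q + R\<close> by
  \<open>\<gamma> * k1 * k2 < 1\<close>, so \<open>Q + R\<close> is asymptotically at most \<open>0\<close>. The lower bounds on the single summands
  then leave no room.
\<close>

theorem convergence:
  shows "(\<lambda>k. Q k s i j) \<longlonglongrightarrow> Qs s i j" "(\<lambda>k. R k s j i) \<longlonglongrightarrow> - Qs s i j"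
    "(\<lambda>k. P1.V k s) \<longlonglongrightarrow> w s" "(\<lambda>k. P2.V k s) \<longlonglongrightarrow> - w s"
proof -
  define k1 where "k1 = max 1 \<rho> / min 1 \<rho>"
  define k2 where "k2 = max 1 \<tau> / min 1 \<tau>"
  have k: "0 < k1" "0 < k2" using \<rho>(1) \<tau>(1) by (auto simp: k1_def k2_def)
  have k\<gamma>: "\<gamma> * k1 * k2 < 1" "0 \<le> \<gamma> * k1 * k2"
    using contraction k P1.\<gamma> by (simp_all only: k1_def[symmetric] k2_def[symmetric] mult_nonneg_nonneg less_imp_le)
  define P where "P c \<longleftrightarrow> (\<forall>\<^sub>F k in sequentially. \<forall>s i j. Q k s i j + R k s j i \<le> c)" for c
  note fast = belief_timescale_bound[folded k1_def P_def] and slow = Q_timescale_bound[folded k2_def P_def]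
  obtain D1 where D1: "\<And>k s i j. \<bar>Q k s i j\<bar> \<le> D1" by (rule P1.Q_bounded) (rule that)
  obtain D2 where D2: "\<And>k s i j. \<bar>R k s i j\<bar> \<le> D2" by (rule P2.Q_bounded) (rule that)
  have P: "P e" if "0 < e" for e
  proof (rule contraction_of_bounds[where \<kappa>="\<gamma> * k1 * k2"])
    have "Q k s i j + R k s j i \<le> D1 + D2" for k s i j
      using D1[of k s i j] D2[of k s j i] by linarith
    then show "P (D1 + D2)" unfolding P_def by (intro always_eventually allI)
  next
    fix c d assume "P c" "c \<le> d"
    then show "P d" unfolding P_def by (auto elim!: eventually_mono intro: order_trans)
  next
    fix c d :: real assume c: "0 \<le> c" "0 < d" "P c"
    define t where "t = d / (k2 * \<gamma> + 1)"
    have pos: "0 < k2 * \<gamma> + 1" using k P1.\<gamma> by (simp add: add_nonneg_pos)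
    then have "(k2 * \<gamma> + 1) * t = d" by (simp add: t_def)
    then have t: "0 < t" "k2 * \<gamma> * t + t = d"
      using c pos by (simp add: t_def, simp add: distrib_right)
    from slow[OF fast[OF c(3,1) t(1)] t(1)]
    have "P (k2 * (\<gamma> * (k1 * c + t)) + t)" .
    moreover have "k2 * (\<gamma> * (k1 * c + t)) + t = \<gamma> * k1 * k2 * c + d"
      using t(2) by (simp add: algebra_simps)
    ultimately show "P (\<gamma> * k1 * k2 * c + d)" by simp
  qed (use k\<gamma> that in auto)
  have V: "\<forall>\<^sub>F k in sequentially. \<forall>s. P1.V k s + P2.V k s \<le> e" if "0 < e" for e
  proof -
    have e: "0 < e / (2 * k1)" "0 < e / 2" using that k by auto
    from fast[OF P[OF e(1)] less_imp_le[OF e(1)] e(2)] show ?thesis using k by simp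
  qed
  have half: "0 < e / 2" if "0 < e" for e :: real using that by simp
  show "(\<lambda>k. Q k s i j) \<longlonglongrightarrow> Qs s i j"
  proof (rule LIMSEQ_of_eventual_bounds)
    fix e :: real assume e: "0 < e"
    show "\<forall>\<^sub>F k in sequentially. Q k s i j \<le> Qs s i j + e"
      using P[OF half[OF e], unfolded P_def] lower_bounds(3)[OF half[OF e]]
    proof eventually_elim
      case (elim k) then show ?case using elim(1)[rule_format, of s i j] elim(2)[rule_format, of s i j] by linarith
    qed
    show "\<forall>\<^sub>F k in sequentially. Qs s i j \<le> Q k s i j + e"
      using lower_bounds(1)[OF e] by eventually_elim blast
  qed
  show "(\<lambda>k. R k s j i) \<longlonglongrightarrow> - Qs s i j"
  proof (rule LIMSEQ_of_eventual_bounds)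
    fix e :: real assume e: "0 < e"
    show "\<forall>\<^sub>F k in sequentially. R k s j i \<le> - Qs s i j + e"
      using P[OF half[OF e], unfolded P_def] lower_bounds(1)[OF half[OF e]]
    proof eventually_elim
      case (elim k) then show ?case using elim(1)[rule_format, of s i j] elim(2)[rule_format, of s i j] by linarith
    qed
    show "\<forall>\<^sub>F k in sequentially. - Qs s i j \<le> R k s j i + e"
      using lower_bounds(3)[OF e] by eventually_elim blast
  qed
  show "(\<lambda>k. P1.V k s) \<longlonglongrightarrow> w s"
  proof (rule LIMSEQ_of_eventual_bounds)
    fix e :: real assume e: "0 < e"
    show "\<forall>\<^sub>F k in sequentially. P1.V k s \<le> w s + e"
      using V[OF half[OF e]] lower_bounds(4)[OF half[OF e]]
    proof eventually_elim
      case (elim k) then show ?case using elim(1)[rule_format, of s] elim(2)[rule_format, of s] by linarith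
    qed
    show "\<forall>\<^sub>F k in sequentially. w s \<le> P1.V k s + e"
      using lower_bounds(2)[OF e] by eventually_elim blast
  qed
  show "(\<lambda>k. P2.V k s) \<longlonglongrightarrow> - w s"
  proof (rule LIMSEQ_of_eventual_bounds)
    fix e :: real assume e: "0 < e"
    show "\<forall>\<^sub>F k in sequentially. P2.V k s \<le> - w s + e"
      using V[OF half[OF e]] lower_bounds(2)[OF half[OF e]]
    proof eventually_elim
      case (elim k) then show ?case using elim(1)[rule_format, of s] elim(2)[rule_format, of s] by linarith
    qed
    show "\<forall>\<^sub>F k in sequentially. - w s \<le> P2.V k s + e"
      using lower_bounds(4)[OF e] by eventually_elim blast
  qed
qed

end

section \<open>Discounted payoffs and stationary equilibrium\<close>

lemma expectation_finite_sum:
  fixes f :: "'u::finite \<Rightarrow> real"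
  shows "measure_pmf.expectation M f = (\<Sum>u\<in>UNIV. pmf M u * f u)"
  by (subst integral_measure_pmf_real[of UNIV]) (auto simp: mult.commute)

lemma expectation_bind_pmf:
  fixes f :: "'v::finite \<Rightarrow> real" and M :: "'u::finite pmf"
  shows "measure_pmf.expectation (bind_pmf M N) f = measure_pmf.expectation M (\<lambda>u. measure_pmf.expectation (N u) f)"
  by (subst pmf_expectation_bind[of UNIV]) (auto simp: expectation_finite_sum)

lemma expectation_mono:
  fixes f g :: "'u::finite \<Rightarrow> real"
  assumes "\<And>u. f u \<le> g u"
  shows "measure_pmf.expectation M f \<le> measure_pmf.expectation M g"
  unfolding expectation_finite_sum by (intro sum_mono mult_left_mono assms) simp

definition play_step :: "('s \<Rightarrow> 'a \<Rightarrow> 'b \<Rightarrow> 's pmf) \<Rightarrow> ('s, 'a) strategy \<Rightarrow> ('s, 'b) strategy \<Rightarrow> 's \<times> 'a \<times> 'b \<Rightarrow> ('s \<times> 'a \<times> 'b) pmf" where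
  "play_step p \<pi>1 \<pi>2 = (\<lambda>(s, a, b). bind_pmf (p s a b) (stage_pmf \<pi>1 \<pi>2))"

text \<open>
  The law of the \<open>n\<close>-th triple of a play as a probability mass function, which reduces discounted
  payoffs to finite sums.
\<close>

primrec play_marginal :: "('s \<Rightarrow> 'a \<Rightarrow> 'b \<Rightarrow> 's pmf) \<Rightarrow> ('s, 'a) strategy \<Rightarrow> ('s, 'b) strategy \<Rightarrow> 's \<Rightarrow> nat \<Rightarrow> ('s \<times> 'a \<times> 'b) pmf" where
  "play_marginal p \<pi>1 \<pi>2 s0 0 = stage_pmf \<pi>1 \<pi>2 s0"
| "play_marginal p \<pi>1 \<pi>2 s0 (Suc n) = bind_pmf (play_marginal p \<pi>1 \<pi>2 s0 n) (play_step p \<pi>1 \<pi>2)"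

context
  fixes p :: "'s::finite \<Rightarrow> 'a::finite \<Rightarrow> 'b::finite \<Rightarrow> 's pmf" and \<pi>1 :: "('s, 'a) strategy" and \<pi>2 :: "('s, 'b) strategy" and s0 :: 's
begin

interpretation IT: Ionescu_Tulcea "play_kernel p \<pi>1 \<pi>2 s0" "\<lambda>_. count_space UNIV"
  by (rule Ionescu_Tulcea_play_kernel)

lemma play_measure_eq_lim: "play_measure p \<pi>1 \<pi>2 s0 = IT.PF.lim"
  by (simp add: play_measure_def)

lemma sets_play_measure: "sets (play_measure p \<pi>1 \<pi>2 s0) = sets (Pi\<^sub>M UNIV (\<lambda>_. count_space UNIV))"
  by (simp add: play_measure_eq_lim)

lemma prob_space_play_measure: "prob_space (play_measure p \<pi>1 \<pi>2 s0)"
proof (rule prob_space_distrD)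
  show "(\<lambda>\<omega>. restrict \<omega> {0}) \<in> measurable (play_measure p \<pi>1 \<pi>2 s0) (Pi\<^sub>M {0} (\<lambda>_. count_space UNIV))"
    by (subst measurable_cong_sets[OF sets_play_measure refl]) (intro measurable_restrict_subset, simp)
  show "prob_space (distr (play_measure p \<pi>1 \<pi>2 s0) (Pi\<^sub>M {0} (\<lambda>_. count_space UNIV)) (\<lambda>\<omega>. restrict \<omega> {0}))"
    unfolding play_measure_eq_lim by (subst IT.distr_lim) (auto intro: IT.PF.prob_space_P)
qed

lemma coordinate_measurable: "(\<lambda>\<omega>. \<omega> k) \<in> measurable (play_measure p \<pi>1 \<pi>2 s0) (count_space UNIV)"
  by (subst measurable_cong_sets[OF sets_play_measure refl]) (rule measurable_component_singleton, simp)

lemma coordinate_measurable':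
  "k < (n::nat) \<Longrightarrow> (\<lambda>\<omega>. f (\<omega> k)) \<in> borel_measurable (Pi\<^sub>M {0..<n} (\<lambda>_. count_space UNIV))"
  by (rule measurable_compose[OF measurable_component_singleton]) simp_all

text \<open>
  The kernel of the play depends on the history only through the last triple, so integrating out the
  last coordinate is one step of the Markov chain \<open>play_marginal\<close>.
\<close>

lemma nn_integral_C_coordinate:
  fixes f :: "'s \<times> 'a \<times> 'b \<Rightarrow> ennreal"
  shows "(\<integral>\<^sup>+\<omega>. f (\<omega> k) \<partial>IT.C 0 (Suc k) (\<lambda>_. undefined)) = (\<integral>\<^sup>+t. f t \<partial>play_marginal p \<pi>1 \<pi>2 s0 k)"
proof (induction k arbitrary: f)
  have init: "(\<lambda>_. undefined) \<in> space (Pi\<^sub>M {0..<0::nat} (\<lambda>_. count_space (UNIV :: ('s \<times> 'a \<times> 'b) set)))"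
    by (simp add: space_PiM)
  have step: "(\<integral>\<^sup>+\<omega>. f (\<omega> k) \<partial>IT.C 0 (Suc k) (\<lambda>_. undefined)) =
      (\<integral>\<^sup>+\<omega>. (\<integral>\<^sup>+t. f t \<partial>play_kernel p \<pi>1 \<pi>2 s0 k \<omega>) \<partial>IT.C 0 k (\<lambda>_. undefined))" for k and f :: "'s \<times> 'a \<times> 'b \<Rightarrow> ennreal"
  proof -
    have "(\<integral>\<^sup>+\<omega>. f (\<omega> k) \<partial>IT.C 0 (Suc k) (\<lambda>_. undefined)) =
        (\<integral>\<^sup>+\<omega>. (\<integral>\<^sup>+\<omega>'. f (\<omega>' k) \<partial>IT.eP k \<omega>) \<partial>IT.C 0 k (\<lambda>_. undefined))"
    proof (simp only: IT.C.simps add_0, rule nn_integral_bind)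
      show "(\<lambda>\<omega>. f (\<omega> k)) \<in> borel_measurable (Pi\<^sub>M {0..<Suc k} (\<lambda>_. count_space UNIV))"
        by (rule coordinate_measurable') simp
      show "IT.eP k \<in> measurable (IT.C 0 k (\<lambda>_. undefined)) (subprob_algebra (Pi\<^sub>M {0..<Suc k} (\<lambda>_. count_space UNIV)))"
        by (subst measurable_cong_sets[OF IT.sets_C[OF init, of k, unfolded add_0] refl]) (rule IT.measurable_eP)
    qed
    also have "\<dots> = (\<integral>\<^sup>+\<omega>. (\<integral>\<^sup>+t. f t \<partial>play_kernel p \<pi>1 \<pi>2 s0 k \<omega>) \<partial>IT.C 0 k (\<lambda>_. undefined))"
    proof (rule nn_integral_cong)
      fix \<omega> assume "\<omega> \<in> space (IT.C 0 k (\<lambda>_. undefined))"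
      then have "\<omega> \<in> space (Pi\<^sub>M {0..<k} (\<lambda>_. count_space UNIV))"
        using IT.space_C[OF init, of k] by simp
      then show "(\<integral>\<^sup>+\<omega>'. f (\<omega>' k) \<partial>IT.eP k \<omega>) = (\<integral>\<^sup>+t. f t \<partial>play_kernel p \<pi>1 \<pi>2 s0 k \<omega>)"
        by (subst IT.nn_integral_eP) (auto intro: coordinate_measurable')
    qed
    finally show ?thesis .
  qed
  {
    case 0
    then show ?case unfolding step
      by (simp add: nn_integral_return[OF init] nn_integral_const)
  next
    case (Suc k)
    have "play_kernel p \<pi>1 \<pi>2 s0 (Suc k) \<omega> = measure_pmf (play_step p \<pi>1 \<pi>2 (\<omega> k))" for \<omega>
      by (simp add: play_step_def split: prod.split)
    then show ?case
      by (subst step) (simp only: Suc.IH[of "\<lambda>t. \<integral>\<^sup>+t'. f t' \<partial>play_step p \<pi>1 \<pi>2 t"] play_marginal.simps nn_integral_bind_pmf)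
  }
qed

lemma distr_play_coordinate:
  "distr (play_measure p \<pi>1 \<pi>2 s0) (count_space UNIV) (\<lambda>\<omega>. \<omega> k) = measure_pmf (play_marginal p \<pi>1 \<pi>2 s0 k)"
proof (rule measure_eqI)
  have init: "(\<lambda>_. undefined) \<in> space (Pi\<^sub>M {0..<0::nat} (\<lambda>_. count_space (UNIV :: ('s \<times> 'a \<times> 'b) set)))"
    by (simp add: space_PiM)
  let ?J = "{0..<Suc k}"
  have up_to: "IT.up_to ?J = Suc k"
    by (rule antisym) (simp add: IT.up_to_iff, use IT.up_to_less[of ?J k] in simp)
  have restr: "(\<lambda>\<omega>. restrict \<omega> ?J) \<in> measurable (play_measure p \<pi>1 \<pi>2 s0) (Pi\<^sub>M ?J (\<lambda>_. count_space UNIV))"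
    by (subst measurable_cong_sets[OF sets_play_measure refl]) (intro measurable_restrict_subset, simp)
  have restr': "(\<lambda>\<omega>. restrict \<omega> ?J) \<in> measurable (IT.C 0 (Suc k) (\<lambda>_. undefined)) (Pi\<^sub>M ?J (\<lambda>_. count_space UNIV))"
    by (subst measurable_cong_sets[OF IT.sets_C[OF init, of "Suc k", unfolded add_0] refl]) (rule measurable_restrict_subset, simp)
  have comp: "(\<lambda>\<omega>. f (\<omega> k)) \<in> borel_measurable (Pi\<^sub>M ?J (\<lambda>_. count_space UNIV))" for f :: "'s \<times> 'a \<times> 'b \<Rightarrow> ennreal"
    by (rule coordinate_measurable') simp
  fix X :: "('s \<times> 'a \<times> 'b) set"
  let ?f = "indicator X :: 's \<times> 'a \<times> 'b \<Rightarrow> ennreal"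
  have "emeasure (distr (play_measure p \<pi>1 \<pi>2 s0) (count_space UNIV) (\<lambda>\<omega>. \<omega> k)) X = (\<integral>\<^sup>+t. ?f t \<partial>distr (play_measure p \<pi>1 \<pi>2 s0) (count_space UNIV) (\<lambda>\<omega>. \<omega> k))"
    by simp
  also have "\<dots> = (\<integral>\<^sup>+\<omega>. ?f (restrict \<omega> ?J k) \<partial>play_measure p \<pi>1 \<pi>2 s0)"
    by (subst nn_integral_distr[OF coordinate_measurable]) auto
  also have "\<dots> = (\<integral>\<^sup>+\<omega>. ?f (\<omega> k) \<partial>distr (play_measure p \<pi>1 \<pi>2 s0) (Pi\<^sub>M ?J (\<lambda>_. count_space UNIV)) (\<lambda>\<omega>. restrict \<omega> ?J))"
    by (rule nn_integral_distr[OF restr, symmetric]) (subst measurable_distr_eq1, rule comp)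
  also have "\<dots> = (\<integral>\<^sup>+\<omega>. ?f (\<omega> k) \<partial>distr (IT.C 0 (Suc k) (\<lambda>_. undefined)) (Pi\<^sub>M ?J (\<lambda>_. count_space UNIV)) (\<lambda>\<omega>. restrict \<omega> ?J))"
    unfolding play_measure_eq_lim by (simp add: IT.distr_lim IT.CI_def up_to)
  also have "\<dots> = (\<integral>\<^sup>+\<omega>. ?f (restrict \<omega> ?J k) \<partial>IT.C 0 (Suc k) (\<lambda>_. undefined))"
    by (rule nn_integral_distr[OF restr']) (subst measurable_distr_eq1, rule comp)
  also have "\<dots> = (\<integral>\<^sup>+t. ?f t \<partial>play_marginal p \<pi>1 \<pi>2 s0 k)"
    using nn_integral_C_coordinate[where f="?f" and k=k] by simp
  finally show "emeasure (distr (play_measure p \<pi>1 \<pi>2 s0) (count_space UNIV) (\<lambda>\<omega>. \<omega> k)) X = emeasure (play_marginal p \<pi>1 \<pi>2 s0 k) X"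
    by simp
qed simp

lemma discounted_payoff_sums:
  assumes \<gamma>: "0 \<le> \<gamma>" "\<gamma> < 1"
  shows "(\<lambda>k. \<gamma> ^ k * measure_pmf.expectation (play_marginal p \<pi>1 \<pi>2 s0 k) (\<lambda>(s, a, b). r s a b))
    sums discounted_payoff r p \<gamma> \<pi>1 \<pi>2 s0"
proof -
  let ?M = "play_measure p \<pi>1 \<pi>2 s0"
  let ?r = "\<lambda>(s, a, b). r s a b"
  interpret prob_space ?M by (rule prob_space_play_measure)
  define R where "R = Max (range (\<lambda>t. \<bar>?r t\<bar>))"
  have R: "\<bar>?r t\<bar> \<le> R" for t unfolding R_def by (intro Max_ge) auto
  have meas: "(\<lambda>\<omega>. \<gamma> ^ k * ?r (\<omega> k)) \<in> borel_measurable ?M" for k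
    by (intro borel_measurable_times borel_measurable_const measurable_compose[OF coordinate_measurable]) simp
  have bound: "norm (\<gamma> ^ k * ?r (\<omega> k)) \<le> \<gamma> ^ k * R" for k \<omega>
    using \<gamma> R[of "\<omega> k"] by (simp add: abs_mult mult_left_mono)
  have int: "integrable ?M (\<lambda>\<omega>. \<gamma> ^ k * ?r (\<omega> k))" for k
    by (rule integrable_const_bound[of _ "\<gamma> ^ k * R"]) (use bound meas in auto)
  have summable: "summable (\<lambda>k. \<gamma> ^ k * R)"
    using \<gamma> by (intro summable_mult2 summable_geometric) simp
  have "(\<lambda>k. \<integral>\<omega>. \<gamma> ^ k * ?r (\<omega> k) \<partial>?M) sums (\<integral>\<omega>. (\<Sum>k. \<gamma> ^ k * ?r (\<omega> k)) \<partial>?M)"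
  proof (rule sums_integral[OF int])
    show "AE \<omega> in ?M. summable (\<lambda>k. norm (\<gamma> ^ k * ?r (\<omega> k)))"
      by (intro AE_I2 summable_comparison_test'[OF summable, of 0]) (use bound in auto)
    show "summable (\<lambda>k. \<integral>\<omega>. norm (\<gamma> ^ k * ?r (\<omega> k)) \<partial>?M)"
    proof (rule summable_comparison_test'[OF summable, of 0])
      fix k :: nat
      have "(\<integral>\<omega>. norm (\<gamma> ^ k * ?r (\<omega> k)) \<partial>?M) \<le> (\<integral>\<omega>. \<gamma> ^ k * R \<partial>?M)"
        by (intro integral_mono integrable_norm int) (use bound in auto)
      then show "norm (\<integral>\<omega>. norm (\<gamma> ^ k * ?r (\<omega> k)) \<partial>?M) \<le> \<gamma> ^ k * R"
        by (simp add: prob_space)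
    qed
  qed
  moreover have "(\<integral>\<omega>. \<gamma> ^ k * ?r (\<omega> k) \<partial>?M) = \<gamma> ^ k * measure_pmf.expectation (play_marginal p \<pi>1 \<pi>2 s0 k) ?r" for k
    unfolding distr_play_coordinate[symmetric]
    by (subst integral_distr[OF coordinate_measurable]) auto
  ultimately show ?thesis unfolding discounted_payoff_def by (simp only:)
qed

text \<open>
  A verification argument: a current payoff plus the discounted expectation of \<open>w\<close> at the next state is
  on average at most \<open>w\<close> at the current state, so the discounted payoffs telescope.
\<close>

lemma discounted_payoff_upper_bound:
  assumes \<gamma>: "0 \<le> \<gamma>" "\<gamma> < 1"
    and w: "\<And>s. measure_pmf.expectation (stage_pmf \<pi>1 \<pi>2 s) (\<lambda>(s, a, b). continuation r p \<gamma> w s a b) \<le> w s"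
  shows "discounted_payoff r p \<gamma> \<pi>1 \<pi>2 s0 \<le> w s0"
proof -
  define E where "E k f = measure_pmf.expectation (play_marginal p \<pi>1 \<pi>2 s0 k) f" for k and f :: "'s \<times> 'a \<times> 'b \<Rightarrow> real"
  let ?r = "\<lambda>(s, a, b). r s a b" and ?q = "\<lambda>(s, a, b). continuation r p \<gamma> w s a b"
  let ?W = "\<lambda>k. E k (\<lambda>t. w (fst t))"
  have stage_w: "measure_pmf.expectation (stage_pmf \<pi>1 \<pi>2 s) (\<lambda>t. w (fst t)) = w s" for s
    by (simp add: stage_pmf_def)
  have step_eq: "measure_pmf.expectation (play_step p \<pi>1 \<pi>2 (s, a, b)) f =
      measure_pmf.expectation (p s a b) (\<lambda>s'. measure_pmf.expectation (stage_pmf \<pi>1 \<pi>2 s') f)" for s a b and f :: "'s \<times> 'a \<times> 'b \<Rightarrow> real"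
    by (simp add: play_step_def expectation_bind_pmf)
  have q_le: "E k ?q \<le> ?W k" for k
  proof (cases k)
    case 0
    then show ?thesis using w[of s0] by (simp add: E_def stage_w)
  next
    case (Suc n)
    show ?thesis unfolding E_def Suc play_marginal.simps expectation_bind_pmf
    proof (rule expectation_mono)
      fix t :: "'s \<times> 'a \<times> 'b"
      show "measure_pmf.expectation (play_step p \<pi>1 \<pi>2 t) ?q \<le> measure_pmf.expectation (play_step p \<pi>1 \<pi>2 t) (\<lambda>t. w (fst t))"
        by (cases t) (simp only: step_eq stage_w, intro expectation_mono w)
    qed
  qed
  have W_Suc: "E k ?q = E k ?r + \<gamma> * ?W (Suc k)" for k
  proof -
    have "?q t = ?r t + \<gamma> * measure_pmf.expectation (play_step p \<pi>1 \<pi>2 t) (\<lambda>t. w (fst t))" for t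
      by (cases t) (simp only: step_eq stage_w, simp add: continuation_def expectation_finite_sum)
    then have "E k ?q = E k (\<lambda>t. ?r t + \<gamma> * measure_pmf.expectation (play_step p \<pi>1 \<pi>2 t) (\<lambda>t. w (fst t)))"
      by (intro arg_cong[where f="E k"] ext)
    also have "\<dots> = E k ?r + \<gamma> * ?W (Suc k)"
      unfolding E_def play_marginal.simps expectation_bind_pmf
      by (simp add: expectation_finite_sum[where M="play_marginal p \<pi>1 \<pi>2 s0 k"] sum.distrib distrib_left sum_distrib_left mult_ac)
    finally show ?thesis .
  qed
  have partial: "(\<Sum>k<n. \<gamma> ^ k * E k ?r) \<le> w s0 - \<gamma> ^ n * ?W n" for n
  proof (induction n)
    case 0
    then show ?case by (simp add: E_def stage_w)
  next
    case (Suc n)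
    have "E n ?r \<le> ?W n - \<gamma> * ?W (Suc n)" using q_le[of n] W_Suc[of n] by simp
    then have "\<gamma> ^ n * E n ?r \<le> \<gamma> ^ n * (?W n - \<gamma> * ?W (Suc n))"
      using \<gamma> by (intro mult_left_mono) auto
    with Suc show ?case by (simp add: algebra_simps)
  qed
  define B where "B = Max (range (\<lambda>s. \<bar>w s\<bar>))"
  have B: "\<bar>w s\<bar> \<le> B" for s unfolding B_def by (intro Max_ge) auto
  have "- B \<le> ?W n" for n
  proof -
    have "E n (\<lambda>_. - B) \<le> ?W n"
      unfolding E_def by (rule expectation_mono) (use B in \<open>simp add: abs_le_iff minus_le_iff\<close>)
    then show ?thesis by (simp add: E_def)
  qed
  then have "\<gamma> ^ n * (- B) \<le> \<gamma> ^ n * ?W n" for n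
    using \<gamma> by (intro mult_left_mono) auto
  with partial have le: "(\<Sum>k<n. \<gamma> ^ k * E k ?r) \<le> w s0 + \<gamma> ^ n * B" for n
    by (smt (verit) mult_minus_right)
  have "(\<lambda>n. w s0 + \<gamma> ^ n * B) \<longlonglongrightarrow> w s0 + 0 * B"
    using \<gamma> by (intro tendsto_intros LIMSEQ_power_zero) simp
  moreover have "(\<lambda>n. \<Sum>k<n. \<gamma> ^ k * E k ?r) \<longlonglongrightarrow> discounted_payoff r p \<gamma> \<pi>1 \<pi>2 s0"
    using discounted_payoff_sums[OF \<gamma>, of r] by (simp add: sums_def E_def)
  ultimately show ?thesis using le LIMSEQ_le[of _ "discounted_payoff r p \<gamma> \<pi>1 \<pi>2 s0" _ "w s0 + 0 * B"] by auto
qed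

lemma discounted_payoff_uminus:
  assumes "0 \<le> \<gamma>" "\<gamma> < 1"
  shows "discounted_payoff (\<lambda>s a b. - r s a b) p \<gamma> \<pi>1 \<pi>2 s0 = - discounted_payoff r p \<gamma> \<pi>1 \<pi>2 s0"
proof (rule sums_unique2[OF discounted_payoff_sums[OF assms]])
  have "(\<lambda>(s, a, b). - r s a b) = (\<lambda>t. - (case t of (s, a, b) \<Rightarrow> r s a b))"
    by auto
  then show "(\<lambda>k. \<gamma> ^ k * measure_pmf.expectation (play_marginal p \<pi>1 \<pi>2 s0 k) (\<lambda>(s, a, b). - r s a b))
    sums (- discounted_payoff r p \<gamma> \<pi>1 \<pi>2 s0)"
    using sums_minus[OF discounted_payoff_sums[OF assms, of r]] by simp
qed

end

lemma expectation_stage_pmf: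
  fixes \<pi>1 :: "('s::finite, 'a::finite) strategy" and \<pi>2 :: "('s, 'b::finite) strategy" and q :: "'s \<Rightarrow> 'a \<Rightarrow> 'b \<Rightarrow> real"
  shows "measure_pmf.expectation (stage_pmf \<pi>1 \<pi>2 s) (\<lambda>(s, a, b). q s a b) = (\<Sum>a\<in>UNIV. pmf (\<pi>1 s) a * action_value (q s) (\<pi>2 s) a)"
    and "measure_pmf.expectation (stage_pmf \<pi>1 \<pi>2 s) (\<lambda>(s, a, b). q s a b) = (\<Sum>b\<in>UNIV. pmf (\<pi>2 s) b * action_value (\<lambda>b a. q s a b) (\<pi>1 s) b)"
proof -
  have "measure_pmf.expectation (stage_pmf \<pi>1 \<pi>2 s) (\<lambda>(s, a, b). q s a b) =
      (\<Sum>a\<in>UNIV. \<Sum>b\<in>UNIV. pmf (\<pi>1 s) a * pmf (\<pi>2 s) b * q s a b)"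
  proof -
    have "measure_pmf.expectation (stage_pmf \<pi>1 \<pi>2 s) (\<lambda>(s, a, b). q s a b) =
        (\<Sum>t\<in>UNIV \<times> UNIV. pmf (pair_pmf (\<pi>1 s) (\<pi>2 s)) t * (case t of (a, b) \<Rightarrow> q s a b))"
      unfolding stage_pmf_def integral_map_pmf unfolding expectation_finite_sum by (simp add: split_def)
    also have "\<dots> = (\<Sum>(a, b)\<in>UNIV \<times> UNIV. pmf (\<pi>1 s) a * pmf (\<pi>2 s) b * q s a b)"
      by (intro sum.cong refl) (auto simp: pmf_pair)
    finally show ?thesis by (simp add: sum.cartesian_product)
  qed
  moreover note sum.swap[of "\<lambda>a b. pmf (\<pi>1 s) a * pmf (\<pi>2 s) b * q s a b" UNIV UNIV]
  ultimately show "measure_pmf.expectation (stage_pmf \<pi>1 \<pi>2 s) (\<lambda>(s, a, b). q s a b) = (\<Sum>a\<in>UNIV. pmf (\<pi>1 s) a * action_value (q s) (\<pi>2 s) a)"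
    and "measure_pmf.expectation (stage_pmf \<pi>1 \<pi>2 s) (\<lambda>(s, a, b). q s a b) = (\<Sum>b\<in>UNIV. pmf (\<pi>2 s) b * action_value (\<lambda>b a. q s a b) (\<pi>1 s) b)"
    by (simp_all add: action_value_eq_sum sum_distrib_left mult_ac)
qed

lemma expectation_le_const:
  assumes "\<And>u::'u::finite. f u \<le> (c::real)"
  shows "(\<Sum>u\<in>UNIV. pmf M u * f u) \<le> c"
proof -
  have "(\<Sum>u\<in>UNIV. pmf M u * f u) \<le> (\<Sum>u\<in>UNIV. pmf M u * c)"
    by (intro sum_mono mult_left_mono assms) simp
  then show ?thesis by (simp add: sum_pmf_eq_1 flip: sum_distrib_right)
qed

text \<open>
  Each player's strategy bounds the payoff of player 1 by \<open>w\<close> from one side against every strategy of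
  the opponent, so \<open>(e1, e2)\<close> is a saddle point.
\<close>

theorem optimal_profile_is_equilibrium:
  fixes r :: "'s::finite \<Rightarrow> 'a::finite \<Rightarrow> 'b::finite \<Rightarrow> real"
  assumes \<gamma>: "0 \<le> \<gamma>" "\<gamma> < 1"
    and e1: "\<And>s. best_value (\<lambda>b a. - continuation r p \<gamma> w s a b) (e1 s) \<le> - w s"
    and e2: "\<And>s. best_value (continuation r p \<gamma> w s) (e2 s) \<le> w s"
  shows "stationary_equilibrium r (\<lambda>s a b. - r s a b) p \<gamma> e1 e2"
proof -
  have upper: "discounted_payoff r p \<gamma> \<sigma>1 e2 s0 \<le> w s0" for \<sigma>1 s0
  proof (rule discounted_payoff_upper_bound[OF \<gamma>])
    fix s show "measure_pmf.expectation (stage_pmf \<sigma>1 e2 s) (\<lambda>(s, a, b). continuation r p \<gamma> w s a b) \<le> w s"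
      unfolding expectation_stage_pmf(1)
      by (rule expectation_le_const) (rule order_trans[OF action_value_le_best_value e2])
  qed
  have lower: "w s0 \<le> discounted_payoff r p \<gamma> e1 \<sigma>2 s0" for \<sigma>2 s0
  proof -
    have cont: "continuation (\<lambda>s a b. - r s a b) p \<gamma> (\<lambda>s. - w s) = (\<lambda>s a b. - continuation r p \<gamma> w s a b)"
      by (simp add: continuation_def fun_eq_iff sum_negf)
    have "discounted_payoff (\<lambda>s a b. - r s a b) p \<gamma> e1 \<sigma>2 s0 \<le> - w s0"
    proof (rule discounted_payoff_upper_bound[OF \<gamma>])
      fix s show "measure_pmf.expectation (stage_pmf e1 \<sigma>2 s) (\<lambda>(s, a, b). continuation (\<lambda>s a b. - r s a b) p \<gamma> (\<lambda>s. - w s) s a b) \<le> - w s"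
        unfolding cont expectation_stage_pmf(2)
        by (rule expectation_le_const) (rule order_trans[OF action_value_le_best_value e1])
    qed
    then show ?thesis by (simp add: discounted_payoff_uminus[OF \<gamma>])
  qed
  show ?thesis unfolding stationary_equilibrium_def discounted_payoff_uminus[OF \<gamma>]
    using order_trans[OF upper lower] by (auto intro: order_trans[OF upper lower])
qed

section \<open>Convergence of the learning dynamics\<close>

lemma best_value_of_convergent_payoffs:
  fixes q :: "nat \<Rightarrow> 'x::finite \<Rightarrow> 'y::finite \<Rightarrow> real"
  assumes q: "\<And>x y. (\<lambda>k. q k x y) \<longlonglongrightarrow> q' x y" and lim: "(\<lambda>k. best_value (q k) (\<mu> k)) \<longlonglongrightarrow> c"
  shows "(\<lambda>k. best_value q' (\<mu> k)) \<longlonglongrightarrow> c"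
proof -
  define d where "d k = (\<Sum>x\<in>UNIV. \<Sum>y\<in>UNIV. \<bar>q' x y - q k x y\<bar>)" for k
  have d: "\<bar>q' x y - q k x y\<bar> \<le> d k" for k x y
  proof -
    have "\<bar>q' x y - q k x y\<bar> \<le> (\<Sum>y\<in>UNIV. \<bar>q' x y - q k x y\<bar>)"
      by (rule member_le_sum[where f="\<lambda>y. \<bar>q' x y - q k x y\<bar>"]) auto
    also have "\<dots> \<le> d k"
      unfolding d_def by (rule member_le_sum[where f="\<lambda>x. \<Sum>y\<in>UNIV. \<bar>q' x y - q k x y\<bar>"]) (auto intro: sum_nonneg)
    finally show ?thesis .
  qed
  have "d \<longlonglongrightarrow> (\<Sum>x\<in>(UNIV::'x set). \<Sum>y\<in>(UNIV::'y set). \<bar>q' x y - q' x y\<bar>)"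
    unfolding d_def by (intro tendsto_intros q)
  then have d0: "d \<longlonglongrightarrow> 0" by simp
  have "norm (best_value q' (\<mu> k) - best_value (q k) (\<mu> k)) \<le> d k" for k
  proof -
    have "q' x y \<le> q k x y + d k" "q k x y \<le> q' x y + d k" for x y
      using d[of x y k] by linarith+
    then show ?thesis
      using best_value_mono[of q' "q k" "d k" "\<mu> k"] best_value_mono[of "q k" q' "d k" "\<mu> k"] by simp
  qed
  then have "(\<lambda>k. best_value q' (\<mu> k) - best_value (q k) (\<mu> k)) \<longlonglongrightarrow> 0"
    by (intro Lim_null_comparison[OF always_eventually[OF allI] d0])
  from tendsto_add[OF this lim] show ?thesis by simp
qed

text \<open>
  Removes the choice of the slower player: the ratio is expressed for player 2 over player 1
  throughout, at the price of a parameter \<open>\<rho>\<close> on either side of \<open>1\<close>.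
\<close>

lemma ratio_limit_parameter:
  fixes f :: "player \<Rightarrow> nat \<Rightarrow> real"
  assumes "0 < d" "d \<le> 1" "(\<lambda>c. f i c / f (opp i) c) \<longlonglongrightarrow> d"
  obtains \<rho> where "0 < \<rho>" "(\<lambda>c. f P2 c / f P1 c) \<longlonglongrightarrow> 1 / \<rho>" "max 1 \<rho> / min 1 \<rho> = 1 / d"
proof (cases i)
  case P1
  have "(\<lambda>c. inverse (f P1 c / f P2 c)) \<longlonglongrightarrow> inverse d"
    using assms P1 by (intro tendsto_inverse) auto
  then show thesis
    using assms by (intro that[of d]) (auto simp: max_def min_def inverse_eq_divide)
next
  case P2
  have "1 \<le> 1 / d" using assms by simp
  then show thesis
    using assms P2 by (intro that[of "1 / d"]) (auto simp: max_def min_def)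
qed

theorem theorem4:
  fixes r1 r2 :: "'s::finite \<Rightarrow> 'a::finite \<Rightarrow> 'b::finite \<Rightarrow> real"
    and p :: "'s \<Rightarrow> 'a \<Rightarrow> 'b \<Rightarrow> 's pmf"
    and \<gamma> :: real
    and \<alpha> \<beta> :: "player \<Rightarrow> nat \<Rightarrow> real"
    and M :: "'w measure" and F :: "nat \<Rightarrow> 'w measure"
    and S :: "nat \<Rightarrow> 'w \<Rightarrow> 's"
    and A1 :: "nat \<Rightarrow> 'w \<Rightarrow> 'a" and A2 :: "nat \<Rightarrow> 'w \<Rightarrow> 'b"
    and \<pi>1 :: "nat \<Rightarrow> 'w \<Rightarrow> ('s, 'a) strategy" and \<pi>2 :: "nat \<Rightarrow> 'w \<Rightarrow> ('s, 'b) strategy"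
    and Q1 Q2 :: "nat \<Rightarrow> 'w \<Rightarrow> 's \<Rightarrow> 'a \<Rightarrow> 'b \<Rightarrow> real"
    and i j :: player
    and d\<alpha> d\<beta> :: real
  assumes "0 \<le> \<gamma>" and "\<gamma> < 1"
    and "zero_sum r1 r2"
    and "\<And>i c. 0 < \<alpha> i c \<and> \<alpha> i c < 1"
    and "\<And>i c. 0 < \<beta> i c \<and> \<beta> i c < 1"
    and "learning_dynamics M F r1 r2 p \<gamma> \<alpha> \<beta> S A1 A2 \<pi>1 \<pi>2 Q1 Q2"
    and "AE \<omega> in M. \<forall>s. infinite {k. S k \<omega> = s}"
    and "\<And>i. \<alpha> i \<longlonglongrightarrow> 0"
    and "\<And>i. \<beta> i \<longlonglongrightarrow> 0"
    and "\<And>i. (\<lambda>c. \<beta> i c / \<alpha> i c) \<longlonglongrightarrow> 0"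
    and "\<And>i. filterlim (\<lambda>n. \<Sum>c<n. \<alpha> i c) at_top sequentially"
    and "\<And>i. filterlim (\<lambda>n. \<Sum>c<n. \<beta> i c) at_top sequentially"
    and "0 < d\<alpha>" and "d\<alpha> \<le> 1" and "(\<lambda>c. \<alpha> i c / \<alpha> (opp i) c) \<longlonglongrightarrow> d\<alpha>"
    and "0 < d\<beta>" and "d\<beta> \<le> 1" and "(\<lambda>c. \<beta> j c / \<beta> (opp j) c) \<longlonglongrightarrow> d\<beta>"
    and "\<gamma> < d\<alpha> * d\<beta>"
  shows "AE \<omega> in M. \<exists>Q1s Q2s e1 e2.
      (\<forall>s a b. (\<lambda>k. Q1 k \<omega> s a b) \<longlonglongrightarrow> Q1s s a b) \<and>
      (\<forall>s a b. (\<lambda>k. Q2 k \<omega> s a b) \<longlonglongrightarrow> Q2s s a b) \<and>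
      (\<forall>k. stationary_equilibrium r1 r2 p \<gamma> (e1 k) (e2 k) \<and>
           is_Q_function r1 p \<gamma> (e2 k) Q1s \<and>
           is_Q_function (swap_actions r2) (swap_actions p) \<gamma> (e1 k) (swap_actions Q2s)) \<and>
      (\<forall>s a. (\<lambda>k. pmf (\<pi>1 k \<omega> s) a - pmf (e1 k s) a) \<longlonglongrightarrow> 0) \<and>
      (\<forall>s b. (\<lambda>k. pmf (\<pi>2 k \<omega> s) b - pmf (e2 k s) b) \<longlonglongrightarrow> 0)"
proof -
  interpret L: learning_dynamics M F r1 r2 p \<gamma> \<alpha> \<beta> S A1 A2 \<pi>1 \<pi>2 Q1 Q2 by fact
  have r2: "r2 = (\<lambda>s a b. - r1 s a b)"
    using assms(3) by (auto simp: zero_sum_def fun_eq_iff add_eq_0_iff)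
  obtain w where w: "\<And>s. game_value (continuation r1 p \<gamma> w s) = w s"
    using Shapley_equation_solvable[OF assms(1,2), of r1 p] by blast
  let ?Q = "continuation r1 p \<gamma> w"
  have swap: "swap_actions r2 = (\<lambda>s j i. - r1 s i j)" "swap_actions p = (\<lambda>s j i. p s i j)"
    by (simp_all add: swap_actions_def r2 fun_eq_iff)
  obtain \<rho> where \<rho>: "0 < \<rho>" "(\<lambda>c. \<alpha> P2 c / \<alpha> P1 c) \<longlonglongrightarrow> 1 / \<rho>" "max 1 \<rho> / min 1 \<rho> = 1 / d\<alpha>"
    by (rule ratio_limit_parameter[OF assms(13-15)])
  obtain \<tau> where \<tau>: "0 < \<tau>" "(\<lambda>c. \<beta> P2 c / \<beta> P1 c) \<longlonglongrightarrow> 1 / \<tau>" "max 1 \<tau> / min 1 \<tau> = 1 / d\<beta>"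
    by (rule ratio_limit_parameter[OF assms(16-18)])
  have contraction: "\<gamma> * (max 1 \<rho> / min 1 \<rho>) * (max 1 \<tau> / min 1 \<tau>) < 1"
    unfolding \<rho>(3) \<tau>(3) using assms(13,16,19) by (simp add: divide_less_eq)
  have Q_opp: "game_value (\<lambda>b a. - ?Q s a b) = - w s" for s
    using minimax[of "?Q s"] w by simp
  have optimal: "is_Q_function r1 p \<gamma> e2 ?Q" if "\<And>s. best_value (?Q s) (e2 s) = w s" for e2
    unfolding is_Q_function_def by (simp add: that) (simp add: continuation_def)
  have optimal_opp: "is_Q_function (swap_actions r2) (swap_actions p) \<gamma> e1 (swap_actions (\<lambda>s a b. - ?Q s a b))"
    if "\<And>s. best_value (\<lambda>b a. - ?Q s a b) (e1 s) = - w s" for e1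
    unfolding is_Q_function_def swap_actions_def r2
    by (simp add: that) (simp add: continuation_def sum_negf)
  have "AE \<omega> in M. \<omega> \<in> space M" by simp
  with assms(7) show ?thesis
  proof eventually_elim
    case (elim \<omega>)
    interpret Z: zero_sum_learning_paths r1 p \<gamma> "\<alpha> P1" "\<beta> P1" "\<alpha> P2" "\<beta> P2" "\<lambda>k. S k \<omega>" "\<lambda>k. A1 k \<omega>" "\<lambda>k. A2 k \<omega>"
      "\<lambda>k. \<pi>1 k \<omega>" "\<lambda>k. \<pi>2 k \<omega>" "\<lambda>k. Q1 k \<omega>" "\<lambda>k. swap_actions (Q2 k \<omega>)" w \<rho> \<tau>
    proof (unfold_locales)
      show "learning_path r1 p \<gamma> (\<alpha> P1) (\<beta> P1) (\<lambda>k. S k \<omega>) (\<lambda>k. A1 k \<omega>) (\<lambda>k. A2 k \<omega>) (\<lambda>k. \<pi>2 k \<omega>) (\<lambda>k. Q1 k \<omega>)"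
        by (rule L.path1) (rule elim)
      show "learning_path (\<lambda>s j i. - r1 s i j) (\<lambda>s j i. p s i j) \<gamma> (\<alpha> P2) (\<beta> P2) (\<lambda>k. S k \<omega>) (\<lambda>k. A2 k \<omega>) (\<lambda>k. A1 k \<omega>)
          (\<lambda>k. \<pi>1 k \<omega>) (\<lambda>k. swap_actions (Q2 k \<omega>))"
        using L.path2[OF elim(2)] unfolding swap .
    qed (use assms elim \<rho> \<tau> contraction w in auto)
    note conv = Z.convergence
    have "\<exists>e. (\<forall>k. best_value (?Q s) (e k) = w s) \<and> (\<forall>b. (\<lambda>k. pmf (\<pi>2 k \<omega> s) b - pmf (e k) b) \<longlonglongrightarrow> 0)" for s
    proof -
      have "(\<lambda>k. best_value (?Q s) (\<pi>2 k \<omega> s)) \<longlonglongrightarrow> game_value (?Q s)"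
        unfolding w by (rule best_value_of_convergent_payoffs[OF conv(1,3)])
      then show ?thesis by (rule asymptotically_optimal) (auto simp: w)
    qed
    then have "\<forall>s. \<exists>e. (\<forall>k. best_value (?Q s) (e k) = w s) \<and> (\<forall>b. (\<lambda>k. pmf (\<pi>2 k \<omega> s) b - pmf (e k) b) \<longlonglongrightarrow> 0)" ..
    from choice[OF this]
    obtain e2 where e2_all: "\<forall>s. (\<forall>k. best_value (?Q s) (e2 s k) = w s) \<and> (\<forall>b. (\<lambda>k. pmf (\<pi>2 k \<omega> s) b - pmf (e2 s k) b) \<longlonglongrightarrow> 0)"
      by (elim exE) (rule that)
    have e2: "best_value (?Q s) (e2 s k) = w s" "(\<lambda>k. pmf (\<pi>2 k \<omega> s) b - pmf (e2 s k) b) \<longlonglongrightarrow> 0" for s k b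
      using e2_all by simp_all
    have "\<exists>e. (\<forall>k. best_value (\<lambda>b a. - ?Q s a b) (e k) = - w s) \<and> (\<forall>a. (\<lambda>k. pmf (\<pi>1 k \<omega> s) a - pmf (e k) a) \<longlonglongrightarrow> 0)" for s
    proof -
      have "(\<lambda>k. best_value (\<lambda>b a. - ?Q s a b) (\<pi>1 k \<omega> s)) \<longlonglongrightarrow> game_value (\<lambda>b a. - ?Q s a b)"
        unfolding Q_opp by (rule best_value_of_convergent_payoffs[OF conv(2,4)])
      then show ?thesis by (rule asymptotically_optimal) (auto simp: Q_opp)
    qed
    then have "\<forall>s. \<exists>e. (\<forall>k. best_value (\<lambda>b a. - ?Q s a b) (e k) = - w s) \<and> (\<forall>a. (\<lambda>k. pmf (\<pi>1 k \<omega> s) a - pmf (e k) a) \<longlonglongrightarrow> 0)" ..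
    from choice[OF this]
    obtain e1 where e1_all: "\<forall>s. (\<forall>k. best_value (\<lambda>b a. - ?Q s a b) (e1 s k) = - w s) \<and> (\<forall>a. (\<lambda>k. pmf (\<pi>1 k \<omega> s) a - pmf (e1 s k) a) \<longlonglongrightarrow> 0)"
      by (elim exE) (rule that)
    have e1: "best_value (\<lambda>b a. - ?Q s a b) (e1 s k) = - w s" "(\<lambda>k. pmf (\<pi>1 k \<omega> s) a - pmf (e1 s k) a) \<longlonglongrightarrow> 0" for s k a
      using e1_all by simp_all
    have Q2: "(\<lambda>k. Q2 k \<omega> s a b) \<longlonglongrightarrow> - ?Q s a b" for s a b
      using conv(2)[of s b a] by (simp add: swap_actions_def)
    have eq: "stationary_equilibrium r1 r2 p \<gamma> (\<lambda>s. e1 s k) (\<lambda>s. e2 s k)" for k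
      unfolding r2 by (rule optimal_profile_is_equilibrium[OF assms(1,2), where w=w]) (simp_all add: e1(1) e2(1))
    show ?case
      by (rule exI[of _ ?Q], rule exI[of _ "\<lambda>s a b. - ?Q s a b"], rule exI[of _ "\<lambda>k s. e1 s k"], rule exI[of _ "\<lambda>k s. e2 s k"],
          intro conjI allI conv(1) Q2 eq optimal optimal_opp e1 e2)
  qed
qed

end
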